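(* Let $\mathbb{K}$ be $\mathbb{R}$ or $\mathbb{C}$, and let $M\in\mathbb{K}^{q\times p}$ be either invertible or surjective (i.e. $M$ has full rank and $p\ge q\ge 1$). Let $f_n(\mathcal{X}_1,\dots,\mathcal{X}_k)$ be a tensor polynomial under the $*_M$-product, where $\mathcal{X}_1,\dots,\mathcal{X}_k$ are $k$ independent $n\times n\times p$ tensor indeterminates. Let $\operatorname{ev}_{f_n}$ be the tensor polynomial evaluation problem, i.e. the problem of evaluating $f_n$ at arbitrary tensors $\mathcal{A}_1,\dots,\mathcal{A}_k\in\mathbb{K}^{n\times n\times p}$. Then $$\widehat{\omega}(\operatorname{ev}_{f_n})=\widehat{\omega}(\operatorname{TM}_{\langle n\rangle,p,q})=\omega(\operatorname{M}_{\langle n\rangle}),$$ where $\operatorname{TM}_{\langle n\rangle,p,q}:\mathbb{K}^{n\times n\times p}\times\mathbb{K}^{n\times n\times p}\to\mathbb{K}^{n\times n\times p}$, $(\mathcal{A},\mathcal{B})\mapsto\mathcal{A}*_M\mathcal{B}$, is the tensor-tensor multiplication map with $M$, and $\operatorname{M}_{\langle n\rangle}:\mathbb{K}^{n\times n}\times\mathbb{K}^{n\times n}\to\mathbb{K}^{n\times n}$, $(A,B)\mapsto AB$, is matrix multiplication.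
   Context: Mode-3 product: for $\mathcal{A}=[a_{ijk}]\in\mathbb{K}^{m\times n\times p}$ and $N=[n_{kl}]\in\mathbb{K}^{r\times p}$, $\mathcal{A}\times_3 N\in\mathbb{K}^{m\times n\times r}$ has entries $(\mathcal{A}\times_3 N)_{ijk}=\sum_{l=1}^p n_{kl}a_{ijl}$. The $i$-th frontal slice $\mathcal{A}^{(i)}$ of $\mathcal{A}\in\mathbb{K}^{m\times n\times p}$ is the $m\times n$ matrix obtained by fixing the third index equal to $i$. Face-wise product: $(\mathcal{A}\triangle\mathcal{B})^{(i)}=\mathcal{A}^{(i)}\mathcal{B}^{(i)}$ for all $i$. Tensor-tensor multiplication: for $M\in\mathbb{K}^{q\times p}$ of full rank $q\le p$, $\mathcal{A}*_M\mathcal{B}=((\mathcal{A}\times_3 M)\triangle(\mathcal{B}\times_3 M))\times_3 M^+$, where $M^+=M^H(MM^H)^{-1}$ is the Moore-Penrose inverse ($M^+=M^{-1}$ if $p=q$; $M^H$ is the conjugate transpose). This product is bilinear over $\mathbb{K}$ and associative. Tensor polynomial: the analogue, with matrix multiplication replaced by the $*_M$-product, of a matrix polynomial $f_n(X_1,\dots,X_k)$ in $k$ independent noncommuting $n\times n$ matrix indeterminates (for instance $X_1X_2X_1+X_3^2+3I_n$ for $k=3$); that is, a polynomial expression in the noncommuting indeterminates $\mathcal{X}_1,\dots,\mathcal{X}_k$ in which all products are $*_M$-products and a constant tensor term in $\mathbb{K}^{n\times n\times p}$ is allowed. The exponents below refer to the sequences indexed by $n$, with $p$, $q$, $M$ and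 the polynomial fixed. Tensor rank: for a bilinear map $T:U\times V\to W$ of finite-dimensional $\mathbb{K}$-vector spaces, $\mathbf{R}(T)$ is the least $r$ such that $T(u,v)=\sum_{i=1}^r\alpha_i(u)\beta_i(v)w_i$ for some $\alpha_i\in U^*$, $\beta_i\in V^*$, $w_i\in W$. For a sequence $(T_n)$ of bilinear maps, $\omega(T_n)=\inf\{\tau\mid \mathbf{R}(T_n)=O(n^\tau)\}$. Total complexity: for a rational map $\varphi:\mathbb{K}^a\to\mathbb{K}^b$, $\mathbf{L}(\varphi)$ is the minimal total number of additions, subtractions, multiplications, divisions and multiplications by constants needed to compute all components of $\varphi$ from the input coordinates. For a sequence $(\varphi_n)$ of rational maps, $\widehat{\omega}(\varphi_n)=\inf\{\tau\mid\mathbf{L}(\varphi_n)=O(n^\tau)\}$.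
   Formalization: The tensor polynomial is required to have degree at least 2 (some product of two or more indeterminates has a nonzero coefficient); for a constant polynomial or for X_1 evaluation costs no operations and the claimed equality fails. *)

theory Defs
  imports
    "HOL-Library.Landau_Symbols"
    "HOL-Library.Extended_Real"
    "HOL-Library.Poly_Mapping"
    "Jordan_Normal_Form.DL_Rank"
    "Jordan_Normal_Form.Gauss_Jordan_Elimination"
    "Jordan_Normal_Form.Schur_Decomposition"
begin

section \<open>Coordinate spaces\<close>

text \<open>
  Dimensions vary with \<open>n\<close>, so \<open>K\<^sup>I\<close> for a finite index set \<open>I\<close> is the set of functions that vanish
  outside \<open>I\<close>. An \<open>n \<times> n\<close> matrix is a point of \<open>K\<^sup>I\<close> with \<open>I = matrix_ix n\<close>, an \<open>n \<times> n \<times> p\<close> tensor one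
  with \<open>I = tensor_ix n p\<close>. All indices start at 0.
\<close>

definition coord_space :: "'i set \<Rightarrow> ('i \<Rightarrow> 'k::zero) set" where
  "coord_space I = {u. \<forall>i. i \<notin> I \<longrightarrow> u i = 0}"

definition matrix_ix :: "nat \<Rightarrow> (nat \<times> nat) set" where
  "matrix_ix n = {..<n} \<times> {..<n}"

definition tensor_ix :: "nat \<Rightarrow> nat \<Rightarrow> (nat \<times> nat \<times> nat) set" where
  "tensor_ix n p = {..<n} \<times> {..<n} \<times> {..<p}"

definition entries :: "'k::zero mat \<Rightarrow> nat \<times> nat \<Rightarrow> 'k" where
  "entries A = (\<lambda>(i, j). if i < dim_row A \<and> j < dim_col A then A $$ (i, j) else 0)"

definition matrix_mult :: "nat \<Rightarrow> (nat \<times> nat \<Rightarrow> 'k::field) \<Rightarrow> (nat \<times> nat \<Rightarrow> 'k) \<Rightarrow> nat \<times> nat \<Rightarrow> 'k" where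
  "matrix_mult n A B = entries (mat n n A * mat n n B)"


section \<open>Tensor-tensor multiplication\<close>

type_synonym 'k tensor = "nat \<times> nat \<times> nat \<Rightarrow> 'k"

definition mode3_prod :: "'k::field tensor \<Rightarrow> 'k mat \<Rightarrow> 'k tensor" (infixl "\<times>\<^sub>3" 70) where
  "A \<times>\<^sub>3 N = (\<lambda>(i, j, k). if k < dim_row N then \<Sum>l<dim_col N. N $$ (k, l) * A (i, j, l) else 0)"

definition frontal_slice :: "nat \<Rightarrow> 'k tensor \<Rightarrow> nat \<Rightarrow> 'k mat" where
  "frontal_slice n A l = mat n n (\<lambda>(i, j). A (i, j, l))"

definition facewise_prod :: "nat \<Rightarrow> 'k::field tensor \<Rightarrow> 'k tensor \<Rightarrow> 'k tensor" where
  "facewise_prod n A B = (\<lambda>(i, j, l). entries (frontal_slice n A l * frontal_slice n B l) (i, j))"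

text \<open>
  The Moore-Penrose inverse of a real or complex matrix of full row rank; then \<open>M M\<^sup>H\<close> is invertible
  and \<open>mat_inverse\<close> returns its inverse.
\<close>

definition pinv :: "'k::conjugatable_field mat \<Rightarrow> 'k mat" where
  "pinv M = mat_adjoint M * the (mat_inverse (M * mat_adjoint M))"

definition tensor_mult :: "nat \<Rightarrow> 'k::conjugatable_field mat \<Rightarrow> 'k tensor \<Rightarrow> 'k tensor \<Rightarrow> 'k tensor" where
  "tensor_mult n M A B = facewise_prod n (A \<times>\<^sub>3 M) (B \<times>\<^sub>3 M) \<times>\<^sub>3 pinv M"


section \<open>Tensor polynomials\<close>

text \<open>
  A tensor polynomial in the noncommuting indeterminates numbered \<open>0, \<dots>, k - 1\<close> is a constant tensor
  plus a finite \<open>K\<close>-linear combination \<open>f\<close> of nonempty words in these indeterminates. The algebra of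
  tensors has no unit in general, so the empty word is excluded and constants enter only
  through the constant tensor. The family \<open>f\<^sub>n\<close> has the same word coefficients for all \<open>n\<close>; the constant
  tensor (for example \<open>3 I\<^sub>n\<close> when \<open>p = 1\<close>) necessarily depends on \<open>n\<close> and is given by the
  sequence \<open>C\<close>.
\<close>

definition tensor_polynomial ::
    "nat \<Rightarrow> nat \<Rightarrow> (nat list \<Rightarrow>\<^sub>0 'k::zero) \<Rightarrow> (nat \<Rightarrow> 'k tensor) \<Rightarrow> bool" where
  "tensor_polynomial k p f C \<longleftrightarrow>
     (\<forall>w\<in>Poly_Mapping.keys f. w \<noteq> [] \<and> set w \<subseteq> {..<k}) \<and> (\<forall>n. C n \<in> coord_space (tensor_ix n p))"

text \<open>
  Degree at least 2. An affine polynomial is evaluated without any \<open>*\<^sub>M\<close>-product, in \<open>O(n\<^sup>2)\<close>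
  operations.
\<close>

definition nonlinear :: "(nat list \<Rightarrow>\<^sub>0 'k::zero) \<Rightarrow> bool" where
  "nonlinear f \<longleftrightarrow> (\<exists>w\<in>Poly_Mapping.keys f. 2 \<le> length w)"

text \<open>The value on the empty word is irrelevant. The bracketing is immaterial by associativity.\<close>

fun word_prod :: "nat \<Rightarrow> 'k::conjugatable_field mat \<Rightarrow> (nat \<Rightarrow> 'k tensor) \<Rightarrow> nat list \<Rightarrow> 'k tensor" where
  "word_prod n M X [] = (\<lambda>_. 0)"
| "word_prod n M X [s] = X s"
| "word_prod n M X (s # t # w) = tensor_mult n M (X s) (word_prod n M X (t # w))"

definition poly_eval ::
    "nat \<Rightarrow> 'k::conjugatable_field mat \<Rightarrow> (nat list \<Rightarrow>\<^sub>0 'k) \<Rightarrow> 'k tensor \<Rightarrow> (nat \<Rightarrow> 'k tensor) \<Rightarrow> 'k tensor" where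
  "poly_eval n M f c X =
     (\<lambda>e. c e + (\<Sum>w\<in>Poly_Mapping.keys f. Poly_Mapping.lookup f w * word_prod n M X w e))"


section \<open>Exponents\<close>

definition growth_exponent :: "(nat \<Rightarrow> nat) \<Rightarrow> ereal" where
  "growth_exponent a = Inf (ereal ` {\<tau>. (\<lambda>n. real (a n)) \<in> O(\<lambda>n. real n powr \<tau>)})"


subsection \<open>Tensor rank\<close>

definition linear_form :: "'i set \<Rightarrow> (('i \<Rightarrow> 'k::field) \<Rightarrow> 'k) \<Rightarrow> bool" where
  "linear_form I \<alpha> \<longleftrightarrow>
     (\<forall>u\<in>coord_space I. \<forall>v\<in>coord_space I. \<alpha> (\<lambda>i. u i + v i) = \<alpha> u + \<alpha> v) \<and>
     (\<forall>c. \<forall>u\<in>coord_space I. \<alpha> (\<lambda>i. c * u i) = c * \<alpha> u)"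

text \<open>The rank of a bilinear map \<open>K\<^sup>I \<times> K\<^sup>J \<rightarrow> K\<^sup>L\<close>, with \<open>I\<close>, \<open>J\<close>, \<open>L\<close> finite.\<close>

definition tensor_rank ::
    "'i set \<Rightarrow> 'j set \<Rightarrow> 'l set \<Rightarrow> (('i \<Rightarrow> 'k::field) \<Rightarrow> ('j \<Rightarrow> 'k) \<Rightarrow> 'l \<Rightarrow> 'k) \<Rightarrow> nat" where
  "tensor_rank I J L T = (LEAST r. \<exists>\<alpha> \<beta> w.
     (\<forall>s<r. linear_form I (\<alpha> s) \<and> linear_form J (\<beta> s) \<and> w s \<in> coord_space L) \<and>
     (\<forall>u\<in>coord_space I. \<forall>v\<in>coord_space J. T u v = (\<lambda>l. \<Sum>s<r. \<alpha> s u * \<beta> s v * w s l)))"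

definition omega ::
    "(nat \<Rightarrow> 'i set) \<Rightarrow> (nat \<Rightarrow> 'j set) \<Rightarrow> (nat \<Rightarrow> 'l set) \<Rightarrow>
     (nat \<Rightarrow> ('i \<Rightarrow> 'k::field) \<Rightarrow> ('j \<Rightarrow> 'k) \<Rightarrow> 'l \<Rightarrow> 'k) \<Rightarrow> ereal" where
  "omega I J L T = growth_exponent (\<lambda>n. tensor_rank (I n) (J n) (L n) (T n))"


subsection \<open>Total complexity\<close>

text \<open>
  Straight-line programs. \<open>Result m\<close> refers to the value computed by instruction number \<open>m\<close>.
  Inputs and scalars of \<open>K\<close> are available for free and every instruction costs 1.
  Multiplication by a constant is a \<open>Mul\<close> instruction with a \<open>Scalar\<close> operand.
\<close>

datatype ('i, 'k) operand = Input 'i | Scalar 'k | Result nat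

datatype operation = Add | Sub | Mul | Div

type_synonym ('i, 'k) instruction = "operation \<times> ('i, 'k) operand \<times> ('i, 'k) operand"

fun apply_operation :: "operation \<Rightarrow> 'k::field \<Rightarrow> 'k \<Rightarrow> 'k option" where
  "apply_operation Add x y = Some (x + y)"
| "apply_operation Sub x y = Some (x - y)"
| "apply_operation Mul x y = Some (x * y)"
| "apply_operation Div x y = (if y = 0 then None else Some (x / y))"

fun operand_value :: "('i \<Rightarrow> 'k) \<Rightarrow> 'k list \<Rightarrow> ('i, 'k) operand \<Rightarrow> 'k option" where
  "operand_value u rs (Input i) = Some (u i)"
| "operand_value u rs (Scalar c) = Some c"
| "operand_value u rs (Result m) = (if m < length rs then Some (rs ! m) else None)"

fun run :: "('i \<Rightarrow> 'k::field) \<Rightarrow> ('i, 'k) instruction list \<Rightarrow> 'k list \<Rightarrow> 'k list option" where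
  "run u [] rs = Some rs"
| "run u ((f, a, b) # P) rs =
     (case (operand_value u rs a, operand_value u rs b) of
        (Some x, Some y) \<Rightarrow>
          (case apply_operation f x y of Some z \<Rightarrow> run u P (rs @ [z]) | None \<Rightarrow> None)
      | _ \<Rightarrow> None)"

text \<open>
  The program \<open>P\<close> with outputs \<open>out\<close> computes the rational map \<open>\<phi> : K\<^sup>I \<rightarrow> K\<^sup>J\<close>, for \<open>K\<close> infinite, \<open>I\<close> and
  \<open>J\<close> finite and \<open>\<phi>\<close> everywhere defined (in particular for \<open>\<phi>\<close> polynomial). A division by a nonzero
  rational function may fail at particular inputs, but no division in \<open>P\<close> is by the zero
  rational function iff \<open>P\<close> runs successfully on some input; the outputs are then the
  components of \<open>\<phi>\<close> as rational functions iff they agree with \<open>\<phi>\<close> wherever \<open>P\<close> runs successfully.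
\<close>

definition computes ::
    "'i set \<Rightarrow> 'j set \<Rightarrow> ('i, 'k) instruction list \<Rightarrow> ('j \<Rightarrow> ('i, 'k) operand) \<Rightarrow>
     (('i \<Rightarrow> 'k::field) \<Rightarrow> 'j \<Rightarrow> 'k) \<Rightarrow> bool" where
  "computes I J P out \<phi> \<longleftrightarrow>
     (\<exists>u\<in>coord_space I. run u P [] \<noteq> None) \<and>
     (\<forall>u\<in>coord_space I. \<forall>rs. run u P [] = Some rs \<longrightarrow>
        (\<forall>j\<in>J. operand_value u rs (out j) = Some (\<phi> u j)))"

definition total_complexity :: "'i set \<Rightarrow> 'j set \<Rightarrow> (('i \<Rightarrow> 'k::field) \<Rightarrow> 'j \<Rightarrow> 'k) \<Rightarrow> nat" where
  "total_complexity I J \<phi> = (LEAST t. \<exists>P out. length P = t \<and> computes I J P out \<phi>)"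

definition omega_hat ::
    "(nat \<Rightarrow> 'i set) \<Rightarrow> (nat \<Rightarrow> 'j set) \<Rightarrow> (nat \<Rightarrow> ('i \<Rightarrow> 'k::field) \<Rightarrow> 'j \<Rightarrow> 'k) \<Rightarrow> ereal" where
  "omega_hat I J \<phi> = growth_exponent (\<lambda>n. total_complexity (I n) (J n) (\<phi> n))"


section \<open>The three exponents\<close>

definition omega_hat_eval ::
    "'k::conjugatable_field mat \<Rightarrow> nat \<Rightarrow> nat \<Rightarrow> (nat list \<Rightarrow>\<^sub>0 'k) \<Rightarrow> (nat \<Rightarrow> 'k tensor) \<Rightarrow> ereal" where
  "omega_hat_eval M p k f C =
     omega_hat (\<lambda>n. {..<k} \<times> tensor_ix n p) (\<lambda>n. tensor_ix n p)
       (\<lambda>n x. poly_eval n M f (C n) (\<lambda>s e. x (s, e)))"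

text \<open>The domain \<open>K\<^sup>I \<times> K\<^sup>I\<close> of a bilinear map is the coordinate space \<open>K\<^sup>I\<^sup>+\<^sup>I\<close>.\<close>

definition omega_hat_tensor_mult :: "'k::conjugatable_field mat \<Rightarrow> nat \<Rightarrow> ereal" where
  "omega_hat_tensor_mult M p =
     omega_hat (\<lambda>n. tensor_ix n p <+> tensor_ix n p) (\<lambda>n. tensor_ix n p)
       (\<lambda>n x. tensor_mult n M (\<lambda>e. x (Inl e)) (\<lambda>e. x (Inr e)))"

definition omega_matrix_mult :: "'k::field itself \<Rightarrow> ereal" where
  "omega_matrix_mult _ =
     omega matrix_ix matrix_ix matrix_ix
       (matrix_mult :: nat \<Rightarrow> (nat \<times> nat \<Rightarrow> 'k) \<Rightarrow> (nat \<times> nat \<Rightarrow> 'k) \<Rightarrow> nat \<times> nat \<Rightarrow> 'k)"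

end

(*
  Upper bound. A rank decomposition of m x m matrix multiplication, applied recursively to block
  matrices, gives programs for n x n matrix multiplication with O(n^sigma) operations for every
  sigma above the rank exponent. A tensor product is q matrix products plus O(n^2) linear
  operations, and a tensor polynomial is a fixed number of tensor products and additions.

  Lower bound. Expand a program to second order around a point at which it succeeds: linear
  operations do not create new second-order terms, and a multiplication or division contributes one
  product of linear forms. So the second-order part of each output lies in the span of L products
  of linear forms, where L is the length of the program. The point can be moved anywhere by
  interpolation along a line, at the price of a factor depending only on the degree. Restricting
  the polynomial to block matrices with blocks A, B, I, ..., I above the diagonal makes a word of
  length d >= 2 contribute the matrix product AB in the corner block, and polarization bounds the
  rank of matrix multiplication by a constant times L.

  Tensor multiplication is the special case of the polynomial X_0 X_1.
*)
theory Submission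
  imports Defs "HOL-Real_Asymp.Real_Asymp"
begin

section \<open>Arithmetic cost\<close>

text \<open>In the lower bound, divisions are the obstacle. To read AB off the corner, the base
  point must carry zero blocks in place of A and B and identity blocks after them, and a given
  program may divide by zero exactly there. The second-order coefficient is therefore taken at other
  points of a line; it is a polynomial along that line of degree at most the bound D on word
  lengths, so D + 1 good points determine it. Shifted blocks are used because letters of a word may
  coincide and other words contribute too. Each letter moves one block to the right, which separates
  lengths, and the block row determines which letter may act, which separates words of equal length.
  Only one transformed slice is used: M M^+ = I embeds matrices multiplicatively, whether or not M
  is square. In the upper bound, the products of the recursion must dominate its linear operations.
  This rests on the rank of m x m multiplication being at least m^2; replacing the rank by rank + 1
  makes this strict, and the loss disappears in the infimum.\<close>

inductive reach :: "('u \<Rightarrow> 'k::field) set \<Rightarrow> nat \<Rightarrow> ('u \<Rightarrow> 'k) set \<Rightarrow> bool" for S where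
  start: "reach S 0 (S \<union> range (\<lambda>c _. c))"
| add: "reach S t G \<Longrightarrow> a \<in> G \<Longrightarrow> b \<in> G \<Longrightarrow> reach S (Suc t) (insert (\<lambda>u. a u + b u) G)"
| mul: "reach S t G \<Longrightarrow> a \<in> G \<Longrightarrow> b \<in> G \<Longrightarrow> reach S (Suc t) (insert (\<lambda>u. a u * b u) G)"

definition avail :: "('u \<Rightarrow> 'k::field) set \<Rightarrow> ('u \<Rightarrow> 'k) set" where
  "avail S = S \<union> range (\<lambda>c _. c)"

text \<open>Results are sets of functions of the input point, so intermediate values are shared for
  free and a bound for several outputs counts common work once.\<close>

definition cost_le :: "('u \<Rightarrow> 'k::field) set \<Rightarrow> ('u \<Rightarrow> 'k) set \<Rightarrow> nat \<Rightarrow> bool" where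
  "cost_le S T t \<longleftrightarrow> (\<exists>t'\<le>t. \<exists>G. reach S t' G \<and> T \<subseteq> G)"

lemma const_avail [simp]: "(\<lambda>_. c) \<in> avail S"
  by (simp add: avail_def)

lemma subset_avail: "S \<subseteq> avail S"
  by (simp add: avail_def)

lemma avail_mono: "S \<subseteq> S' \<Longrightarrow> avail S \<subseteq> avail S'"
  by (auto simp: avail_def)

lemma reach_start: "reach S 0 (avail S)"
  unfolding avail_def by (rule reach.start)

lemma reach_avail: "reach S t G \<Longrightarrow> avail S \<subseteq> G"
  by (induction rule: reach.induct) (auto simp: avail_def)

text \<open>The second computation is replayed on top of \<open>G1\<close>: its inputs are already
  there, so only its own steps are paid for.\<close>

lemma reach_compose:
  assumes "reach S t1 G1" "reach S' t2 G2" "S' \<subseteq> G1"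
  shows "reach S (t1 + t2) (G1 \<union> G2)"
  using assms(2)
proof (induction rule: reach.induct)
  case start
  have "G1 \<union> (S' \<union> range (\<lambda>c _. c)) = G1"
    using reach_avail[OF assms(1)] assms(3) by (auto simp: avail_def)
  then show ?case using assms(1) by simp
next
  case (add t G a b)
  then show ?case using reach.add[of S "t1 + t" "G1 \<union> G" a b] by simp
next
  case (mul t G a b)
  then show ?case using reach.mul[of S "t1 + t" "G1 \<union> G" a b] by simp
qed

lemma cost_le_mono:
  assumes "cost_le S T t" "S \<subseteq> avail S'" "T' \<subseteq> T" "t \<le> t'"
  shows "cost_le S' T' t'"
proof -
  obtain s G where "s \<le> t" "reach S s G" "T \<subseteq> G"
    using assms(1) by (auto simp: cost_le_def)
  then have "reach S' (0 + s) (avail S' \<union> G)"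
    using reach_compose[OF reach_start] assms(2) by blast
  then show ?thesis
    unfolding cost_le_def using \<open>s \<le> t\<close> \<open>T \<subseteq> G\<close> assms(3,4)
    by (intro exI[of _ s] conjI exI[of _ "avail S' \<union> G"]) auto
qed

lemma cost_le_avail: "T \<subseteq> avail S \<Longrightarrow> cost_le S T t"
  unfolding cost_le_def using reach_start by blast

lemma cost_le_trans:
  assumes "cost_le S T t1" "cost_le (S \<union> T) U t2"
  shows "cost_le S (T \<union> U) (t1 + t2)"
proof -
  obtain s1 G1 where 1: "s1 \<le> t1" "reach S s1 G1" "T \<subseteq> G1"
    using assms(1) by (auto simp: cost_le_def)
  obtain s2 G2 where 2: "s2 \<le> t2" "reach (S \<union> T) s2 G2" "U \<subseteq> G2"
    using assms(2) by (auto simp: cost_le_def)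
  have "S \<union> T \<subseteq> G1" using reach_avail[OF 1(2)] subset_avail 1(3) by blast
  from reach_compose[OF 1(2) 2(2) this] show ?thesis
    unfolding cost_le_def using 1 2
    by (intro exI[of _ "s1 + s2"] conjI exI[of _ "G1 \<union> G2"]) auto
qed

lemma cost_le_UN:
  assumes "finite I" "\<And>i. i \<in> I \<Longrightarrow> cost_le S (T i) t"
  shows "cost_le S (\<Union>i\<in>I. T i) (card I * t)"
  using assms
proof (induction I rule: finite_induct)
  case empty
  show ?case by (rule cost_le_avail) simp
next
  case (insert i I)
  have "cost_le S ((\<Union>i\<in>I. T i) \<union> T i) (card I * t + t)"
    using insert.prems insert.IH
    by (intro cost_le_trans cost_le_mono[of S "T i" t "S \<union> (\<Union>i\<in>I. T i)"])
      (auto simp: avail_def)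
  then show ?case using insert.hyps by (simp add: Un_commute add.commute)
qed

lemma cost_le_image:
  assumes "finite I" "\<And>i. i \<in> I \<Longrightarrow> cost_le S {g i} t"
  shows "cost_le S (g ` I) (card I * t)"
  using cost_le_UN[OF assms] by (simp add: UNION_singleton_eq_range)

lemma cost_le_mult:
  assumes "a \<in> avail S" "b \<in> avail S"
  shows "cost_le S {\<lambda>u. a u * b u} 1"
  unfolding cost_le_def using reach.mul[OF reach_start assms] by auto

lemma cost_le_add:
  assumes "cost_le S {a} t1" "cost_le S {b} t2"
  shows "cost_le S {\<lambda>u. a u + b u} (Suc (t1 + t2))"
proof -
  have "cost_le S ({a} \<union> {b}) (t1 + t2)"
    using assms(1) by (rule cost_le_trans) (use assms(2) in \<open>auto intro: cost_le_mono simp: avail_def\<close>)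
  moreover have "cost_le (S \<union> ({a} \<union> {b})) {\<lambda>u. a u + b u} 1"
    unfolding cost_le_def
    using reach.add[OF reach_start, of a "S \<union> ({a} \<union> {b})" b] by (auto simp: avail_def)
  ultimately have "cost_le S (({a} \<union> {b}) \<union> {\<lambda>u. a u + b u}) (t1 + t2 + 1)"
    by (rule cost_le_trans)
  then show ?thesis by (rule cost_le_mono) (auto simp: avail_def)
qed

text \<open>One scalar multiplication and one addition per term; the sum starts from the constant 0,
  which is free.\<close>

lemma cost_le_lincomb:
  assumes "finite I" "\<And>i. i \<in> I \<Longrightarrow> a i \<in> avail S"
  shows "cost_le S {\<lambda>u. \<Sum>i\<in>I. c i * a i u} (2 * card I)"
  using assms
proof (induction I rule: finite_induct)
  case empty
  show ?case by (rule cost_le_avail) simp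
next
  case (insert i I)
  have "cost_le S {\<lambda>u. (c i * a i u) + (\<Sum>i\<in>I. c i * a i u)} (Suc (1 + 2 * card I))"
    using insert by (intro cost_le_add cost_le_mult[of "\<lambda>_. c i"]) auto
  then show ?case using insert.hyps by simp
qed

section \<open>Straight-line programs for computations without division\<close>

lemma run_append:
  "run u (P @ Q) rs = (case run u P rs of None \<Rightarrow> None | Some rs' \<Rightarrow> run u Q rs')"
  by (induction u P rs rule: run.induct) (auto split: option.splits)

lemma run_length: "run u P rs = Some rs' \<Longrightarrow> length rs' = length rs + length P"
  by (induction u P rs rule: run.induct) (auto split: option.splits)

lemma operand_value_append:
  "operand_value u rs x = Some y \<Longrightarrow> operand_value u (rs @ rs') x = Some y"
  by (cases x) (auto split: if_splits simp: nth_append)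

text \<open>\<open>reach\<close> offers only addition and multiplication, so the program never fails
  and one \<open>P\<close> with a total result function \<open>R\<close> serves all inputs.
  Subtraction is still available through the scalar -1.\<close>

lemma reach_program:
  assumes "reach ((\<lambda>i u. u i) ` I) t G"
  shows "\<exists>P. length P = t \<and> (\<exists>R. (\<forall>u. run u P [] = Some (R u)) \<and>
    (\<forall>g\<in>G. \<exists>x. \<forall>u. operand_value u (R u) x = Some (g u)))"
  using assms
proof (induction rule: reach.induct)
  case start
  have "\<exists>x. \<forall>u. operand_value u [] x = Some (g u)"
    if "g \<in> (\<lambda>i u. u i) ` I \<union> range (\<lambda>c _. c)" for g :: "('a \<Rightarrow> 'b) \<Rightarrow> 'b"
  proof -
    from that consider i where "g = (\<lambda>u. u i)" | c where "g = (\<lambda>_. c)" by auto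
    then show ?thesis
      by cases (auto intro: exI[of _ "Input _"] exI[of _ "Scalar _"])
  qed
  then show ?case by (intro exI[of _ "[]"] conjI exI[of _ "\<lambda>_. []"]) auto
next
  case (add t G a b)
  then obtain P R where P: "length P = t" "\<And>u. run u P [] = Some (R u)"
    "\<forall>g\<in>G. \<exists>x. \<forall>u. operand_value u (R u) x = Some (g u)" by auto
  then obtain x y where xy: "\<And>u. operand_value u (R u) x = Some (a u)"
    "\<And>u. operand_value u (R u) y = Some (b u)" using add.hyps by meson
  have len: "length (R u) = t" for u using run_length[OF P(2)] P(1) by simp
  have "\<exists>x. \<forall>u. operand_value u (R u @ [a u + b u]) x = Some (g u)"
    if "g \<in> insert (\<lambda>u. a u + b u) G" for g
  proof (cases "g = (\<lambda>u. a u + b u)")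
    case True
    \<comment> \<open>The new value is appended at position \<open>t\<close>, the length of the
      earlier results.\<close>
    then show ?thesis using len by (intro exI[of _ "Result t"]) (auto simp: nth_append)
  next
    case False
    then show ?thesis using P(3) that operand_value_append by (metis insertE)
  qed
  then show ?case using P xy
    by (intro exI[of _ "P @ [(Add, x, y)]"] conjI exI[of _ "\<lambda>u. R u @ [a u + b u]"])
      (auto simp: run_append)
next
  case (mul t G a b)
  then obtain P R where P: "length P = t" "\<And>u. run u P [] = Some (R u)"
    "\<forall>g\<in>G. \<exists>x. \<forall>u. operand_value u (R u) x = Some (g u)" by auto
  then obtain x y where xy: "\<And>u. operand_value u (R u) x = Some (a u)"
    "\<And>u. operand_value u (R u) y = Some (b u)" using mul.hyps by meson
  have len: "length (R u) = t" for u using run_length[OF P(2)] P(1) by simp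
  have "\<exists>x. \<forall>u. operand_value u (R u @ [a u * b u]) x = Some (g u)"
    if "g \<in> insert (\<lambda>u. a u * b u) G" for g
  proof (cases "g = (\<lambda>u. a u * b u)")
    case True
    then show ?thesis using len by (intro exI[of _ "Result t"]) (auto simp: nth_append)
  next
    case False
    then show ?thesis using P(3) that operand_value_append by (metis insertE)
  qed
  then show ?case using P xy
    by (intro exI[of _ "P @ [(Mul, x, y)]"] conjI exI[of _ "\<lambda>u. R u @ [a u * b u]"])
      (auto simp: run_append)
qed

lemma cost_le_computes:
  assumes "cost_le ((\<lambda>i u. u i) ` I) ((\<lambda>j u. \<phi> u j) ` J) t"
  shows "\<exists>P out. length P \<le> t \<and> computes I J P out \<phi>"
proof -
  obtain t' G where G: "t' \<le> t" "reach ((\<lambda>i u. u i) ` I) t' G" "(\<lambda>j u. \<phi> u j) ` J \<subseteq> G"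
    using assms by (auto simp: cost_le_def)
  from reach_program[OF G(2)] obtain P R where P: "length P = t'" "\<And>u. run u P [] = Some (R u)"
    "\<forall>g\<in>G. \<exists>x. \<forall>u. operand_value u (R u) x = Some (g u)" by auto
  have "\<forall>j\<in>J. \<exists>x. \<forall>u. operand_value u (R u) x = Some (\<phi> u j)" using P(3) G(3) by auto
  then obtain out where "\<forall>j\<in>J. \<forall>u. operand_value u (R u) (out j) = Some (\<phi> u j)" by metis
  moreover have "(\<lambda>_. 0) \<in> coord_space I" by (simp add: coord_space_def)
  ultimately have "computes I J P out \<phi>" using P(2) by (auto simp: computes_def)
  then show ?thesis using P(1) G(1) by auto
qed

section \<open>Recursive matrix multiplication\<close>

text \<open>The entries range over arbitrary available functions and not only over input
  coordinates: in the recursion they are linear combinations of blocks, and inside a word they come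
  from earlier products.\<close>

definition mm_cost :: "'u itself \<Rightarrow> 'k::field itself \<Rightarrow> nat \<Rightarrow> nat \<Rightarrow> bool" where
  "mm_cost _ _ n t \<longleftrightarrow> (\<forall>(S :: ('u \<Rightarrow> 'k) set) a b.
     (\<forall>i<n. \<forall>j<n. a i j \<in> avail S \<and> b i j \<in> avail S) \<longrightarrow>
     cost_le S ((\<lambda>(i, j) u. \<Sum>z<n. a i z u * b z j u) ` ({..<n} \<times> {..<n})) t)"

text \<open>A rank decomposition written with the coefficients of its linear forms, so that it
  applies to any values \<open>A\<close> and \<open>B\<close> without a condition on their
  support.\<close>

definition bilinear_scheme :: "'k::field itself \<Rightarrow> nat \<Rightarrow> nat \<Rightarrow> bool" where
  "bilinear_scheme _ m r \<longleftrightarrow> (\<exists>\<alpha> \<beta> w. \<forall>(A :: nat \<times> nat \<Rightarrow> 'k) B. \<forall>i<m. \<forall>j<m.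
     (\<Sum>z<m. A (i, z) * B (z, j)) =
     (\<Sum>s<r. (\<Sum>e\<in>matrix_ix m. \<alpha> s e * A e) * (\<Sum>e\<in>matrix_ix m. \<beta> s e * B e) * w s (i, j)))"

lemma finite_matrix_ix [simp]: "finite (matrix_ix n)"
  by (simp add: matrix_ix_def)

lemma card_matrix_ix [simp]: "card (matrix_ix n) = n\<^sup>2"
  by (simp add: matrix_ix_def power2_eq_square)

lemma sum_lessThan_mult: "(\<Sum>j<m * n. f j) = (\<Sum>k<m. \<Sum>z<n. f (k * n + z :: nat))"
proof (induction m)
  case (Suc m)
  have "(\<Sum>j<Suc m * n. f j) = (\<Sum>j<m * n. f j) + (\<Sum>j=m * n..<m * n + n. f j)"
    using sum.atLeastLessThan_concat[of 0 "m * n" "m * n + n" f]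
    by (simp add: lessThan_atLeast0 add.commute)
  also have "(\<Sum>j=m * n..<m * n + n. f j) = (\<Sum>z<n. f (m * n + z))"
    using sum.shift_bounds_nat_ivl[of f 0 "m * n" n]
    by (simp add: lessThan_atLeast0 add.commute)
  finally show ?case using Suc by simp
qed simp

lemma block_index_less: "i < m \<Longrightarrow> x < n \<Longrightarrow> i * n + x < m * (n::nat)"
proof -
  assume "i < m" "x < n"
  then have "i * n + x < Suc i * n" by simp
  also have "\<dots> \<le> m * n" using \<open>i < m\<close> by (intro mult_le_mono1) simp
  finally show ?thesis .
qed

text \<open>The scheme only multiplies combinations of left entries by combinations of right
  entries, in this order, so blocks may replace scalars: \<open>r\<close> products of size
  \<open>n\<close>. The rest is linear: \<open>2 * m^2\<close> operations for each of
  \<open>r * n^2\<close> entries on the left and again on the right, and \<open>2 * r\<close> for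
  each of the \<open>m^2 * n^2\<close> output entries, hence the 6.\<close>

lemma mm_cost_block:
  assumes scheme: "bilinear_scheme TYPE('k::field) m r"
    and mm: "mm_cost TYPE('u) TYPE('k) n t"
  shows "mm_cost TYPE('u) TYPE('k) (m * n) (r * t + 6 * r * m\<^sup>2 * n\<^sup>2)"
  unfolding mm_cost_def
proof (intro allI impI)
  fix S :: "('u \<Rightarrow> 'k) set" and a b
  assume ab: "\<forall>i<m * n. \<forall>j<m * n. a i j \<in> avail S \<and> b i j \<in> avail S"
  obtain \<alpha> \<beta> w where abw: "\<And>(A :: nat \<times> nat \<Rightarrow> 'k) B i j. i < m \<Longrightarrow> j < m \<Longrightarrow>
     (\<Sum>z<m. A (i, z) * B (z, j)) =
     (\<Sum>s<r. (\<Sum>e\<in>matrix_ix m. \<alpha> s e * A e) * (\<Sum>e\<in>matrix_ix m. \<beta> s e * B e) * w s (i, j))"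
    using scheme unfolding bilinear_scheme_def by blast
  \<comment> \<open>Entry \<open>(x, y)\<close> of the \<open>s\<close>-th linear combination of the
    blocks of \<open>g\<close>.\<close>
  define L where "L c g s x y u = (\<Sum>e\<in>matrix_ix m. c s e * g (fst e * n + x) (snd e * n + y) u)"
    for c :: "nat \<Rightarrow> nat \<times> nat \<Rightarrow> 'k" and g :: "nat \<Rightarrow> nat \<Rightarrow> 'u \<Rightarrow> 'k" and s x y u
  define I where "I = {..<r} \<times> {..<n} \<times> {..<n}"
  define T1 where "T1 = (\<lambda>(s, x, y). L \<alpha> a s x y) ` I"
  define T2 where "T2 = (\<lambda>(s, x, y). L \<beta> b s x y) ` I"
  have cardI: "card I = r * n\<^sup>2" and finI: "finite I"
    by (simp_all add: I_def power2_eq_square)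
  have cost_L: "cost_le S {L c g s x y} (2 * m\<^sup>2)"
    if "x < n" "y < n" "\<And>i j. i < m * n \<Longrightarrow> j < m * n \<Longrightarrow> g i j \<in> avail S" for c g s x y
  proof -
    have "cost_le S {L c g s x y} (2 * card (matrix_ix m))"
      unfolding L_def using that
      by (intro cost_le_lincomb) (auto simp: matrix_ix_def intro!: that block_index_less)
    then show ?thesis by simp
  qed
  have c1: "cost_le S T1 (r * n\<^sup>2 * (2 * m\<^sup>2))"
    unfolding T1_def cardI[symmetric]
  proof (rule cost_le_image[OF finI])
    fix i assume "i \<in> I"
    then show "cost_le S {case i of (s, x, y) \<Rightarrow> L \<alpha> a s x y} (2 * m\<^sup>2)"
      using ab by (auto simp: I_def intro!: cost_L)
  qed
  have c2: "cost_le S T2 (r * n\<^sup>2 * (2 * m\<^sup>2))"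
    unfolding T2_def cardI[symmetric]
  proof (rule cost_le_image[OF finI])
    fix i assume "i \<in> I"
    then show "cost_le S {case i of (s, x, y) \<Rightarrow> L \<beta> b s x y} (2 * m\<^sup>2)"
      using ab by (auto simp: I_def intro!: cost_L)
  qed
  have c12: "cost_le S (T1 \<union> T2) (r * n\<^sup>2 * (2 * m\<^sup>2) + r * n\<^sup>2 * (2 * m\<^sup>2))"
    using c1 by (rule cost_le_trans) (use c2 in \<open>auto intro: cost_le_mono simp: avail_def\<close>)
  define Q where "Q s x y u = (\<Sum>z<n. L \<alpha> a s x z u * L \<beta> b s z y u)" for s x y u
  define T3 where "T3 = (\<Union>s\<in>{..<r}. (\<lambda>(x, y). Q s x y) ` ({..<n} \<times> {..<n}))"
  have c3: "cost_le (S \<union> (T1 \<union> T2)) T3 (r * t)"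
  proof -
    have "cost_le (S \<union> (T1 \<union> T2)) ((\<lambda>(x, y). Q s x y) ` ({..<n} \<times> {..<n})) t" if "s < r" for s
    proof -
      have "\<forall>x<n. \<forall>y<n. L \<alpha> a s x y \<in> avail (S \<union> (T1 \<union> T2)) \<and> L \<beta> b s x y \<in> avail (S \<union> (T1 \<union> T2))"
        using that unfolding T1_def T2_def I_def avail_def by force
      then show ?thesis
        using mm unfolding mm_cost_def Q_def by fast
    qed
    then show ?thesis
      unfolding T3_def by (intro cost_le_UN[where I = "{..<r}", unfolded card_lessThan]) simp_all
  qed
  have c123: "cost_le S (T1 \<union> T2 \<union> T3) (r * n\<^sup>2 * (2 * m\<^sup>2) + r * n\<^sup>2 * (2 * m\<^sup>2) + r * t)"
    using c12 c3 by (rule cost_le_trans)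
  define W where "W i j x y u = (\<Sum>s<r. w s (i, j) * Q s x y u)" for i j x y u
  have c4: "cost_le (S \<union> (T1 \<union> T2 \<union> T3))
      ((\<lambda>(I, J). W (I div n) (J div n) (I mod n) (J mod n)) ` ({..<m*n} \<times> {..<m*n}))
      (card ({..<m*n} \<times> {..<m*n}) * (2 * r))"
  proof (rule cost_le_image)
    fix I assume "I \<in> {..<m*n} \<times> {..<m*n}"
    then obtain i j where I: "I = (i, j)" "i < m * n" "j < m * n" by auto
    then have "n > 0" by (cases n) auto
    have "cost_le (S \<union> (T1 \<union> T2 \<union> T3)) {W (i div n) (j div n) (i mod n) (j mod n)} (2 * card {..<r})"
      unfolding W_def using \<open>n > 0\<close>
      by (rule_tac cost_le_lincomb) (force simp: avail_def T3_def)+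
    then show "cost_le (S \<union> (T1 \<union> T2 \<union> T3)) {case I of (I, J) \<Rightarrow> W (I div n) (J div n) (I mod n) (J mod n)} (2 * r)"
      using I by simp
  qed simp
  from cost_le_trans[OF c123 c4]
  show "cost_le S ((\<lambda>(i, j) u. \<Sum>z<m * n. a i z u * b z j u) ` ({..<m * n} \<times> {..<m * n}))
         (r * t + 6 * r * m\<^sup>2 * n\<^sup>2)"
  proof (rule cost_le_mono)
    have "(\<Sum>z<m * n. a i z u * b z j u) = W (i div n) (j div n) (i mod n) (j mod n) u"
      if "i < m * n" "j < m * n" for i j u
    proof -
      have "n > 0" using that by (cases n) auto
      define i' x j' y where d: "i' = i div n" "x = i mod n" "j' = j div n" "y = j mod n"
      have i: "i = i' * n + x" "j = j' * n + y" by (simp_all add: d)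
      have l: "i' < m" "j' < m" using that by (simp_all add: d less_mult_imp_div_less)
      have "(\<Sum>z<m * n. a i z u * b z j u) = (\<Sum>k<m. \<Sum>z<n. a i (k * n + z) u * b (k * n + z) j u)"
        by (rule sum_lessThan_mult)
      also have "\<dots> = (\<Sum>z<n. \<Sum>k<m. a i (k * n + z) u * b (k * n + z) j u)"
        by (rule sum.swap)
      \<comment> \<open>For fixed \<open>z\<close> the scheme is applied to scalar matrices with one
        entry from each block; summing over \<open>z\<close> afterwards assembles the products
        \<open>Q s\<close> of whole blocks.\<close>
      also have "\<dots> = (\<Sum>z<n. \<Sum>s<r. L \<alpha> a s x z u * L \<beta> b s z y u * w s (i', j'))"
        using abw[OF l, of "\<lambda>(i, j). a (i * n + x) (j * n + z) u" "\<lambda>(i, j). b (i * n + z) (j * n + y) u" for z]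
        by (simp add: i L_def case_prod_beta)
      also have "\<dots> = (\<Sum>s<r. \<Sum>z<n. L \<alpha> a s x z u * L \<beta> b s z y u * w s (i', j'))"
        by (rule sum.swap)
      also have "\<dots> = W i' j' x y u"
        by (simp add: W_def Q_def sum_distrib_left mult_ac)
      finally show ?thesis by (simp add: d)
    qed
    then show "(\<lambda>(i, j) u. \<Sum>z<m * n. a i z u * b z j u) ` ({..<m * n} \<times> {..<m * n}) \<subseteq>
      T1 \<union> T2 \<union> T3 \<union> (\<lambda>(I, J). W (I div n) (J div n) (I mod n) (J mod n)) ` ({..<m*n} \<times> {..<m*n})"
      by (intro le_supI2) (auto simp: fun_eq_iff image_iff intro!: bexI)
    show "r * n\<^sup>2 * (2 * m\<^sup>2) + r * n\<^sup>2 * (2 * m\<^sup>2) + r * t + card ({..<m * n} \<times> {..<m * n}) * (2 * r)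
      \<le> r * t + 6 * r * m\<^sup>2 * n\<^sup>2"
      by (simp add: power2_eq_square algebra_simps)
  qed (rule subset_avail)
qed

lemma mm_cost_pad:
  assumes "mm_cost TYPE('u) TYPE('k::field) N t" "n \<le> N"
  shows "mm_cost TYPE('u) TYPE('k) n t"
  unfolding mm_cost_def
proof (intro allI impI)
  fix S :: "('u \<Rightarrow> 'k) set" and a b
  assume ab: "\<forall>i<n. \<forall>j<n. a i j \<in> avail S \<and> b i j \<in> avail S"
  define pad where "pad c i j = (if i < n \<and> j < n then c i j else (\<lambda>_. 0))"
    for c :: "nat \<Rightarrow> nat \<Rightarrow> 'u \<Rightarrow> 'k" and i j
  have "cost_le S ((\<lambda>(i, j) u. \<Sum>z<N. pad a i z u * pad b z j u) ` ({..<N} \<times> {..<N})) t"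
    using assms(1) ab unfolding mm_cost_def pad_def by (auto)
  then show "cost_le S ((\<lambda>(i, j) u. \<Sum>z<n. a i z u * b z j u) ` ({..<n} \<times> {..<n})) t"
  proof (rule cost_le_mono)
    have "(\<Sum>z<n. a i z u * b z j u) = (\<Sum>z<N. pad a i z u * pad b z j u)" if "i < n" "j < n" for i j u
      using that assms(2) by (intro sum.mono_neutral_cong_left) (auto simp: pad_def)
    then show "(\<lambda>(i, j) u. \<Sum>z<n. a i z u * b z j u) ` ({..<n} \<times> {..<n})
      \<subseteq> (\<lambda>(i, j) u. \<Sum>z<N. pad a i z u * pad b z j u) ` ({..<N} \<times> {..<N})"
      using assms(2) by (force simp: fun_eq_iff image_iff)
  qed (auto simp: avail_def)
qed

lemma mm_cost_1: "mm_cost TYPE('u) TYPE('k::field) 1 1"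
  unfolding mm_cost_def using cost_le_mult by (auto simp: lessThan_Suc)

text \<open>The term \<open>c * m ^ (2 * e)\<close> strengthens the induction hypothesis so that it
  absorbs the linear operations: one level adds at most this many, and
  \<open>c * (m^2 + 1) \<le> c * r\<close> closes the induction. This is where
  \<open>m^2 < r\<close> enters.\<close>

lemma mm_cost_power:
  assumes "bilinear_scheme TYPE('k::field) m R" "R < r" "m\<^sup>2 < r"
  defines "c \<equiv> 6 * r * m\<^sup>2"
  shows "\<exists>t. mm_cost TYPE('u) TYPE('k) (m ^ e) t \<and> t + c * m ^ (2 * e) \<le> (1 + c) * r ^ e"
proof (induction e)
  case 0
  show ?case using mm_cost_1 by (intro exI[of _ 1]) auto
next
  case (Suc e)
  then obtain t where t: "mm_cost TYPE('u) TYPE('k) (m ^ e) t"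
    "t + c * m ^ (2 * e) \<le> (1 + c) * r ^ e" by auto
  have "mm_cost TYPE('u) TYPE('k) (m ^ Suc e) (R * t + 6 * R * m\<^sup>2 * (m ^ e)\<^sup>2)"
    using mm_cost_block[OF assms(1) t(1)] by simp
  moreover have "R * t + 6 * R * m\<^sup>2 * (m ^ e)\<^sup>2 + c * m ^ (2 * Suc e) \<le> (1 + c) * r ^ Suc e"
  proof -
    have sq: "(m ^ e)\<^sup>2 = m ^ (2 * e)" "m ^ (2 * Suc e) = m\<^sup>2 * m ^ (2 * e)"
      by (simp_all flip: power_mult power_add add: mult.commute)
    have "6 * R * m\<^sup>2 * m ^ (2 * e) + c * (m\<^sup>2 * m ^ (2 * e)) = (6 * R * m\<^sup>2 + c * m\<^sup>2) * m ^ (2 * e)"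
      by (simp add: algebra_simps)
    also have "\<dots> \<le> (c * r) * m ^ (2 * e)"
    proof (rule mult_right_mono)
      have "6 * R * m\<^sup>2 + c * m\<^sup>2 \<le> c + c * m\<^sup>2" using assms(2) by (simp add: c_def)
      also have "\<dots> = c * (m\<^sup>2 + 1)" by simp
      also have "\<dots> \<le> c * r" using assms(3) by (intro mult_left_mono) auto
      finally show "6 * R * m\<^sup>2 + c * m\<^sup>2 \<le> c * r" .
    qed simp
    finally have *: "6 * R * m\<^sup>2 * m ^ (2 * e) + c * (m\<^sup>2 * m ^ (2 * e)) \<le> c * r * m ^ (2 * e)" .
    have "R * t \<le> r * t" using assms(2) by simp
    then have "R * t + 6 * R * m\<^sup>2 * (m ^ e)\<^sup>2 + c * m ^ (2 * Suc e) \<le> r * t + c * r * m ^ (2 * e)"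
      unfolding sq add.assoc using * by (intro add_mono)
    also have "\<dots> = r * (t + c * m ^ (2 * e))" by (simp add: algebra_simps)
    also have "\<dots> \<le> r * ((1 + c) * r ^ e)" using t(2) by (rule mult_left_mono) simp
    finally show ?thesis by (simp add: algebra_simps)
  qed
  ultimately show ?case by blast
qed

text \<open>Padding \<open>n\<close> to the next power of \<open>m\<close> costs at most the factor
  \<open>m powr \<sigma>\<close>, because the padded size is at most \<open>m * n\<close>. The bound
  on \<open>n^2\<close> is carried along because the linear operations of a tensor product have to
  be absorbed too.\<close>

lemma mm_cost_exponent:
  assumes "bilinear_scheme TYPE('k::field) m R" "R < r" "m\<^sup>2 < r" "2 \<le> m" "real r \<le> real m powr \<sigma>"
  shows "\<exists>K. \<forall>n\<ge>1. \<exists>t. mm_cost TYPE('u) TYPE('k) n t \<and> real t \<le> K * real n powr \<sigma>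
    \<and> (real n)\<^sup>2 \<le> K * real n powr \<sigma>"
proof -
  define c where "c = 6 * r * m\<^sup>2"
  \<comment> \<open>Needed for monotonicity of \<open>powr\<close> in its base when
    \<open>m ^ e\<close> is replaced by \<open>m * n\<close>.\<close>
  have \<sigma>: "\<sigma> \<ge> 0"
  proof (rule ccontr)
    assume "\<not> \<sigma> \<ge> 0"
    then have "real m powr \<sigma> < 1" using assms(4) by (intro powr_less_one) auto
    then show False using assms(3,5) by simp
  qed
  show ?thesis
  proof (intro exI[of _ "real (1 + c) * real m powr \<sigma>"] allI impI)
    fix n :: nat assume n: "1 \<le> n"
    define e where "e = (LEAST e. n \<le> m ^ e)"
    have "n < 2 ^ n" by simp
    also have "(2::nat) ^ n \<le> m ^ n" using assms(4) by (rule power_mono) simp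
    finally have ex: "n \<le> m ^ n" by simp
    have ne: "n \<le> m ^ e" unfolding e_def using ex by (rule LeastI)
    have me: "m ^ e \<le> m * n"
    proof (cases e)
      case 0
      then show ?thesis using assms(4) n by simp
    next
      case (Suc e')
      then have "\<not> n \<le> m ^ e'" unfolding e_def by (metis not_less_Least lessI)
      then show ?thesis using Suc by simp
    qed
    have "real r ^ e \<le> (real m powr \<sigma>) ^ e" using assms(5) by (rule power_mono) simp
    also have "\<dots> = (real (m ^ e)) powr \<sigma>"
      using assms(4) by (simp add: powr_power powr_realpow[symmetric] powr_powr mult.commute)
    also have "\<dots> \<le> real (m * n) powr \<sigma>"
      using me \<sigma> by (intro powr_mono2) (auto simp only: of_nat_le_iff of_nat_0_le_iff)
    also have "\<dots> = real m powr \<sigma> * real n powr \<sigma>" by (simp add: powr_mult)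
    finally have re: "real r ^ e \<le> real m powr \<sigma> * real n powr \<sigma>" .
    obtain t where t: "mm_cost TYPE('u) TYPE('k) (m ^ e) t" "t + c * m ^ (2 * e) \<le> (1 + c) * r ^ e"
      using mm_cost_power[OF assms(1-3)] unfolding c_def by blast
    have "real t \<le> real ((1 + c) * r ^ e)" using t(2) by (simp only: of_nat_le_iff)
    also have "\<dots> = real (1 + c) * real r ^ e" by (simp add: distrib_right)
    also have "\<dots> \<le> real (1 + c) * (real m powr \<sigma> * real n powr \<sigma>)"
      using re by (rule mult_left_mono) simp
    finally have 1: "real t \<le> real (1 + c) * real m powr \<sigma> * real n powr \<sigma>" by simp
    have "n\<^sup>2 \<le> (m ^ e)\<^sup>2" using ne by (rule power_mono) simp
    also have "\<dots> = (m\<^sup>2) ^ e" by (simp add: power_mult[symmetric] mult.commute)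
    also have "\<dots> \<le> r ^ e" using assms(3) by (intro power_mono) auto
    finally have "real (n\<^sup>2) \<le> real (r ^ e)" by (simp only: of_nat_le_iff)
    also have "\<dots> \<le> real m powr \<sigma> * real n powr \<sigma>" using re by simp
    also have "\<dots> \<le> real (1 + c) * (real m powr \<sigma> * real n powr \<sigma>)"
      using mult_right_mono[of 1 "real (1 + c)" "real m powr \<sigma> * real n powr \<sigma>"] by simp
    finally have 2: "(real n)\<^sup>2 \<le> real (1 + c) * real m powr \<sigma> * real n powr \<sigma>" by simp
    show "\<exists>t. mm_cost TYPE('u) TYPE('k) n t \<and> real t \<le> real (1 + c) * real m powr \<sigma> * real n powr \<sigma>
        \<and> (real n)\<^sup>2 \<le> real (1 + c) * real m powr \<sigma> * real n powr \<sigma>"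
      using mm_cost_pad[OF t(1) ne] 1 2 by blast
  qed
qed

section \<open>Second-order expansion of straight-line programs\<close>

text \<open>
  The 2-jet at 0 of a rational function that is defined at 0. Values matter only for almost all \<open>t\<close>,
  since a program may fail at finitely many points of a line.
\<close>

definition jet :: "('k::field \<Rightarrow> 'k) \<Rightarrow> 'k \<Rightarrow> 'k \<Rightarrow> 'k \<Rightarrow> bool" where
  "jet g a b c \<longleftrightarrow> (\<exists>N D. coeff D 0 \<noteq> 0 \<and>
     (\<forall>\<^sub>F t in cofinite. poly D t \<noteq> 0 \<and> g t = poly N t / poly D t) \<and>
     monom 1 3 dvd N - D * [:a, b, c:])"

lemma eventually_poly_nonzero: "p \<noteq> 0 \<Longrightarrow> \<forall>\<^sub>F t in cofinite. poly p t \<noteq> (0 :: 'k :: idom)"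
  by (simp add: eventually_cofinite poly_roots_finite)

lemma monom_dvd_coeffs: "monom 1 3 dvd (p :: 'k::field poly) \<longleftrightarrow> coeff p 0 = 0 \<and> coeff p 1 = 0 \<and> coeff p 2 = 0"
  by (auto simp: monom_1_dvd_iff' numeral_3_eq_3 numeral_2_eq_2 less_Suc_eq)

lemma coeff_mult_low:
  fixes p q :: "'k::comm_semiring_0 poly"
  shows "coeff (p * q) 0 = coeff p 0 * coeff q 0"
    and "coeff (p * q) 1 = coeff p 0 * coeff q 1 + coeff p 1 * coeff q 0"
    and "coeff (p * q) 2 = coeff p 0 * coeff q 2 + coeff p 1 * coeff q 1 + coeff p 2 * coeff q 0"
  by (simp_all add: coeff_mult numeral_2_eq_2 add_ac)

lemma coeff_list_low [simp]:
  "coeff [:a, b, c:] 0 = a" "coeff [:a, b, c:] 1 = b" "coeff [:a, b, c:] 2 = c"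
  "coeff [:a, b, c:] (Suc 0) = b"
  by (simp_all add: numeral_2_eq_2)

lemma jet_cong: "jet g a b c \<Longrightarrow> \<forall>\<^sub>F t in cofinite. g t = h t \<Longrightarrow> jet h a b c"
  unfolding jet_def by (force elim: eventually_elim2)

lemma jet_poly: "jet (poly p) (coeff p 0) (coeff p 1) (coeff p 2)"
  unfolding jet_def by (rule exI[of _ p], rule exI[of _ 1]) (simp add: monom_dvd_coeffs)

lemma jet_const: "jet (\<lambda>_. a) a 0 0"
proof -
  have "poly [:a:] = (\<lambda>_. a)" by auto
  then show ?thesis using jet_poly[of "[:a:]"] by (simp add: numeral_2_eq_2)
qed

lemma jet_line: "jet (\<lambda>t. a + t * b) a b 0"
proof -
  have "poly [:a, b:] = (\<lambda>t. a + t * b)" by auto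
  then show ?thesis using jet_poly[of "[:a, b:]"] by (simp add: numeral_2_eq_2)
qed

text \<open>Two quotients that agree at almost all points of an infinite field agree after cross
  multiplication as polynomials. Over the common denominator \<open>D * D'\<close>, which is
  invertible modulo t^3, the two truncations must then coincide.\<close>

lemma jet_unique:
  assumes "jet g a b c" "jet g a' b' c'" "infinite (UNIV :: 'k::field set)"
  shows "(c :: 'k) = c'"
proof -
  obtain N D where 1: "coeff D 0 \<noteq> 0" "\<forall>\<^sub>F t in cofinite. poly D t \<noteq> 0 \<and> g t = poly N t / poly D t"
    "monom 1 3 dvd N - D * [:a, b, c:]" using assms(1) by (auto simp: jet_def)
  obtain N' D' where 2: "coeff D' 0 \<noteq> 0" "\<forall>\<^sub>F t in cofinite. poly D' t \<noteq> 0 \<and> g t = poly N' t / poly D' t"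
    "monom 1 3 dvd N' - D' * [:a', b', c':]" using assms(2) by (auto simp: jet_def)
  have "\<forall>\<^sub>F t in cofinite. poly (N * D' - N' * D) t = 0"
    using 1(2) 2(2) by eventually_elim (auto simp: field_simps)
  then have eq: "N * D' - N' * D = 0"
  proof (rule contrapos_pp)
    assume "N * D' - N' * D \<noteq> 0"
    from eventually_poly_nonzero[OF this]
    show "\<not> (\<forall>\<^sub>F t in cofinite. poly (N * D' - N' * D) t = 0)"
      using assms(3) by (auto simp: eventually_cofinite dest: finite_UnI simp flip: Collect_disj_eq)
  qed
  have "D * (N' - D' * p') - D' * (N - D * p) = (D * D') * (p - p') - (N * D' - N' * D)" for p p'
    by (simp add: algebra_simps)
  then have "(D * D') * (p - p') = D * (N' - D' * p') - D' * (N - D * p)" for p p'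
    by (simp add: eq)
  then have "monom 1 3 dvd (D * D') * ([:a, b, c:] - [:a', b', c':])"
    using 1(3) 2(3) by (simp only: dvd_diff dvd_mult)
  then show ?thesis
    using 1(1) 2(1) unfolding monom_dvd_coeffs coeff_mult_low coeff_diff coeff_list_low by auto
qed

lemma jet_add:
  assumes "jet g1 a1 b1 c1" "jet g2 a2 b2 c2"
  shows "jet (\<lambda>t. g1 t + g2 t) (a1 + a2) (b1 + b2) (c1 + c2)"
proof -
  obtain N D where 1: "coeff D 0 \<noteq> 0" "\<forall>\<^sub>F t in cofinite. poly D t \<noteq> 0 \<and> g1 t = poly N t / poly D t"
    "monom 1 3 dvd N - D * [:a1, b1, c1:]" using assms(1) by (auto simp: jet_def)
  obtain N' D' where 2: "coeff D' 0 \<noteq> 0" "\<forall>\<^sub>F t in cofinite. poly D' t \<noteq> 0 \<and> g2 t = poly N' t / poly D' t"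
    "monom 1 3 dvd N' - D' * [:a2, b2, c2:]" using assms(2) by (auto simp: jet_def)
  have "\<forall>\<^sub>F t in cofinite. poly (D * D') t \<noteq> 0 \<and> g1 t + g2 t = poly (N * D' + N' * D) t / poly (D * D') t"
    using 1(2) 2(2) by eventually_elim (auto simp: field_simps)
  moreover have "N * D' + N' * D - (D * D') * [:a1 + a2, b1 + b2, c1 + c2:] =
      D' * (N - D * [:a1, b1, c1:]) + D * (N' - D' * [:a2, b2, c2:])"
  proof -
    have "[:a1 + a2, b1 + b2, c1 + c2:] = [:a1, b1, c1:] + [:a2, b2, c2:]" by simp
    then show ?thesis by (simp only: algebra_simps)
  qed
  then have "monom 1 3 dvd N * D' + N' * D - (D * D') * [:a1 + a2, b1 + b2, c1 + c2:]"
    using 1(3) 2(3) by (simp only: dvd_add dvd_mult)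
  moreover have "coeff (D * D') 0 \<noteq> 0" using 1(1) 2(1) by (simp add: coeff_mult_low)
  ultimately show ?thesis unfolding jet_def by blast
qed

lemma jet_mult:
  assumes "jet g1 a1 b1 c1" "jet g2 a2 b2 c2"
  shows "jet (\<lambda>t. g1 t * g2 t) (a1 * a2) (a1 * b2 + a2 * b1) (a2 * c1 + a1 * c2 + b1 * b2)"
proof -
  obtain N D where 1: "coeff D 0 \<noteq> 0" "\<forall>\<^sub>F t in cofinite. poly D t \<noteq> 0 \<and> g1 t = poly N t / poly D t"
    "monom 1 3 dvd N - D * [:a1, b1, c1:]" using assms(1) by (auto simp: jet_def)
  obtain N' D' where 2: "coeff D' 0 \<noteq> 0" "\<forall>\<^sub>F t in cofinite. poly D' t \<noteq> 0 \<and> g2 t = poly N' t / poly D' t"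
    "monom 1 3 dvd N' - D' * [:a2, b2, c2:]" using assms(2) by (auto simp: jet_def)
  define A where "A = [:a1 * a2, a1 * b2 + a2 * b1, a2 * c1 + a1 * c2 + b1 * b2:]"
  have "\<forall>\<^sub>F t in cofinite. poly (D * D') t \<noteq> 0 \<and> g1 t * g2 t = poly (N * N') t / poly (D * D') t"
    using 1(2) 2(2) by eventually_elim auto
  have eq: "N * N' - (D * D') * A = N' * (N - D * p) + (D * p) * (N' - D' * p') + (D * D') * (p * p' - A)"
    for p p' by (simp add: algebra_simps)
  have "monom 1 3 dvd [:a1, b1, c1:] * [:a2, b2, c2:] - A"
    unfolding monom_dvd_coeffs coeff_diff coeff_mult_low A_def by (simp add: algebra_simps)
  then have "monom 1 3 dvd N * N' - (D * D') * A"
    unfolding eq[of "[:a1, b1, c1:]" "[:a2, b2, c2:]"] using 1(3) 2(3) by (intro dvd_add dvd_mult)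
  moreover have "coeff (D * D') 0 \<noteq> 0" using 1(1) 2(1) by (simp add: coeff_mult_low)
  moreover have "\<forall>\<^sub>F t in cofinite. poly (D * D') t \<noteq> 0 \<and> g1 t * g2 t = poly (N * N') t / poly (D * D') t"
    by fact
  ultimately show ?thesis unfolding jet_def A_def by blast
qed

text \<open>Numerator and denominator change places; the constant coefficient of \<open>N\<close> is
  that of \<open>D\<close> times \<open>a\<close>, hence nonzero. The new coefficients are those of
  the power series of 1 / (a + b t + c t^2).\<close>

lemma jet_inverse:
  assumes "jet g a b c" "a \<noteq> 0"
  shows "\<forall>\<^sub>F t in cofinite. g t \<noteq> 0" "jet (\<lambda>t. 1 / g t) (1 / a) (- b / a^2) (b^2 / a^3 - c / a^2)"
proof -
  obtain N D where 1: "coeff D 0 \<noteq> 0" "\<forall>\<^sub>F t in cofinite. poly D t \<noteq> 0 \<and> g t = poly N t / poly D t"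
    "monom 1 3 dvd N - D * [:a, b, c:]" using assms(1) by (auto simp: jet_def)
  have N0: "coeff N 0 \<noteq> 0" using 1(1,3) assms(2) by (auto simp: monom_dvd_coeffs coeff_mult_low)
  then have "\<forall>\<^sub>F t in cofinite. poly N t \<noteq> 0" by (intro eventually_poly_nonzero) auto
  with 1(2) have ev: "\<forall>\<^sub>F t in cofinite. g t \<noteq> 0 \<and> poly N t \<noteq> 0 \<and> 1 / g t = poly D t / poly N t"
    by eventually_elim auto
  then show "\<forall>\<^sub>F t in cofinite. g t \<noteq> 0" by (rule eventually_mono) simp
  define A where "A = [:1 / a, - b / a^2, b^2 / a^3 - c / a^2:]"
  have "monom 1 3 dvd 1 - [:a, b, c:] * A"
    unfolding monom_dvd_coeffs coeff_diff coeff_mult_low A_def using assms(2)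
    by (simp add: field_simps power2_eq_square power3_eq_cube)
  moreover have "D - N * A = D * (1 - p * A) - A * (N - D * p)" for p by (simp add: algebra_simps)
  ultimately have "monom 1 3 dvd D - N * A"
    using 1(3) by (metis dvd_diff dvd_mult)
  moreover have "\<forall>\<^sub>F t in cofinite. poly N t \<noteq> 0 \<and> 1 / g t = poly D t / poly N t"
    using ev by (rule eventually_mono) simp
  ultimately show "jet (\<lambda>t. 1 / g t) (1 / a) (- b / a^2) (b^2 / a^3 - c / a^2)"
    unfolding jet_def A_def using N0 by blast
qed

section \<open>Jets of the values computed by a program\<close>

lemma linear_form_0 [simp]: "linear_form I (\<lambda>_. 0)"
  by (simp add: linear_form_def)

lemma linear_form_proj: "linear_form I (\<lambda>u. u i)"
  by (simp add: linear_form_def)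

lemma linear_form_add: "linear_form I a \<Longrightarrow> linear_form I b \<Longrightarrow> linear_form I (\<lambda>u. a u + b u)"
  by (simp add: linear_form_def algebra_simps)

lemma linear_form_scale: "linear_form I a \<Longrightarrow> linear_form I (\<lambda>u. c * a u)"
  by (simp add: linear_form_def algebra_simps)

text \<open>The order of the quantifiers is the content: \<open>b\<close>, the weights and the pair
  \<open>l\<close>, \<open>l'\<close> are fixed at the base point and serve all directions
  \<open>x\<close> at once. For addition and subtraction \<open>\<kappa>\<close> is 0, so only
  multiplication and division create a product of linear forms.\<close>

lemma operation_jets:
  assumes "apply_operation f a1 a2 = Some z" "linear_form I b1" "linear_form I b2"
  shows "\<exists>b \<mu>1 \<mu>2 \<kappa> l l'. linear_form I b \<and> linear_form I l \<and> linear_form I l' \<and>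
    (\<forall>g1 g2 x c1 c2. jet g1 a1 (b1 x) c1 \<longrightarrow> jet g2 a2 (b2 x) c2 \<longrightarrow>
      (\<exists>g. (\<forall>\<^sub>F t in cofinite. apply_operation f (g1 t) (g2 t) = Some (g t)) \<and>
        jet g z (b x) (\<mu>1 * c1 + \<mu>2 * c2 + \<kappa> * l x * l' x)))"
proof (cases f)
  case Add
  show ?thesis
  proof (rule exI[of _ "\<lambda>x. b1 x + b2 x"], rule exI[of _ "1"], rule exI[of _ "1"], rule exI[of _ "0"],
      rule exI[of _ b1], rule exI[of _ b1], intro conjI allI impI)
    show "linear_form I (\<lambda>x. b1 x + b2 x)" "linear_form I b1" "linear_form I b1"
      by (intro linear_form_add linear_form_scale assms)+
    fix g1 g2 x c1 c2 assume j: "jet g1 a1 (b1 x) c1" "jet g2 a2 (b2 x) c2"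
    show "\<exists>g. (\<forall>\<^sub>F t in cofinite. apply_operation f (g1 t) (g2 t) = Some (g t)) \<and>
        jet g z ((\<lambda>x. b1 x + b2 x) x) (1 * c1 + 1 * c2 + 0 * b1 x * b1 x)"
      by (rule exI[of _ "\<lambda>t. g1 t + g2 t"]) (use jet_add[OF j] assms(1) in \<open>simp add: Add\<close>)
  qed
next
  case Sub
  show ?thesis
  proof (rule exI[of _ "\<lambda>x. b1 x + (-1) * b2 x"], rule exI[of _ "1"], rule exI[of _ "(-1)"], rule exI[of _ "0"],
      rule exI[of _ b1], rule exI[of _ b1], intro conjI allI impI)
    show "linear_form I (\<lambda>x. b1 x + (-1) * b2 x)" "linear_form I b1" "linear_form I b1"
      by (intro linear_form_add linear_form_scale assms)+
    fix g1 g2 x c1 c2 assume j: "jet g1 a1 (b1 x) c1" "jet g2 a2 (b2 x) c2"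
    show "\<exists>g. (\<forall>\<^sub>F t in cofinite. apply_operation f (g1 t) (g2 t) = Some (g t)) \<and>
        jet g z ((\<lambda>x. b1 x + (-1) * b2 x) x) (1 * c1 + (-1) * c2 + 0 * b1 x * b1 x)"
      by (rule exI[of _ "\<lambda>t. g1 t - g2 t"]) (use jet_add[OF j(1) jet_mult[OF jet_const[of "-1"] j(2)]] assms(1) in \<open>simp add: Sub\<close>)
  qed
next
  case Mul
  show ?thesis
  proof (rule exI[of _ "\<lambda>x. a1 * b2 x + a2 * b1 x"], rule exI[of _ "a2"], rule exI[of _ "a1"], rule exI[of _ "1"],
      rule exI[of _ b1], rule exI[of _ b2], intro conjI allI impI)
    show "linear_form I (\<lambda>x. a1 * b2 x + a2 * b1 x)" "linear_form I b1" "linear_form I b2"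
      by (intro linear_form_add linear_form_scale assms)+
    fix g1 g2 x c1 c2 assume j: "jet g1 a1 (b1 x) c1" "jet g2 a2 (b2 x) c2"
    show "\<exists>g. (\<forall>\<^sub>F t in cofinite. apply_operation f (g1 t) (g2 t) = Some (g t)) \<and>
        jet g z ((\<lambda>x. a1 * b2 x + a2 * b1 x) x) (a2 * c1 + a1 * c2 + 1 * b1 x * b2 x)"
      by (rule exI[of _ "\<lambda>t. g1 t * g2 t"]) (use jet_mult[OF j] assms(1) in \<open>simp add: Mul\<close>)
  qed
next
  case Div
  then have a2: "a2 \<noteq> 0" "z = a1 / a2" using assms(1) by (auto split: if_splits)
  \<comment> \<open>The linear part of the quotient. Comparing second-order coefficients in g1 = (g1
    / g2) * g2 leaves the single product \<open>b x * b2 x\<close>, where direct expansion shows two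
    terms.\<close>
  define b where "b = (\<lambda>x. 1 / a2 * b1 x + (- a1 / a2^2) * b2 x)"
  have b: "linear_form I b" unfolding b_def by (intro linear_form_add linear_form_scale assms)
  have jet: "jet (\<lambda>t. g1 t / g2 t) z (b x) (1 / a2 * c1 + (- a1 / a2^2) * c2 + (- 1 / a2) * b x * b2 x)"
    if "jet g1 a1 (b1 x) c1" "jet g2 a2 (b2 x) c2" for g1 g2 x c1 c2
  proof -
    have "(1 / a2) * c1 + a1 * ((b2 x)^2 / a2^3 - c2 / a2^2) + b1 x * (- b2 x / a2^2)
      = 1 / a2 * c1 + (- a1 / a2^2) * c2 + (- 1 / a2) * b x * b2 x"
      unfolding b_def using a2(1) by (simp add: field_simps power2_eq_square power3_eq_cube)
    moreover have "a1 * (- b2 x / a2^2) + 1 / a2 * b1 x = b x"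
      unfolding b_def by simp
    moreover have "(\<lambda>t. g1 t * (1 / g2 t)) = (\<lambda>t. g1 t / g2 t)" "a1 * (1 / a2) = z"
      using a2 by simp_all
    ultimately show ?thesis
      using jet_mult[OF that(1) jet_inverse(2)[OF that(2) a2(1)]] by (simp only:)
  qed
  show ?thesis
  proof (rule exI[of _ b], rule exI[of _ "1 / a2"], rule exI[of _ "- a1 / a2^2"], rule exI[of _ "- 1 / a2"],
      rule exI[of _ b], rule exI[of _ b2], intro conjI allI impI)
    show "linear_form I b" "linear_form I b" "linear_form I b2" by (fact b assms(3))+
    fix g1 g2 x c1 c2 assume j: "jet g1 a1 (b1 x) c1" "jet g2 a2 (b2 x) c2"
    have "\<forall>\<^sub>F t in cofinite. apply_operation f (g1 t) (g2 t) = Some (g1 t / g2 t)"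
      using jet_inverse(1)[OF j(2) a2(1)] by eventually_elim (simp add: Div)
    then show "\<exists>g. (\<forall>\<^sub>F t in cofinite. apply_operation f (g1 t) (g2 t) = Some (g t)) \<and>
        jet g z (b x) (1 / a2 * c1 + (- a1 / a2^2) * c2 + (- 1 / a2) * b x * b2 x)"
      using jet[OF j] by (intro exI[of _ "\<lambda>t. g1 t / g2 t"] conjI)
  qed
qed

text \<open>Inputs and scalars are affine along every line and have no second-order part; a
  \<open>Result\<close> inherits the weights of its instruction. Again \<open>b'\<close> and
  \<open>W'\<close> are fixed before the direction \<open>d\<close>.\<close>

lemma operand_jets:
  assumes x: "operand_value \<xi> rs x = Some a" and len: "length rs = L"
    and b: "\<And>i. i < L \<Longrightarrow> linear_form I (b i)"
  shows "\<exists>b' W'. linear_form I b' \<and> (\<forall>d R. (\<forall>\<^sub>F t in cofinite. length (R t) = L) \<and>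
    (\<forall>i<L. jet (\<lambda>t. R t ! i) (rs ! i) (b i d) (\<Sum>s<N. W i s * l s d * l' s d)) \<longrightarrow>
    (\<exists>g. (\<forall>\<^sub>F t in cofinite. operand_value (\<lambda>i. \<xi> i + t * d i) (R t) x = Some (g t)) \<and>
      jet g a (b' d) (\<Sum>s<N. W' s * l s d * l' s d)))"
proof (cases x)
  case (Input i)
  show ?thesis using x Input
    by (intro exI[of _ "\<lambda>d. d i"] exI[of _ "\<lambda>_. 0"])
      (auto simp: linear_form_proj intro: exI[of _ "\<lambda>t. \<xi> i + t * _ i"] jet_line)
next
  case (Scalar c)
  show ?thesis using x Scalar
    by (intro exI[of _ "\<lambda>d. 0"] exI[of _ "\<lambda>_. 0"])
      (auto intro: exI[of _ "\<lambda>t. c"] jet_const)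
next
  case (Result i)
  then have i: "i < L" "a = rs ! i" using x len by (auto split: if_splits)
  have "\<forall>\<^sub>F t in cofinite. operand_value (\<lambda>i. \<xi> i + t * d i) (R t) x = Some (R t ! i)"
    if "\<forall>\<^sub>F t in cofinite. length (R t) = L" for d R
    using that by eventually_elim (simp add: Result i)
  note * = this
  show ?thesis
  proof (intro exI[of _ "b i"] exI[of _ "W i"] conjI allI impI)
    show "linear_form I (b i)" using i b by simp
    fix d R assume h: "(\<forall>\<^sub>F t in cofinite. length (R t) = L) \<and>
      (\<forall>i<L. jet (\<lambda>t. R t ! i) (rs ! i) (b i d) (\<Sum>s<N. W i s * l s d * l' s d))"
    then have "jet (\<lambda>t. R t ! i) a (b i d) (\<Sum>s<N. W i s * l s d * l' s d)" using i by simp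
    then show "\<exists>g. (\<forall>\<^sub>F t in cofinite. operand_value (\<lambda>i. \<xi> i + t * d i) (R t) x = Some (g t)) \<and>
        jet g a (b i d) (\<Sum>s<N. W i s * l s d * l' s d)"
      using *[OF conjunct1[OF h]] by (intro exI[of _ "\<lambda>t. R t ! i"] conjI)
  qed
qed

text \<open>Success at \<open>\<xi>\<close> means that every divisor is nonzero there, so along any
  line through \<open>\<xi>\<close> it vanishes at finitely many points only. Each instruction owns
  one product of linear forms, and \<open>W\<close> records the weights with which it enters the
  second-order parts; none of this depends on the direction \<open>x\<close>.\<close>

lemma run_jets:
  assumes "run \<xi> P [] = Some rs"
  shows "\<exists>b W l l'. (\<forall>i<length P. linear_form I (b i) \<and> linear_form I (l i) \<and> linear_form I (l' i)) \<and>
    (\<forall>x. \<exists>R. (\<forall>\<^sub>F t in cofinite. run (\<lambda>i. \<xi> i + t * x i) P [] = Some (R t)) \<and>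
      (\<forall>i<length P. jet (\<lambda>t. R t ! i) (rs ! i) (b i x) (\<Sum>s<length P. W i s * l s x * l' s x)))"
  using assms
proof (induction P arbitrary: rs rule: rev_induct)
  case Nil
  then show ?case by (auto intro!: exI[of _ "\<lambda>_. []"])
next
  case (snoc ins P)
  obtain f o1 o2 where ins: "ins = (f, o1, o2)" by (cases ins)
  obtain rs0 a1 a2 z where rs0: "run \<xi> P [] = Some rs0" "operand_value \<xi> rs0 o1 = Some a1"
    "operand_value \<xi> rs0 o2 = Some a2" "apply_operation f a1 a2 = Some z" "rs = rs0 @ [z]"
    using snoc.prems by (auto simp: run_append ins split: option.splits)
  define L where "L = length P"
  have len: "length rs0 = L" using run_length[OF rs0(1)] by (simp add: L_def)
  obtain b W l l' where lin: "\<And>i. i < L \<Longrightarrow> linear_form I (b i) \<and> linear_form I (l i) \<and> linear_form I (l' i)"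
    and R: "\<And>x. \<exists>R. (\<forall>\<^sub>F t in cofinite. run (\<lambda>i. \<xi> i + t * x i) P [] = Some (R t)) \<and>
      (\<forall>i<L. jet (\<lambda>t. R t ! i) (rs0 ! i) (b i x) (\<Sum>s<L. W i s * l s x * l' s x))"
    using snoc.IH[OF rs0(1)] unfolding L_def by blast
  obtain b1 W1 where 1: "linear_form I b1" "\<And>d R. (\<forall>\<^sub>F t in cofinite. length (R t) = L) \<and>
    (\<forall>i<L. jet (\<lambda>t. R t ! i) (rs0 ! i) (b i d) (\<Sum>s<L. W i s * l s d * l' s d)) \<Longrightarrow>
    (\<exists>g. (\<forall>\<^sub>F t in cofinite. operand_value (\<lambda>i. \<xi> i + t * d i) (R t) o1 = Some (g t)) \<and>
      jet g a1 (b1 d) (\<Sum>s<L. W1 s * l s d * l' s d))"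
    using operand_jets[OF rs0(2) len, where I = I and b = b and N = L and W = W and l = l and l' = l'] lin by blast
  obtain b2 W2 where 2: "linear_form I b2" "\<And>d R. (\<forall>\<^sub>F t in cofinite. length (R t) = L) \<and>
    (\<forall>i<L. jet (\<lambda>t. R t ! i) (rs0 ! i) (b i d) (\<Sum>s<L. W i s * l s d * l' s d)) \<Longrightarrow>
    (\<exists>g. (\<forall>\<^sub>F t in cofinite. operand_value (\<lambda>i. \<xi> i + t * d i) (R t) o2 = Some (g t)) \<and>
      jet g a2 (b2 d) (\<Sum>s<L. W2 s * l s d * l' s d))"
    using operand_jets[OF rs0(3) len, where I = I and b = b and N = L and W = W and l = l and l' = l'] lin by blast
  obtain b' \<mu>1 \<mu>2 \<kappa> k k' where 3: "linear_form I b'" "linear_form I k" "linear_form I k'"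
    "\<And>g1 g2 x c1 c2. jet g1 a1 (b1 x) c1 \<Longrightarrow> jet g2 a2 (b2 x) c2 \<Longrightarrow>
      (\<exists>g. (\<forall>\<^sub>F t in cofinite. apply_operation f (g1 t) (g2 t) = Some (g t)) \<and>
        jet g z (b' x) (\<mu>1 * c1 + \<mu>2 * c2 + \<kappa> * k x * k' x))"
    using operation_jets[OF rs0(4) 1(1) 2(1)] by blast
  \<comment> \<open>Column \<open>L\<close> belongs to the new product, which only the new
    instruction uses; row \<open>L\<close> combines the weights of its two operands.\<close>
  define W' where "W' i s = (if s = L then (if i = L then \<kappa> else 0)
    else if i = L then \<mu>1 * W1 s + \<mu>2 * W2 s else W i s)" for i s
  have R': "\<exists>R. (\<forall>\<^sub>F t in cofinite. run (\<lambda>i. \<xi> i + t * x i) (P @ [ins]) [] = Some (R t)) \<and>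
      (\<forall>i<Suc L. jet (\<lambda>t. R t ! i) (rs ! i) ((b(L := b')) i x)
        (\<Sum>s<Suc L. W' i s * (l(L := k)) s x * (l'(L := k')) s x))" for x
  proof -
    obtain R where R: "\<forall>\<^sub>F t in cofinite. run (\<lambda>i. \<xi> i + t * x i) P [] = Some (R t)"
      "\<forall>i<L. jet (\<lambda>t. R t ! i) (rs0 ! i) (b i x) (\<Sum>s<L. W i s * l s x * l' s x)"
      using R[of x] by blast
    have lenR: "\<forall>\<^sub>F t in cofinite. length (R t) = L"
      using R(1) by (rule eventually_mono) (auto dest: run_length simp: L_def)
    obtain g1 where g1: "\<forall>\<^sub>F t in cofinite. operand_value (\<lambda>i. \<xi> i + t * x i) (R t) o1 = Some (g1 t)"
      "jet g1 a1 (b1 x) (\<Sum>s<L. W1 s * l s x * l' s x)" using 1(2) R(2) lenR by blast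
    obtain g2 where g2: "\<forall>\<^sub>F t in cofinite. operand_value (\<lambda>i. \<xi> i + t * x i) (R t) o2 = Some (g2 t)"
      "jet g2 a2 (b2 x) (\<Sum>s<L. W2 s * l s x * l' s x)" using 2(2) R(2) lenR by blast
    obtain g where g: "\<forall>\<^sub>F t in cofinite. apply_operation f (g1 t) (g2 t) = Some (g t)"
      "jet g z (b' x) (\<mu>1 * (\<Sum>s<L. W1 s * l s x * l' s x) + \<mu>2 * (\<Sum>s<L. W2 s * l s x * l' s x) + \<kappa> * k x * k' x)"
      using 3(4)[OF g1(2) g2(2)] by blast
    have "\<forall>\<^sub>F t in cofinite. run (\<lambda>i. \<xi> i + t * x i) (P @ [ins]) [] = Some (R t @ [g t])"
      using R(1) g1(1) g2(1) g(1) by eventually_elim (simp add: run_append ins)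
    moreover have "jet (\<lambda>t. (R t @ [g t]) ! i) (rs ! i) ((b(L := b')) i x)
        (\<Sum>s<Suc L. W' i s * (l(L := k)) s x * (l'(L := k')) s x)" if "i < Suc L" for i
    proof (cases "i = L")
      case True
      have "(\<Sum>s<Suc L. W' i s * (l(L := k)) s x * (l'(L := k')) s x) =
        \<mu>1 * (\<Sum>s<L. W1 s * l s x * l' s x) + \<mu>2 * (\<Sum>s<L. W2 s * l s x * l' s x) + \<kappa> * k x * k' x"
      proof -
        have "(\<Sum>s<L. W' i s * (l(L := k)) s x * (l'(L := k')) s x) =
            (\<Sum>s<L. \<mu>1 * (W1 s * l s x * l' s x) + \<mu>2 * (W2 s * l s x * l' s x))"
          using True by (intro sum.cong) (auto simp: W'_def algebra_simps)
        then show ?thesis by (simp add: True W'_def sum_distrib_left sum.distrib)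
      qed
      then have "jet g (rs ! i) ((b(L := b')) i x)
          (\<Sum>s<Suc L. W' i s * (l(L := k)) s x * (l'(L := k')) s x)"
        using g(2) True rs0(5) len by (simp add: nth_append del: sum.lessThan_Suc)
      moreover have "\<forall>\<^sub>F t in cofinite. g t = (R t @ [g t]) ! i"
        using lenR by eventually_elim (simp add: True nth_append)
      ultimately show ?thesis by (rule jet_cong)
    next
      case False
      with that have i: "i < L" by simp
      have "(\<Sum>s<Suc L. W' i s * (l(L := k)) s x * (l'(L := k')) s x) = (\<Sum>s<L. W i s * l s x * l' s x)"
        using False by (simp add: W'_def)
      then have "jet (\<lambda>t. R t ! i) (rs ! i) ((b(L := b')) i x)
          (\<Sum>s<Suc L. W' i s * (l(L := k)) s x * (l'(L := k')) s x)"
        using R(2) i rs0(5) len by (simp add: nth_append del: sum.lessThan_Suc)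
      moreover have "\<forall>\<^sub>F t in cofinite. R t ! i = (R t @ [g t]) ! i"
        using lenR by eventually_elim (simp add: i nth_append)
      ultimately show ?thesis by (rule jet_cong)
    qed
    ultimately show ?thesis by (intro exI[of _ "\<lambda>t. R t @ [g t]"]) auto
  qed
  have lin': "\<forall>i<Suc L. linear_form I ((b(L := b')) i) \<and> linear_form I ((l(L := k)) i) \<and> linear_form I ((l'(L := k')) i)"
    using lin 3(1-3) by (auto simp: less_Suc_eq)
  show ?case
    unfolding length_append_singleton L_def[symmetric]
    by (intro exI[of _ "b(L := b')"] exI[of _ W'] exI[of _ "l(L := k)"] exI[of _ "l'(L := k')"])
      (rule conjI[OF lin' allI[OF R']])
qed

lemma coord_space_line:
  "u \<in> coord_space I \<Longrightarrow> v \<in> coord_space I \<Longrightarrow> (\<lambda>i. u i + c * v i :: 'k::field) \<in> coord_space I"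
  by (simp add: coord_space_def)

text \<open>Along a line an output is the polynomial \<open>p\<close> and also has the jet predicted
  by the program, so uniqueness of jets identifies the coefficients of t^2. All outputs
  \<open>j\<close> share the same forms \<open>l\<close>, \<open>l'\<close>; only the weights depend
  on \<open>j\<close>, which is what bounds a rank by the program length.\<close>

lemma second_order:
  assumes inf: "infinite (UNIV :: 'k::field set)"
    and comp: "computes I J P out \<phi>" and \<xi>: "\<xi> \<in> coord_space I" and run: "run \<xi> P [] = Some rs"
  shows "\<exists>W l l'. (\<forall>s<length P. linear_form I (l s) \<and> linear_form I (l' s)) \<and>
    (\<forall>x\<in>coord_space I. \<forall>j\<in>J. \<forall>p :: 'k poly. (\<forall>t. \<phi> (\<lambda>i. \<xi> i + t * x i) j = poly p t) \<longrightarrow>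
      coeff p 2 = (\<Sum>s<length P. W j s * l s x * l' s x))"
proof -
  define L where "L = length P"
  have len: "length rs = L" using run_length[OF run] by (simp add: L_def)
  obtain b W l l' where lin: "\<And>i. i < L \<Longrightarrow> linear_form I (b i) \<and> linear_form I (l i) \<and> linear_form I (l' i)"
    and R: "\<And>x. \<exists>R. (\<forall>\<^sub>F t in cofinite. run (\<lambda>i. \<xi> i + t * x i) P [] = Some (R t)) \<and>
      (\<forall>i<L. jet (\<lambda>t. R t ! i) (rs ! i) (b i x) (\<Sum>s<L. W i s * l s x * l' s x))"
    using run_jets[OF run, of I] unfolding L_def by blast
  define Q where "Q j V \<longleftrightarrow> (\<forall>x\<in>coord_space I. \<forall>p :: 'k poly.
      (\<forall>t. \<phi> (\<lambda>i. \<xi> i + t * x i) j = poly p t) \<longrightarrow> coeff p 2 = (\<Sum>s<L. V s * l s x * l' s x))" for j V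
  have "\<exists>V. Q j V" if j: "j \<in> J" for j
  proof -
    have o: "operand_value \<xi> rs (out j) = Some (\<phi> \<xi> j)" using comp \<xi> run j by (auto simp: computes_def)
    obtain b' V where V: "\<And>d R. (\<forall>\<^sub>F t in cofinite. length (R t) = L) \<and>
      (\<forall>i<L. jet (\<lambda>t. R t ! i) (rs ! i) (b i d) (\<Sum>s<L. W i s * l s d * l' s d)) \<Longrightarrow>
      (\<exists>g. (\<forall>\<^sub>F t in cofinite. operand_value (\<lambda>i. \<xi> i + t * d i) (R t) (out j) = Some (g t)) \<and>
        jet g (\<phi> \<xi> j) (b' d) (\<Sum>s<L. V s * l s d * l' s d))"
      using operand_jets[OF o len, where I = I and b = b and N = L and W = W and l = l and l' = l'] lin by blast
    have "coeff p 2 = (\<Sum>s<L. V s * l s x * l' s x)"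
      if x: "x \<in> coord_space I" and p: "\<And>t. \<phi> (\<lambda>i. \<xi> i + t * x i) j = poly p t" for x p
    proof -
      obtain R where R: "\<forall>\<^sub>F t in cofinite. run (\<lambda>i. \<xi> i + t * x i) P [] = Some (R t)"
        "\<forall>i<L. jet (\<lambda>t. R t ! i) (rs ! i) (b i x) (\<Sum>s<L. W i s * l s x * l' s x)"
        using R[of x] by blast
      have lenR: "\<forall>\<^sub>F t in cofinite. length (R t) = L"
        using R(1) by (rule eventually_mono) (auto dest: run_length simp: L_def)
      obtain g where g: "\<forall>\<^sub>F t in cofinite. operand_value (\<lambda>i. \<xi> i + t * x i) (R t) (out j) = Some (g t)"
        "jet g (\<phi> \<xi> j) (b' x) (\<Sum>s<L. V s * l s x * l' s x)" using V R(2) lenR by blast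
      have "\<forall>\<^sub>F t in cofinite. g t = poly p t"
        using R(1) g(1)
      proof eventually_elim
        case (elim t)
        have "operand_value (\<lambda>i. \<xi> i + t * x i) (R t) (out j) = Some (\<phi> (\<lambda>i. \<xi> i + t * x i) j)"
          using comp elim(1) j coord_space_line[OF \<xi> x] unfolding computes_def by blast
        then show ?case using elim(2) p by simp
      qed
      from jet_cong[OF g(2) this] have "jet (poly p) (\<phi> \<xi> j) (b' x) (\<Sum>s<L. V s * l s x * l' s x)" .
      from jet_unique[OF jet_poly this inf] show ?thesis .
    qed
    then show ?thesis unfolding Q_def by blast
  qed
  then obtain V where V: "\<And>j. j \<in> J \<Longrightarrow> Q j (V j)" by metis
  show ?thesis
  proof (intro exI conjI ballI allI impI)
    fix s assume "s < length P"
    then show "linear_form I (l s)" "linear_form I (l' s)" using lin by (simp_all add: L_def)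
  next
    fix x j p assume "x \<in> coord_space I" "j \<in> J" "\<forall>t. \<phi> (\<lambda>i. \<xi> i + t * x i) j = poly p t"
    then show "coeff p 2 = (\<Sum>s<length P. V j s * l s x * l' s x)"
      using V unfolding Q_def L_def by simp
  qed
qed

section \<open>Moving the base point by interpolation\<close>

text \<open>Expansion starts at the good point \<open>\<xi>\<close>; the substitution t = 1 - s
  turns the line around so that s = 0 is \<open>\<eta>\<close>.\<close>

lemma run_success_cofinite:
  assumes "run \<xi> P [] \<noteq> None"
  shows "finite {s. run (\<lambda>i. \<eta> i + s * (\<xi> i - \<eta> i)) P [] = None}"
proof -
  obtain rs where rs: "run \<xi> P [] = Some rs" using assms by auto
  obtain R where "\<forall>\<^sub>F t in cofinite. run (\<lambda>i. \<xi> i + t * (\<eta> i - \<xi> i)) P [] = Some (R t)"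
    using run_jets[OF rs, of UNIV] by meson
  then have "finite {t. run (\<lambda>i. \<xi> i + t * (\<eta> i - \<xi> i)) P [] = None}"
    unfolding eventually_cofinite by (rule rev_finite_subset) auto
  then have "finite ((\<lambda>t. 1 - t) ` {t. run (\<lambda>i. \<xi> i + t * (\<eta> i - \<xi> i)) P [] = None})" by simp
  moreover have "{s. run (\<lambda>i. \<eta> i + s * (\<xi> i - \<eta> i)) P [] = None} \<subseteq>
      (\<lambda>t. 1 - t) ` {t. run (\<lambda>i. \<xi> i + t * (\<eta> i - \<xi> i)) P [] = None}"
  proof
    fix s assume "s \<in> {s. run (\<lambda>i. \<eta> i + s * (\<xi> i - \<eta> i)) P [] = None}"
    moreover have "(\<lambda>i. \<xi> i + (1 - s) * (\<eta> i - \<xi> i)) = (\<lambda>i. \<eta> i + s * (\<xi> i - \<eta> i))"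
      by (simp add: fun_eq_iff algebra_simps)
    ultimately show "s \<in> (\<lambda>t. 1 - t) ` {t. run (\<lambda>i. \<xi> i + t * (\<eta> i - \<xi> i)) P [] = None}"
      by (intro image_eqI[of _ _ "1 - s"]) auto
  qed
  ultimately show ?thesis by (rule rev_finite_subset)
qed

text \<open>The weights are the Lagrange basis polynomials of \<open>A\<close> evaluated at 0. They
  are the same for all \<open>q\<close>, so they can be merged into the weights of the products of
  linear forms.\<close>

lemma lagrange_at_0:
  assumes "finite A" "card A = Suc D"
  shows "\<exists>h. \<forall>q :: 'k::field poly. degree q \<le> D \<longrightarrow> poly q 0 = (\<Sum>a\<in>A. h a * poly q a)"
proof -
  define B where "B a = (\<Prod>b\<in>A - {a}. smult (1 / (a - b)) [:- b, 1:])" for a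
  have B: "poly (B a) c = (if c = a then 1 else 0)" if "a \<in> A" "c \<in> A" for a c
  proof (cases "c = a")
    case True
    have "(\<Prod>b\<in>A - {a}. poly (smult (1 / (a - b)) [:- b, 1:]) a) = 1"
    proof (rule prod.neutral, rule ballI)
      fix b assume "b \<in> A - {a}"
      then have "a - b \<noteq> 0" by auto
      moreover have "poly (smult (1 / (a - b)) [:- b, 1:]) a = 1 / (a - b) * (a - b)"
        by (simp only: poly_smult poly_pCons poly_0) simp
      ultimately show "poly (smult (1 / (a - b)) [:- b, 1:]) a = 1" by simp
    qed
    then show ?thesis using True by (simp add: B_def poly_prod)
  next
    case False
    then show ?thesis using that assms(1) by (auto simp: B_def poly_prod intro!: prod_zero bexI[of _ c])
  qed
  have degB: "degree (B a) \<le> D" if "a \<in> A" for a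
  proof -
    have "degree (B a) \<le> (\<Sum>b\<in>A - {a}. degree (smult (1 / (a - b)) [:- b, 1:]))"
      unfolding B_def using degree_prod_sum_le[of "A - {a}" "\<lambda>b. smult (1 / (a - b)) [:- b, 1:]"] assms(1)
      unfolding comp_def by blast
    also have "\<dots> \<le> (\<Sum>b\<in>A - {a}. 1)" by (intro sum_mono) auto
    also have "\<dots> = D" using assms that by simp
    finally show ?thesis .
  qed
  have "poly q 0 = (\<Sum>a\<in>A. poly (B a) 0 * poly q a)" if "degree q \<le> D" for q
  proof -
    define r where "r = q - (\<Sum>a\<in>A. smult (poly q a) (B a))"
    have "r = 0"
    proof (rule ccontr)
      assume "r \<noteq> 0"
      have "A \<subseteq> {x. poly r x = 0}"
      proof
        fix x assume x: "x \<in> A"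
        have "(\<Sum>a\<in>A. poly q a * poly (B a) x) = (\<Sum>a\<in>A. if x = a then poly q a else 0)"
          using B[OF _ x] by (intro sum.cong) auto
        then show "x \<in> {x. poly r x = 0}" using x assms(1) by (simp add: r_def poly_sum)
      qed
      then have "card A \<le> card {x. poly r x = 0}"
        using poly_roots_finite[OF \<open>r \<noteq> 0\<close>] by (intro card_mono)
      also have "\<dots> \<le> degree r" using \<open>r \<noteq> 0\<close> by (rule poly_roots_degree)
      also have "\<dots> \<le> D" unfolding r_def
        using that assms(1) degB
        by (intro degree_diff_le degree_sum_le) (auto intro: order_trans[OF degree_smult_le])
      finally show False using assms(2) by simp
    qed
    then have "poly (q - (\<Sum>a\<in>A. smult (poly q a) (B a))) 0 = 0" by (simp add: r_def)
    then show ?thesis by (simp add: poly_sum mult.commute)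
  qed
  then show ?thesis by (intro exI[of _ "\<lambda>a. poly (B a) 0"]) simp
qed

text \<open>\<open>g\<close> is the polynomial \<open>q\<close> in \<open>t\<close> over the polynomials in \<open>s\<close>, of degree at most \<open>D\<close> in \<open>s\<close>.\<close>

definition bipoly :: "nat \<Rightarrow> 'k::field poly poly \<Rightarrow> ('k \<Rightarrow> 'k \<Rightarrow> 'k) \<Rightarrow> bool" where
  "bipoly D q g \<longleftrightarrow> (\<forall>b. degree (coeff q b) \<le> D) \<and> (\<forall>s t. g s t = poly (poly q [:t:]) s)"

lemma poly_poly_const: "poly (poly q [:t:]) s = poly (map_poly (\<lambda>c. poly c s) q) (t :: 'k::field)"
  by (induction q) (auto simp: map_poly_pCons)

lemma bipoly_add:
  "bipoly D q g \<Longrightarrow> bipoly D r h \<Longrightarrow> bipoly D (q + r) (\<lambda>s t. g s t + h s t)"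
  by (auto simp: bipoly_def intro: degree_add_le)

lemma bipoly_mult:
  "bipoly D q g \<Longrightarrow> bipoly E r h \<Longrightarrow> bipoly (D + E) (q * r) (\<lambda>s t. g s t * h s t)"
  unfolding bipoly_def coeff_mult
  by (auto intro!: degree_sum_le order_trans[OF degree_mult_le] add_mono)

lemma bipoly_const: "bipoly 0 [:[:c:]:] (\<lambda>s t. c)"
  by (auto simp: bipoly_def coeff_pCons split: nat.splits)

lemma bipoly_affine: "bipoly 1 [:[:a, b:], [:c:]:] (\<lambda>s t. a + s * b + t * c)"
  by (auto simp: bipoly_def coeff_pCons algebra_simps split: nat.splits)

lemma bipoly_mono: "bipoly D q g \<Longrightarrow> D \<le> E \<Longrightarrow> bipoly E q g"
  by (auto simp: bipoly_def intro: order_trans)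

text \<open>
  The program may fail at the point \<open>\<eta>\<close>. It succeeds at almost all points of a line through \<open>\<eta>\<close>, and
  the second-order part of \<open>\<phi>\<close> at \<open>\<eta>\<close> is interpolated from \<open>D + 1\<close> of these.
\<close>

lemma second_order_everywhere:
  assumes inf: "infinite (UNIV :: 'k::field set)"
    and comp: "computes I J P out \<phi>" and \<eta>: "\<eta> \<in> coord_space I"
    and bipoly: "\<And>\<xi> x j. \<xi> \<in> coord_space I \<Longrightarrow> x \<in> coord_space I \<Longrightarrow> j \<in> J \<Longrightarrow>
      \<exists>q. bipoly D q (\<lambda>s t. \<phi> (\<lambda>i. \<eta> i + s * \<xi> i + t * x i) j)"
  shows "\<exists>(F :: ('k \<times> nat) set) W l l'. finite F \<and> card F = Suc D * length P \<and>
    (\<forall>s\<in>F. linear_form I (l s) \<and> linear_form I (l' s)) \<and>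
    (\<forall>x\<in>coord_space I. \<forall>j\<in>J. \<forall>p :: 'k poly. (\<forall>t. \<phi> (\<lambda>i. \<eta> i + t * x i) j = poly p t) \<longrightarrow>
      coeff p 2 = (\<Sum>s\<in>F. W j s * l s x * l' s x))"
proof -
  obtain \<xi> where \<xi>: "\<xi> \<in> coord_space I" "run \<xi> P [] \<noteq> None" using comp by (auto simp: computes_def)
  define pt where "pt s = (\<lambda>i. \<eta> i + s * (\<xi> i - \<eta> i))" for s
  have d: "(\<lambda>i. \<xi> i - \<eta> i) \<in> coord_space I" using \<xi>(1) \<eta> by (simp add: coord_space_def)
  have pt: "pt s \<in> coord_space I" for s unfolding pt_def using \<eta> d by (rule coord_space_line)
  have "infinite (UNIV - {s. run (pt s) P [] = None})"
    using inf run_success_cofinite[OF \<xi>(2)] unfolding pt_def by (intro Diff_infinite_finite)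
  then obtain A where A: "A \<subseteq> UNIV - {s. run (pt s) P [] = None}" "finite A" "card A = Suc D"
    using infinite_arbitrarily_large by blast
  obtain \<mu> where \<mu>: "\<And>q :: 'k poly. degree q \<le> D \<Longrightarrow> poly q 0 = (\<Sum>a\<in>A. \<mu> a * poly q a)"
    using lagrange_at_0[OF A(2,3)] by blast
  define Q where "Q a W l l' \<longleftrightarrow> (\<forall>s<length P. linear_form I (l s) \<and> linear_form I (l' s)) \<and>
    (\<forall>x\<in>coord_space I. \<forall>j\<in>J. \<forall>p :: 'k poly. (\<forall>t. \<phi> (\<lambda>i. pt a i + t * x i) j = poly p t) \<longrightarrow>
      coeff p 2 = (\<Sum>s<length P. W j s * l s x * l' s x))" for a W l l'
  have "\<exists>W l l'. Q a W l l'" if "a \<in> A" for a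
  proof -
    have "a \<in> UNIV - {s. run (pt s) P [] = None}" using A(1) that by (rule subsetD)
    then have "run (pt a) P [] \<noteq> None" by simp
    then obtain rs where "run (pt a) P [] = Some rs" by blast
    from second_order[OF inf comp pt this] show ?thesis unfolding Q_def .
  qed
  then obtain W l l' where Q: "\<And>a. a \<in> A \<Longrightarrow> Q a (W a) (l a) (l' a)"
    by metis
  have Wl: "a \<in> A \<Longrightarrow> s < length P \<Longrightarrow> linear_form I (l a s) \<and> linear_form I (l' a s)"
    "a \<in> A \<Longrightarrow> x \<in> coord_space I \<Longrightarrow> j \<in> J \<Longrightarrow> \<forall>t. \<phi> (\<lambda>i. pt a i + t * x i) j = poly p t \<Longrightarrow>
      coeff p 2 = (\<Sum>s<length P. W a j s * l a s x * l' a s x)" for a s x j p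
    using Q[of a] unfolding Q_def by blast+
  \<comment> \<open>Each of the \<open>D + 1\<close> base points brings its own products of linear
    forms.\<close>
  define F where "F = A \<times> {..<length P}"
  have "coeff p 2 = (\<Sum>(a, s)\<in>F. (\<mu> a * W a j s) * l a s x * l' a s x)"
    if x: "x \<in> coord_space I" and j: "j \<in> J" and p: "\<forall>t. \<phi> (\<lambda>i. \<eta> i + t * x i) j = poly p t" for x j p
  proof -
    obtain q where q: "\<And>b. degree (coeff q b) \<le> D"
      "\<And>s t. \<phi> (\<lambda>i. pt s i + t * x i) j = poly (poly q [:t:]) s"
      using bipoly[OF d x j] unfolding bipoly_def pt_def by blast
    define r where "r s = map_poly (\<lambda>c. poly c s) q" for s
    have r: "\<phi> (\<lambda>i. pt s i + t * x i) j = poly (r s) t" for s t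
      unfolding r_def poly_poly_const[symmetric] by (rule q(2))
    \<comment> \<open>The coefficient of t^2 is a polynomial in s of degree at most
      \<open>D\<close>; its value at s = 0 belongs to \<open>\<eta>\<close>.\<close>
    have c2: "coeff (r s) 2 = poly (coeff q 2) s" for s by (simp add: r_def coeff_map_poly)
    have "poly p t = poly (r 0) t" for t using r[of 0 t] p by (simp add: pt_def)
    then have "poly (p - r 0) t = 0" for t by simp
    then have "p - r 0 = 0" using poly_roots_finite[of "p - r 0"] inf by auto
    then have "coeff p 2 = poly (coeff q 2) 0" by (simp add: c2)
    also have "\<dots> = (\<Sum>a\<in>A. \<mu> a * coeff (r a) 2)" unfolding c2 by (rule \<mu>) (rule q(1))
    also have "\<dots> = (\<Sum>a\<in>A. \<mu> a * (\<Sum>s<length P. W a j s * l a s x * l' a s x))"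
      using Wl(2)[OF _ x j] r by (intro sum.cong) simp_all
    finally show ?thesis by (simp add: F_def sum.cartesian_product sum_distrib_left mult_ac)
  qed
  moreover have "finite F" "card F = Suc D * length P" using A by (simp_all add: F_def)
  moreover have "\<forall>(a, s)\<in>F. linear_form I (l a s) \<and> linear_form I (l' a s)" using Wl(1) by (auto simp: F_def)
  ultimately show ?thesis
    by (intro exI[of _ F] exI[of _ "\<lambda>j (a, s). \<mu> a * W a j s"] exI[of _ "\<lambda>(a, s). l a s"] exI[of _ "\<lambda>(a, s). l' a s"])
      (simp add: case_prod_beta)
qed

section \<open>Rank decompositions and polarization\<close>

definition rank_decomposition ::
    "'i set \<Rightarrow> 'j set \<Rightarrow> 'l set \<Rightarrow> (('i \<Rightarrow> 'k::field) \<Rightarrow> ('j \<Rightarrow> 'k) \<Rightarrow> 'l \<Rightarrow> 'k) \<Rightarrow> nat \<Rightarrow> bool" where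
  "rank_decomposition I J L T r \<longleftrightarrow> (\<exists>\<alpha> \<beta> w.
     (\<forall>s<r. linear_form I (\<alpha> s) \<and> linear_form J (\<beta> s) \<and> w s \<in> coord_space L) \<and>
     (\<forall>u\<in>coord_space I. \<forall>v\<in>coord_space J. T u v = (\<lambda>l. \<Sum>s<r. \<alpha> s u * \<beta> s v * w s l)))"

lemma tensor_rank_eq_Least: "tensor_rank I J L T = (LEAST r. rank_decomposition I J L T r)"
  by (simp only: tensor_rank_def rank_decomposition_def)

lemma rank_decompositionI:
  fixes T :: "('i \<Rightarrow> 'k::field) \<Rightarrow> ('j \<Rightarrow> 'k) \<Rightarrow> 'l \<Rightarrow> 'k"
  assumes "finite F" "\<And>s. s \<in> F \<Longrightarrow> linear_form I (\<alpha> s) \<and> linear_form J (\<beta> s) \<and> w s \<in> coord_space L"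
    and "\<And>u v. u \<in> coord_space I \<Longrightarrow> v \<in> coord_space J \<Longrightarrow> T u v = (\<lambda>l. \<Sum>s\<in>F. \<alpha> s u * \<beta> s v * w s l)"
  shows "rank_decomposition I J L T (card F)"
proof -
  obtain h where h: "bij_betw h {..<card F} F"
    using ex_bij_betw_nat_finite[OF assms(1)] by (auto simp: lessThan_atLeast0)
  show ?thesis unfolding rank_decomposition_def
  proof (intro exI conjI)
    show "\<forall>s<card F. linear_form I (\<alpha> (h s)) \<and> linear_form J (\<beta> (h s)) \<and> w (h s) \<in> coord_space L"
      using assms(2) bij_betwE[OF h] by auto
    show "\<forall>u\<in>coord_space I. \<forall>v\<in>coord_space J. T u v = (\<lambda>l. \<Sum>s<card F. \<alpha> (h s) u * \<beta> (h s) v * w (h s) l)"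
    proof (intro ballI ext)
      fix u :: "'i \<Rightarrow> 'k" and v :: "'j \<Rightarrow> 'k" and l
      assume uv: "u \<in> coord_space I" "v \<in> coord_space J"
      show "T u v l = (\<Sum>s<card F. \<alpha> (h s) u * \<beta> (h s) v * w (h s) l)"
        unfolding assms(3)[OF uv] by (rule sum.reindex_bij_betw[OF h, symmetric])
    qed
  qed
qed

text \<open>Expand each product at \<open>A u + B v\<close>. The terms in \<open>u\<close> alone and
  in \<open>v\<close> alone sum to \<open>T u 0\<close> and \<open>T 0 v\<close>, which vanish; each
  product leaves the two mixed terms \<open>l (A u) * l' (B v)\<close> and
  \<open>l' (A u) * l (B v)\<close>. Hence the factor 2, without any division by 2.\<close>

lemma tensor_rank_le_polar:
  fixes T :: "('i \<Rightarrow> 'k::field) \<Rightarrow> ('j \<Rightarrow> 'k) \<Rightarrow> 'l \<Rightarrow> 'k"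
  assumes F: "finite F" and l: "\<And>s. s \<in> F \<Longrightarrow> linear_form X (l s) \<and> linear_form X (l' s)"
    and A: "\<And>u. u \<in> coord_space I \<Longrightarrow> A u \<in> coord_space X"
      "\<And>u u'. A (\<lambda>i. u i + u' i) = (\<lambda>i. A u i + A u' i)" "\<And>c u. A (\<lambda>i. c * u i) = (\<lambda>i. c * A u i)"
    and B: "\<And>u. u \<in> coord_space J \<Longrightarrow> B u \<in> coord_space X"
      "\<And>u u'. B (\<lambda>i. u i + u' i) = (\<lambda>i. B u i + B u' i)" "\<And>c u. B (\<lambda>i. c * u i) = (\<lambda>i. c * B u i)"
    and T: "\<And>u v. u \<in> coord_space I \<Longrightarrow> v \<in> coord_space J \<Longrightarrow>
      T u v = (\<lambda>k. \<Sum>s\<in>F. W k s * l s (\<lambda>i. A u i + B v i) * l' s (\<lambda>i. A u i + B v i))"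
    and T0: "\<And>u. u \<in> coord_space I \<Longrightarrow> T u (\<lambda>_. 0) = (\<lambda>_. 0)" "\<And>v. v \<in> coord_space J \<Longrightarrow> T (\<lambda>_. 0) v = (\<lambda>_. 0)"
    and W: "\<And>k s. k \<notin> L \<Longrightarrow> W k s = 0"
  shows "tensor_rank I J L T \<le> 2 * card F"
proof -
  have zero: "(\<lambda>_. 0) \<in> coord_space I" "(\<lambda>_. 0) \<in> coord_space J" by (simp_all add: coord_space_def)
  have A0: "A (\<lambda>_. 0) = (\<lambda>_. 0)" using A(3)[of 0] by simp
  have B0: "B (\<lambda>_. 0) = (\<lambda>_. 0)" using B(3)[of 0] by simp
  have lA: "linear_form I (\<lambda>u. h (A u))" if "linear_form X h" for h
    using that A unfolding linear_form_def by simp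
  have lB: "linear_form J (\<lambda>u. h (B u))" if "linear_form X h" for h
    using that B unfolding linear_form_def by simp
  have "rank_decomposition I J L T (card (F <+> F))"
  proof (rule rank_decompositionI)
    show "finite (F <+> F)" using F by simp
    fix s assume "s \<in> F <+> F"
    then show "linear_form I (case s of Inl s \<Rightarrow> \<lambda>u. l s (A u) | Inr s \<Rightarrow> \<lambda>u. l' s (A u)) \<and>
        linear_form J (case s of Inl s \<Rightarrow> \<lambda>u. l' s (B u) | Inr s \<Rightarrow> \<lambda>u. l s (B u)) \<and>
        (case s of Inl s \<Rightarrow> \<lambda>k. W k s | Inr s \<Rightarrow> \<lambda>k. W k s) \<in> coord_space L"
      using W by (auto intro!: lA lB conjunct1[OF l] conjunct2[OF l] simp: coord_space_def)
  next
    fix u :: "'i \<Rightarrow> 'k" and v :: "'j \<Rightarrow> 'k"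
    assume u: "u \<in> coord_space I" and v: "v \<in> coord_space J"
    show "T u v = (\<lambda>k. \<Sum>s\<in>F <+> F. (case s of Inl s \<Rightarrow> \<lambda>u. l s (A u) | Inr s \<Rightarrow> \<lambda>u. l' s (A u)) u *
        (case s of Inl s \<Rightarrow> \<lambda>u. l' s (B u) | Inr s \<Rightarrow> \<lambda>u. l s (B u)) v *
        (case s of Inl s \<Rightarrow> \<lambda>k. W k s | Inr s \<Rightarrow> \<lambda>k. W k s) k)"
    proof
      fix k
      have add: "l s (\<lambda>i. A u i + B v i) = l s (A u) + l s (B v)"
        "l' s (\<lambda>i. A u i + B v i) = l' s (A u) + l' s (B v)" if "s \<in> F" for s
        using l[OF that] A(1)[OF u] B(1)[OF v] unfolding linear_form_def by blast+
      have "(\<Sum>s\<in>F. W k s * l s (A u) * l' s (A u)) = 0"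
        using T[OF u zero(2)] T0(1)[OF u] by (simp add: B0 fun_eq_iff)
      moreover have "(\<Sum>s\<in>F. W k s * l s (B v) * l' s (B v)) = 0"
        using T[OF zero(1) v] T0(2)[OF v] by (simp add: A0 fun_eq_iff)
      moreover have "T u v k = (\<Sum>s\<in>F. W k s * (l s (A u) + l s (B v)) * (l' s (A u) + l' s (B v)))"
        using T[OF u v] add by simp
      moreover have "\<dots> = (\<Sum>s\<in>F. W k s * l s (A u) * l' s (A u)) + (\<Sum>s\<in>F. W k s * l s (B v) * l' s (B v))
          + ((\<Sum>s\<in>F. l s (A u) * l' s (B v) * W k s) + (\<Sum>s\<in>F. l' s (A u) * l s (B v) * W k s))"
        unfolding sum.distrib[symmetric] by (rule sum.cong) (simp_all add: algebra_simps)
      ultimately show "T u v k = (\<Sum>s\<in>F <+> F. (case s of Inl s \<Rightarrow> \<lambda>u. l s (A u) | Inr s \<Rightarrow> \<lambda>u. l' s (A u)) u *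
        (case s of Inl s \<Rightarrow> \<lambda>u. l' s (B u) | Inr s \<Rightarrow> \<lambda>u. l s (B u)) v *
        (case s of Inl s \<Rightarrow> \<lambda>k. W k s | Inr s \<Rightarrow> \<lambda>k. W k s) k)"
        using F by (simp add: sum.Plus)
    qed
  qed
  then have "tensor_rank I J L T \<le> card (F <+> F)"
    unfolding tensor_rank_eq_Least by (rule Least_le)
  then show ?thesis using F by (simp add: card_Plus)
qed

section \<open>Rank of matrix multiplication\<close>

lemma coord_space_mono: "I \<subseteq> I' \<Longrightarrow> u \<in> coord_space I \<Longrightarrow> u \<in> coord_space I'"
  by (auto simp: coord_space_def)

lemma zero_coord_space [simp]: "(\<lambda>_. 0) \<in> coord_space I"
  by (simp add: coord_space_def)

definition unit_vec_at :: "'i \<Rightarrow> 'i \<Rightarrow> 'k::zero_neq_one" where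
  "unit_vec_at i = (\<lambda>j. if j = i then 1 else 0)"

lemma unit_vec_at_coord_space: "i \<in> I \<Longrightarrow> unit_vec_at i \<in> coord_space I"
  by (auto simp: coord_space_def unit_vec_at_def)

lemma linear_formD_add:
  "linear_form I \<alpha> \<Longrightarrow> u \<in> coord_space I \<Longrightarrow> v \<in> coord_space I \<Longrightarrow> \<alpha> (\<lambda>i. u i + v i) = \<alpha> u + \<alpha> v"
  by (simp add: linear_form_def)

lemma linear_formD_scale:
  "linear_form I \<alpha> \<Longrightarrow> u \<in> coord_space I \<Longrightarrow> \<alpha> (\<lambda>i. c * u i) = c * \<alpha> u"
  by (simp add: linear_form_def)

lemma linear_form_zero: "linear_form I \<alpha> \<Longrightarrow> \<alpha> (\<lambda>_. 0) = 0"
  using linear_formD_scale[of I \<alpha> "\<lambda>_. 0" 0] by simp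

text \<open>\<open>linear_form I\<close> says nothing outside \<open>coord_space I\<close>, so
  coordinates are peeled off one at a time and every vector is kept inside that space.\<close>

lemma linear_form_expand:
  fixes \<alpha> :: "('i \<Rightarrow> 'k::field) \<Rightarrow> 'k"
  assumes "finite I" "linear_form I \<alpha>" "u \<in> coord_space I"
  shows "\<alpha> u = (\<Sum>i\<in>I. u i * \<alpha> (unit_vec_at i))"
proof -
  have "\<alpha> u = (\<Sum>i\<in>F. u i * \<alpha> (unit_vec_at i))" if "finite F" "F \<subseteq> I" "u \<in> coord_space F" for F u
    using that
  proof (induction F arbitrary: u rule: finite_induct)
    case empty
    then have "u = (\<lambda>_. 0)" by (auto simp: coord_space_def)
    then show ?case using linear_form_zero[OF assms(2)] by simp
  next
    case (insert x F)
    define v where "v = u(x := 0)"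
    have v: "v \<in> coord_space F" using insert.prems(2) by (auto simp: v_def coord_space_def)
    have vI: "v \<in> coord_space I" by (rule coord_space_mono[OF _ v]) (use insert.prems(1) in simp)
    have x: "(unit_vec_at x :: 'i \<Rightarrow> 'k) \<in> coord_space I" using insert.prems(1) by (intro unit_vec_at_coord_space) simp
    have xI: "(\<lambda>i. u x * unit_vec_at x i) \<in> coord_space I" using x by (simp add: coord_space_def)
    have "u = (\<lambda>i. v i + u x * unit_vec_at x i)" by (auto simp: v_def unit_vec_at_def)
    then have "\<alpha> u = \<alpha> (\<lambda>i. v i + u x * unit_vec_at x i)" by simp
    also have "\<dots> = \<alpha> v + \<alpha> (\<lambda>i. u x * unit_vec_at x i)"
      by (rule linear_formD_add[OF assms(2) vI xI])
    also have "\<alpha> (\<lambda>i. u x * unit_vec_at x i) = u x * \<alpha> (unit_vec_at x)"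
      by (rule linear_formD_scale[OF assms(2) x])
    also have "\<alpha> v = (\<Sum>i\<in>F. v i * \<alpha> (unit_vec_at i))"
      using insert.IH insert.prems(1) v by simp
    also have "\<dots> = (\<Sum>i\<in>F. u i * \<alpha> (unit_vec_at i))"
      using insert.hyps(2) by (intro sum.cong) (auto simp: v_def)
    finally show ?case using insert.hyps by simp
  qed
  then show ?thesis using assms(1,3) by blast
qed

lemma linear_form_subset: "linear_form I \<alpha> \<Longrightarrow> I' \<subseteq> I \<Longrightarrow> linear_form I' \<alpha>"
  by (simp add: linear_form_def coord_space_mono[of I' I])

text \<open>Gaussian elimination: each step removes one form together with one pivot
  coordinate.\<close>

lemma common_zero:
  fixes \<alpha> :: "nat \<Rightarrow> ('i \<Rightarrow> 'k::field) \<Rightarrow> 'k"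
  assumes "finite I" "r < card I" "\<And>s. s < r \<Longrightarrow> linear_form I (\<alpha> s)"
  shows "\<exists>u\<in>coord_space I. u \<noteq> (\<lambda>_. 0) \<and> (\<forall>s<r. \<alpha> s u = 0)"
  using assms
proof (induction r arbitrary: I \<alpha>)
  case 0
  then obtain i where "i \<in> I" by fastforce
  moreover have "unit_vec_at i \<noteq> (\<lambda>_. 0 :: 'k)" by (auto simp: unit_vec_at_def fun_eq_iff)
  ultimately show ?case
    by (intro bexI[of _ "unit_vec_at i"]) (simp_all add: unit_vec_at_coord_space)
next
  case (Suc r)
  have r: "linear_form I (\<alpha> r)" using Suc.prems(3) by simp
  show ?case
  proof (cases "\<exists>i\<in>I. \<alpha> r (unit_vec_at i) \<noteq> 0")
    case False
    then have "\<alpha> r u = 0" if "u \<in> coord_space I" for u :: "'i \<Rightarrow> 'k"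
      using linear_form_expand[OF Suc.prems(1) r that] by simp
    moreover obtain u where "u \<in> coord_space I" "u \<noteq> (\<lambda>_. 0)" "\<forall>s<r. \<alpha> s u = 0"
      using Suc.IH[of I \<alpha>] Suc.prems by auto
    ultimately show ?thesis by (intro bexI[of _ u]) (simp_all add: less_Suc_eq)
  next
    case True
    then obtain i where i: "i \<in> I" "\<alpha> r (unit_vec_at i) \<noteq> 0" by blast
    define c where "c = \<alpha> r (unit_vec_at i)"
    \<comment> \<open>Subtracts the multiple of \<open>\<alpha> r\<close> that makes the form vanish
      on \<open>unit_vec_at i\<close>.\<close>
    define \<alpha>' where "\<alpha>' s u = \<alpha> s u + (- \<alpha> s (unit_vec_at i) / c) * \<alpha> r u" for s u
    have "linear_form (I - {i}) (\<alpha>' s)" if "s < r" for s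
      unfolding \<alpha>'_def using Suc.prems(3)[of s] r that
      by (intro linear_form_add linear_form_scale) (auto intro: linear_form_subset)
    moreover have "r < card (I - {i})" using Suc.prems(1,2) i(1) by simp
    ultimately obtain u where u: "u \<in> coord_space (I - {i})" "u \<noteq> (\<lambda>_. 0)" "\<forall>s<r. \<alpha>' s u = 0"
      using Suc.IH[of "I - {i}" \<alpha>'] Suc.prems(1) by auto
    have uI: "u \<in> coord_space I" by (rule coord_space_mono[OF _ u(1)]) auto
    \<comment> \<open>This value makes \<open>\<alpha> r v\<close> zero, and then
      \<open>\<alpha> s v = \<alpha>' s u\<close> for the other forms.\<close>
    define d where "d = - \<alpha> r u / c"
    define v where "v = (\<lambda>j. u j + d * unit_vec_at i j)"
    have xI: "(unit_vec_at i :: 'i \<Rightarrow> 'k) \<in> coord_space I" by (rule unit_vec_at_coord_space[OF i(1)])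
    have "v \<in> coord_space I" unfolding v_def by (rule coord_space_line[OF uI xI])
    have v: "\<alpha> s v = \<alpha> s u + d * \<alpha> s (unit_vec_at i)" if "s < Suc r" for s
    proof -
      have "(\<lambda>j. d * unit_vec_at i j) \<in> coord_space I" using xI by (simp add: coord_space_def)
      then show ?thesis unfolding v_def
        using linear_formD_add[OF Suc.prems(3)[OF that] uI]
          linear_formD_scale[OF Suc.prems(3)[OF that] xI] by simp
    qed
    have "\<alpha> s v = 0" if "s < Suc r" for s
    proof (cases "s = r")
      case True
      then show ?thesis using v[OF that] i(2) by (simp add: c_def d_def)
    next
      case False
      then have "\<alpha>' s u = 0" using u(3) that by simp
      then show ?thesis using v[OF that] by (simp add: \<alpha>'_def d_def mult.commute)
    qed
    moreover have "v \<noteq> (\<lambda>_. 0)"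
    proof
      assume "v = (\<lambda>_. 0)"
      then have "u j = 0" for j
        using u(1) by (cases "j = i") (auto simp: v_def unit_vec_at_def coord_space_def fun_eq_iff split: if_splits)
      then show False using u(2) by auto
    qed
    ultimately show ?thesis using \<open>v \<in> coord_space I\<close> by (intro bexI[of _ v]) simp_all
  qed
qed

lemma matrix_mult_apply:
  "matrix_mult n A B (i, j) = (if i < n \<and> j < n then \<Sum>z<n. A (i, z) * B (z, j) else 0)"
  by (auto simp: matrix_mult_def entries_def scalar_prod_def lessThan_atLeast0 intro!: sum.cong)

text \<open>The schoolbook algorithm with n^3 products; some decomposition must exist for the
  \<open>LEAST\<close> in the rank to be attained.\<close>

lemma matrix_mult_decomposition_ex:
  "\<exists>r. rank_decomposition (matrix_ix n) (matrix_ix n) (matrix_ix n)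
    (matrix_mult n :: (nat \<times> nat \<Rightarrow> 'k::field) \<Rightarrow> _) r"
proof (rule exI, rule rank_decompositionI)
  let ?F = "{..<n} \<times> {..<n} \<times> {..<n}"
  show "finite ?F" by simp
  fix s assume "s \<in> ?F"
  then show "linear_form (matrix_ix n) (\<lambda>u. u (fst s, snd (snd s)) :: 'k) \<and>
      linear_form (matrix_ix n) (\<lambda>u. u (snd (snd s), fst (snd s)) :: 'k) \<and>
      unit_vec_at (fst s, fst (snd s)) \<in> coord_space (matrix_ix n)"
    by (auto simp: linear_form_proj matrix_ix_def intro!: unit_vec_at_coord_space)
next
  let ?F = "{..<n} \<times> {..<n} \<times> {..<n}"
  fix u v :: "nat \<times> nat \<Rightarrow> 'k"
  show "matrix_mult n u v = (\<lambda>l. \<Sum>s\<in>?F. u (fst s, snd (snd s)) * v (snd (snd s), fst (snd s)) *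
      unit_vec_at (fst s, fst (snd s)) l)"
  proof
    fix l :: "nat \<times> nat"
    obtain i j where l: "l = (i, j)" by (cases l)
    have "(\<Sum>s\<in>?F. u (fst s, snd (snd s)) * v (snd (snd s), fst (snd s)) * unit_vec_at (fst s, fst (snd s)) l)
        = (\<Sum>a<n. \<Sum>b<n. \<Sum>z<n. u (a, z) * v (z, b) * unit_vec_at (a, b) l)"
      by (simp add: sum.cartesian_product case_prod_beta)
    also have "\<dots> = (\<Sum>a<n. \<Sum>b<n. if b = j then if a = i then (\<Sum>z<n. u (a, z) * v (z, b)) else 0 else 0)"
      by (intro sum.cong) (auto simp: l unit_vec_at_def)
    also have "\<dots> = matrix_mult n u v l"
      by (cases "j < n") (auto simp: l matrix_mult_apply)
    finally show "matrix_mult n u v l = (\<Sum>s\<in>?F. u (fst s, snd (snd s)) * v (snd (snd s), fst (snd s)) *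
      unit_vec_at (fst s, fst (snd s)) l)" by simp
  qed
qed

lemma matrix_mult_rank_decomposition:
  "rank_decomposition (matrix_ix n) (matrix_ix n) (matrix_ix n)
    (matrix_mult n :: (nat \<times> nat \<Rightarrow> 'k::field) \<Rightarrow> _)
    (tensor_rank (matrix_ix n) (matrix_ix n) (matrix_ix n) (matrix_mult n :: (nat \<times> nat \<Rightarrow> 'k) \<Rightarrow> _))"
  unfolding tensor_rank_eq_Least by (rule LeastI_ex[OF matrix_mult_decomposition_ex])

text \<open>Right multiplication by the identity matrix is injective, so the left linear forms have no common zero.\<close>

lemma matrix_mult_rank_ge:
  assumes "rank_decomposition (matrix_ix n) (matrix_ix n) (matrix_ix n)
    (matrix_mult n :: (nat \<times> nat \<Rightarrow> 'k::field) \<Rightarrow> _) r"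
  shows "n\<^sup>2 \<le> r"
proof (rule ccontr)
  assume "\<not> n\<^sup>2 \<le> r"
  obtain \<alpha> \<beta> :: "nat \<Rightarrow> (nat \<times> nat \<Rightarrow> 'k) \<Rightarrow> 'k" and w where
    d: "\<And>s. s < r \<Longrightarrow> linear_form (matrix_ix n) (\<alpha> s)"
    "\<And>u v. u \<in> coord_space (matrix_ix n) \<Longrightarrow> v \<in> coord_space (matrix_ix n) \<Longrightarrow>
      matrix_mult n u v = (\<lambda>l. \<Sum>s<r. \<alpha> s u * \<beta> s v * w s l)"
    using assms unfolding rank_decomposition_def by blast
  obtain u where u: "u \<in> coord_space (matrix_ix n)" "u \<noteq> (\<lambda>_. 0)" "\<forall>s<r. \<alpha> s u = 0"
    using common_zero[of "matrix_ix n" r \<alpha>] d(1) \<open>\<not> n\<^sup>2 \<le> r\<close> by auto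
  define e :: "nat \<times> nat \<Rightarrow> 'k" where "e = (\<lambda>(i, j). if i = j \<and> i < n then 1 else 0)"
  have "e \<in> coord_space (matrix_ix n)" by (auto simp: e_def coord_space_def matrix_ix_def)
  then have 0: "matrix_mult n u e = (\<lambda>_. 0)" using d(2)[OF u(1)] u(3) by simp
  have "u (i, j) = 0" for i j
  proof (cases "i < n \<and> j < n")
    case True
    then have "matrix_mult n u e (i, j) = (\<Sum>z<n. u (i, z) * e (z, j))"
      by (simp add: matrix_mult_apply)
    also have "\<dots> = (\<Sum>z<n. if z = j then u (i, z) else 0)"
      by (rule sum.cong) (auto simp: e_def)
    finally show ?thesis using 0 True by simp
  next
    case False
    then show ?thesis using u(1) by (auto simp: coord_space_def matrix_ix_def)
  qed
  then show False using u(2) by (auto simp: fun_eq_iff)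
qed

lemma bilinear_scheme_if_decomposition:
  assumes "rank_decomposition (matrix_ix n) (matrix_ix n) (matrix_ix n)
    (matrix_mult n :: (nat \<times> nat \<Rightarrow> 'k::field) \<Rightarrow> _) r"
  shows "bilinear_scheme TYPE('k) n r"
proof -
  obtain \<alpha> \<beta> :: "nat \<Rightarrow> (nat \<times> nat \<Rightarrow> 'k) \<Rightarrow> 'k" and w where
    d: "\<And>s. s < r \<Longrightarrow> linear_form (matrix_ix n) (\<alpha> s)" "\<And>s. s < r \<Longrightarrow> linear_form (matrix_ix n) (\<beta> s)"
    "\<And>u v. u \<in> coord_space (matrix_ix n) \<Longrightarrow> v \<in> coord_space (matrix_ix n) \<Longrightarrow>
      matrix_mult n u v = (\<lambda>l. \<Sum>s<r. \<alpha> s u * \<beta> s v * w s l)"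
    using assms unfolding rank_decomposition_def by blast
  show ?thesis unfolding bilinear_scheme_def
  proof (intro exI allI impI)
    fix A B :: "nat \<times> nat \<Rightarrow> 'k" and i j assume ij: "i < n" "j < n"
    \<comment> \<open>The decomposition speaks of points of the coordinate space only, the scheme of
      arbitrary functions; truncation changes no entry that occurs.\<close>
    define A' where "A' = (\<lambda>e. if e \<in> matrix_ix n then A e else 0)"
    define B' where "B' = (\<lambda>e. if e \<in> matrix_ix n then B e else 0)"
    have AB: "A' \<in> coord_space (matrix_ix n)" "B' \<in> coord_space (matrix_ix n)"
      by (auto simp: A'_def B'_def coord_space_def)
    have "(\<Sum>z<n. A (i, z) * B (z, j)) = matrix_mult n A' B' (i, j)"
      using ij by (auto simp: matrix_mult_apply A'_def B'_def matrix_ix_def intro!: sum.cong)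
    also have "\<dots> = (\<Sum>s<r. \<alpha> s A' * \<beta> s B' * w s (i, j))" by (simp add: d(3)[OF AB])
    also have "\<dots> = (\<Sum>s<r. (\<Sum>e\<in>matrix_ix n. \<alpha> s (unit_vec_at e) * A e) *
        (\<Sum>e\<in>matrix_ix n. \<beta> s (unit_vec_at e) * B e) * w s (i, j))"
    proof (rule sum.cong[OF refl])
      fix s assume "s \<in> {..<r}"
      then have s: "s < r" by simp
      have "\<alpha> s A' = (\<Sum>e\<in>matrix_ix n. \<alpha> s (unit_vec_at e) * A e)"
        unfolding linear_form_expand[OF finite_matrix_ix d(1)[OF s] AB(1)]
        by (intro sum.cong) (auto simp: A'_def)
      moreover have "\<beta> s B' = (\<Sum>e\<in>matrix_ix n. \<beta> s (unit_vec_at e) * B e)"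
        unfolding linear_form_expand[OF finite_matrix_ix d(2)[OF s] AB(2)]
        by (intro sum.cong) (auto simp: B'_def)
      ultimately show "\<alpha> s A' * \<beta> s B' * w s (i, j) = (\<Sum>e\<in>matrix_ix n. \<alpha> s (unit_vec_at e) * A e) *
        (\<Sum>e\<in>matrix_ix n. \<beta> s (unit_vec_at e) * B e) * w s (i, j)" by simp
    qed
    finally show "(\<Sum>z<n. A (i, z) * B (z, j)) = (\<Sum>s<r. (\<Sum>e\<in>matrix_ix n. \<alpha> s (unit_vec_at e) * A e) *
        (\<Sum>e\<in>matrix_ix n. \<beta> s (unit_vec_at e) * B e) * w s (i, j))" .
  qed
qed

section \<open>Cost of tensor polynomials\<close>

lemma frontal_slice_mult:
  "facewise_prod n A B (i, j, l) = (if i < n \<and> j < n then \<Sum>z<n. A (i, z, l) * B (z, j, l) else 0)"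
  by (auto simp: facewise_prod_def frontal_slice_def entries_def scalar_prod_def lessThan_atLeast0
      intro!: sum.cong)

lemma finite_tensor_ix [simp]: "finite (tensor_ix n p)"
  by (simp add: tensor_ix_def)

lemma card_tensor_ix: "card (tensor_ix n p) = n\<^sup>2 * p"
  by (simp add: tensor_ix_def power2_eq_square)

lemma cost_le_UnI: "cost_le S T t1 \<Longrightarrow> cost_le S U t2 \<Longrightarrow> cost_le S (T \<union> U) (t1 + t2)"
  by (rule cost_le_trans) (auto intro: cost_le_mono simp: avail_def)

text \<open>Each of the two products with \<open>M\<close> has \<open>n^2 * q\<close> entries at
  \<open>2 * p\<close> operations, and the product with \<open>pinv M\<close> has
  \<open>n^2 * p\<close> entries at \<open>2 * q\<close>. This gives the 6; the \<open>q\<close>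
  slices are multiplied as matrices.\<close>

lemma cost_le_tensor_mult:
  fixes a b :: "nat \<times> nat \<times> nat \<Rightarrow> 'u \<Rightarrow> 'k::conjugatable_field"
  assumes mm: "mm_cost TYPE('u) TYPE('k) n t"
    and M: "M \<in> carrier_mat q p" "pinv M \<in> carrier_mat p q"
    and ab: "\<And>e. e \<in> tensor_ix n p \<Longrightarrow> a e \<in> avail S" "\<And>e. e \<in> tensor_ix n p \<Longrightarrow> b e \<in> avail S"
  shows "cost_le S ((\<lambda>e u. tensor_mult n M (\<lambda>e. a e u) (\<lambda>e. b e u) e) ` tensor_ix n p)
    (q * t + 6 * p * q * n\<^sup>2)"
proof -
  define A where "A c e u = (\<Sum>l<p. M $$ (snd (snd e), l) * c (fst e, fst (snd e), l) u)"
    for c :: "nat \<times> nat \<times> nat \<Rightarrow> 'u \<Rightarrow> 'k" and e :: "nat \<times> nat \<times> nat" and u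
  have A: "cost_le S (A c ` tensor_ix n q) (card (tensor_ix n q) * (2 * p))"
    if "\<And>e. e \<in> tensor_ix n p \<Longrightarrow> c e \<in> avail S" for c
  proof (rule cost_le_image)
    fix e assume e: "e \<in> tensor_ix n q"
    have "cost_le S {A c e} (2 * card {..<p})"
      unfolding A_def using e by (intro cost_le_lincomb) (auto simp: tensor_ix_def intro!: that)
    then show "cost_le S {A c e} (2 * p)" by simp
  qed simp
  have 1: "cost_le S (A a ` tensor_ix n q \<union> A b ` tensor_ix n q)
      (card (tensor_ix n q) * (2 * p) + card (tensor_ix n q) * (2 * p))"
    using ab by (intro cost_le_UnI A)
  define S1 where "S1 = S \<union> (A a ` tensor_ix n q \<union> A b ` tensor_ix n q)"
  define P where "P h i j u = (\<Sum>z<n. A a (i, z, h) u * A b (z, j, h) u)" for h i j u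
  define T where "T = (\<Union>h<q. (\<lambda>(i, j). P h i j) ` ({..<n} \<times> {..<n}))"
  have "cost_le S1 T (card {..<q} * t)" unfolding T_def
  proof (rule cost_le_UN)
    fix h assume "h \<in> {..<q}"
    then have "\<forall>i<n. \<forall>j<n. A a (i, j, h) \<in> avail S1 \<and> A b (i, j, h) \<in> avail S1"
      unfolding S1_def avail_def tensor_ix_def by auto
    then show "cost_le S1 ((\<lambda>(i, j). P h i j) ` ({..<n} \<times> {..<n})) t"
      using mm unfolding mm_cost_def P_def by fast
  qed simp
  from cost_le_trans[OF 1 this[unfolded S1_def]]
  have 2: "cost_le S (A a ` tensor_ix n q \<union> A b ` tensor_ix n q \<union> T)
      (card (tensor_ix n q) * (2 * p) + card (tensor_ix n q) * (2 * p) + card {..<q} * t)" .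
  define S2 where "S2 = S \<union> (A a ` tensor_ix n q \<union> A b ` tensor_ix n q \<union> T)"
  define R where "R e u = (\<Sum>h<q. pinv M $$ (snd (snd e), h) * P h (fst e) (fst (snd e)) u)"
    for e :: "nat \<times> nat \<times> nat" and u
  have P: "P h i j \<in> avail S2" if "h < q" "i < n" "j < n" for h i j
  proof -
    have "P h i j \<in> (\<lambda>(i, j). P h i j) ` ({..<n} \<times> {..<n})"
      using that by (intro image_eqI[of _ _ "(i, j)"]) auto
    then show ?thesis using that(1) unfolding S2_def avail_def T_def by blast
  qed
  have "cost_le S2 (R ` tensor_ix n p) (card (tensor_ix n p) * (2 * q))"
  proof (rule cost_le_image)
    fix e assume e: "e \<in> tensor_ix n p"
    have "cost_le S2 {R e} (2 * card {..<q})"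
      unfolding R_def using e
      by (intro cost_le_lincomb) (auto simp: tensor_ix_def intro!: P)
    then show "cost_le S2 {R e} (2 * q)" by simp
  qed simp
  from cost_le_trans[OF 2 this[unfolded S2_def]] show ?thesis
  proof (rule cost_le_mono)
    have "(\<lambda>u. tensor_mult n M (\<lambda>e. a e u) (\<lambda>e. b e u) e) = R e" if "e \<in> tensor_ix n p" for e
      using that M unfolding tensor_mult_def mode3_prod_def R_def P_def A_def tensor_ix_def
      by (auto simp: frontal_slice_mult intro!: sum.cong)
    then show "(\<lambda>e u. tensor_mult n M (\<lambda>e. a e u) (\<lambda>e. b e u) e) ` tensor_ix n p
        \<subseteq> A a ` tensor_ix n q \<union> A b ` tensor_ix n q \<union> T \<union> R ` tensor_ix n p"
      by auto
    show "card (tensor_ix n q) * (2 * p) + card (tensor_ix n q) * (2 * p) + card {..<q} * t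
        + card (tensor_ix n p) * (2 * q) \<le> q * t + 6 * p * q * n\<^sup>2"
      by (simp add: card_tensor_ix)
  qed (rule subset_avail)
qed

lemma cost_le_word_prod:
  fixes S :: "((nat \<times> nat \<times> nat \<times> nat \<Rightarrow> 'k::conjugatable_field) \<Rightarrow> 'k) set"
  assumes mm: "mm_cost TYPE(nat \<times> nat \<times> nat \<times> nat \<Rightarrow> 'k) TYPE('k) n t"
    and M: "M \<in> carrier_mat q p" "pinv M \<in> carrier_mat p q"
    and S: "\<And>s e. s < k \<Longrightarrow> e \<in> tensor_ix n p \<Longrightarrow> (\<lambda>x. x (s, e)) \<in> avail S"
    and w: "w \<noteq> []" "set w \<subseteq> {..<k}"
  shows "cost_le S ((\<lambda>e x. word_prod n M (\<lambda>s e. x (s, e)) w e) ` tensor_ix n p)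
    (length w * (q * t + 6 * p * q * n\<^sup>2))"
  using w
proof (induction w rule: induct_list012)
  case (2 s)
  then show ?case using S by (intro cost_le_avail) auto
next
  case (3 s s' w)
  let ?c = "q * t + 6 * p * q * n\<^sup>2"
  define T where "T = (\<lambda>e x. word_prod n M (\<lambda>s e. x (s, e)) (s' # w) e) ` tensor_ix n p"
  have "cost_le S T (length (s' # w) * ?c)" unfolding T_def using 3 by simp
  moreover have "cost_le (S \<union> T) ((\<lambda>e x. word_prod n M (\<lambda>s e. x (s, e)) (s # s' # w) e) ` tensor_ix n p) ?c"
    unfolding word_prod.simps
  proof (rule cost_le_tensor_mult[OF mm M])
    fix e assume e: "e \<in> tensor_ix n p"
    show "(\<lambda>x. x (s, e)) \<in> avail (S \<union> T)"
      using S[OF _ e, of s] 3(4) avail_mono[of S "S \<union> T"] by auto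
    show "(\<lambda>x. word_prod n M (\<lambda>s e. x (s, e)) (s' # w) e) \<in> avail (S \<union> T)"
      using e by (auto simp: T_def avail_def)
  qed
  ultimately have "cost_le S (T \<union> (\<lambda>e x. word_prod n M (\<lambda>s e. x (s, e)) (s # s' # w) e) ` tensor_ix n p)
      (length (s' # w) * ?c + ?c)" by (rule cost_le_trans)
  then show ?case by (rule cost_le_mono[OF _ subset_avail]) auto
qed simp

text \<open>\<open>K\<close> is chosen before \<open>n\<close> and \<open>t\<close>: the number of
  words and their lengths do not grow with \<open>n\<close>. The constants \<open>C n\<close> do
  vary, but scalars are free.\<close>

lemma eval_program:
  fixes M :: "'k::conjugatable_field mat"
  assumes M: "M \<in> carrier_mat q p" "pinv M \<in> carrier_mat p q" and f: "tensor_polynomial k p f C"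
  shows "\<exists>K. \<forall>n t. mm_cost TYPE(nat \<times> nat \<times> nat \<times> nat \<Rightarrow> 'k) TYPE('k) n t \<longrightarrow>
    (\<exists>P out. length P \<le> K * (t + n\<^sup>2) \<and> computes ({..<k} \<times> tensor_ix n p) (tensor_ix n p) P out
      (\<lambda>x. poly_eval n M f (C n) (\<lambda>s e. x (s, e))))"
proof -
  define F where "F = Poly_Mapping.keys f"
  have F: "finite F" "\<And>w. w \<in> F \<Longrightarrow> w \<noteq> [] \<and> set w \<subseteq> {..<k}"
    using f by (auto simp: F_def tensor_polynomial_def)
  obtain D where D: "\<And>w. w \<in> F \<Longrightarrow> length w \<le> D"
    using finite_nat_set_iff_bounded_le[of "length ` F"] F(1) by auto
  define K where "K = card F * D * (q + 6 * p * q) + p * (1 + 2 * card F)"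
  show ?thesis
  proof (intro exI[of _ K] allI impI)
    fix n t assume mm: "mm_cost TYPE(nat \<times> nat \<times> nat \<times> nat \<Rightarrow> 'k) TYPE('k) n t"
    define S where "S = (\<lambda>i (u :: nat \<times> nat \<times> nat \<times> nat \<Rightarrow> 'k). u i) ` ({..<k} \<times> tensor_ix n p)"
    define W where "W w e x = word_prod n M (\<lambda>s e. x (s, e)) w e"
      for w e and x :: "nat \<times> nat \<times> nat \<times> nat \<Rightarrow> 'k"
    define T where "T = (\<Union>w\<in>F. W w ` tensor_ix n p)"
    let ?c = "D * (q * t + 6 * p * q * n\<^sup>2)"
    have 1: "cost_le S T (card F * ?c)" unfolding T_def
    proof (rule cost_le_UN[OF F(1)])
      fix w assume w: "w \<in> F"
      have "cost_le S (W w ` tensor_ix n p) (length w * (q * t + 6 * p * q * n\<^sup>2))"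
        unfolding W_def
        using F(2)[OF w] by (intro cost_le_word_prod[OF mm M, of k]) (auto simp: S_def avail_def)
      then show "cost_le S (W w ` tensor_ix n p) ?c"
        by (rule cost_le_mono[OF _ subset_avail order_refl]) (rule mult_right_mono[OF D[OF w]], simp)
    qed
    have 2: "cost_le (S \<union> T) ((\<lambda>e x. C n e + (\<Sum>w\<in>F. Poly_Mapping.lookup f w * W w e x)) ` tensor_ix n p)
        (card (tensor_ix n p) * Suc (0 + 2 * card F))"
    proof (rule cost_le_image)
      fix e assume e: "e \<in> tensor_ix n p"
      have "cost_le (S \<union> T) {\<lambda>_. C n e} 0" by (rule cost_le_avail) simp
      moreover have "cost_le (S \<union> T) {\<lambda>x. \<Sum>w\<in>F. Poly_Mapping.lookup f w * W w e x} (2 * card F)"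
        using F(1) e by (intro cost_le_lincomb) (auto simp: T_def avail_def)
      ultimately show "cost_le (S \<union> T) {\<lambda>x. C n e + (\<Sum>w\<in>F. Poly_Mapping.lookup f w * W w e x)}
          (Suc (0 + 2 * card F))" by (rule cost_le_add)
    qed simp
    have "card F * ?c + card (tensor_ix n p) * Suc (0 + 2 * card F) \<le> K * (t + n\<^sup>2)"
      by (simp add: K_def card_tensor_ix algebra_simps)
    with cost_le_trans[OF 1 2]
    have "cost_le S ((\<lambda>e x. poly_eval n M f (C n) (\<lambda>s e. x (s, e)) e) ` tensor_ix n p) (K * (t + n\<^sup>2))"
      by (rule_tac cost_le_mono[OF _ subset_avail]) (auto simp: poly_eval_def F_def W_def)
    from cost_le_computes[OF this[unfolded S_def]]
    show "\<exists>P out. length P \<le> K * (t + n\<^sup>2) \<and> computes ({..<k} \<times> tensor_ix n p) (tensor_ix n p) P out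
      (\<lambda>x. poly_eval n M f (C n) (\<lambda>s e. x (s, e)))" .
  qed
qed

section \<open>Renaming the inputs of a program\<close>

text \<open>A program may read an input outside \<open>I\<close>, where every point of the
  coordinate space is 0. As \<open>h\<close> is controlled on \<open>I\<close> only, such an operand
  becomes the scalar 0.\<close>

fun rename_operand :: "'i set \<Rightarrow> ('i \<Rightarrow> 'j) \<Rightarrow> ('i, 'k::zero) operand \<Rightarrow> ('j, 'k) operand" where
  "rename_operand I h (Input i) = (if i \<in> I then Input (h i) else Scalar 0)"
| "rename_operand I h (Scalar c) = Scalar c"
| "rename_operand I h (Result m) = Result m"

lemma operand_value_rename:
  "operand_value u rs (rename_operand I h x) = operand_value (\<lambda>i. if i \<in> I then u (h i) else 0) rs x"
  by (cases x) auto

lemma run_rename: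
  "run u (map (\<lambda>(f, x, y). (f, rename_operand I h x, rename_operand I h y)) P) rs =
    run (\<lambda>i. if i \<in> I then u (h i) else 0) P rs"
  by (induction "(\<lambda>i. if i \<in> I then u (h i) else 0)" P rs rule: run.induct)
    (auto simp: operand_value_rename split: option.splits)

lemma computes_rename:
  fixes \<phi> :: "('i \<Rightarrow> 'k::field) \<Rightarrow> 'l \<Rightarrow> 'k"
  assumes h: "bij_betw h I I'"
    and eq: "\<And>u. u \<in> coord_space I' \<Longrightarrow> \<phi>' u = \<phi> (\<lambda>i. if i \<in> I then u (h i) else 0)"
    and comp: "\<exists>P out. length P = t \<and> computes I J P out \<phi>"
  shows "\<exists>P out. length P = t \<and> computes I' J P out \<phi>'"
proof -
  obtain P out where P: "length P = t" "computes I J P out \<phi>" using comp by blast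
  define P' where "P' = map (\<lambda>(f, x, y). (f, rename_operand I h x, rename_operand I h y)) P"
  define pull where "pull u = (\<lambda>i. if i \<in> I then u (h i) else 0)" for u :: "_ \<Rightarrow> 'k"
  have pull: "pull u \<in> coord_space I" for u by (simp add: pull_def coord_space_def)
  obtain u where u: "u \<in> coord_space I" "run u P [] \<noteq> None" using P(2) by (auto simp: computes_def)
  define u' where "u' = (\<lambda>i. if i \<in> I' then u (inv_into I h i) else 0)"
  have "pull u' = u"
    using u(1) h by (auto simp: pull_def u'_def fun_eq_iff coord_space_def bij_betw_def)
  moreover have "u' \<in> coord_space I'" by (simp add: u'_def coord_space_def)
  moreover have run: "run v P' [] = run (pull v) P []" for v
    unfolding P'_def pull_def by (rule run_rename)
  moreover have "operand_value v rs (rename_operand I h (out j)) = Some (\<phi>' v j)"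
    if "v \<in> coord_space I'" "run v P' [] = Some rs" "j \<in> J" for v rs j
  proof -
    have "operand_value (pull v) rs (out j) = Some (\<phi> (pull v) j)"
      using P(2) pull that unfolding run computes_def by blast
    then show ?thesis
      using eq[OF that(1)] by (simp add: operand_value_rename pull_def)
  qed
  ultimately have "computes I' J P' (\<lambda>j. rename_operand I h (out j)) \<phi>'"
    unfolding computes_def using u(2) by (metis (no_types, lifting))
  moreover have "length P' = t" by (simp add: P'_def P(1))
  ultimately show ?thesis by blast
qed

text \<open>The complexities differ only in how inputs are indexed, by a disjoint sum or by pairs
  tagged 0 or 1. Renaming in both directions shows that the same program lengths occur.\<close>

lemma omega_hat_tensor_mult_eq_eval:
  fixes M :: "'k::conjugatable_field mat"
  shows "omega_hat_tensor_mult M p = omega_hat_eval M p 2 (Poly_Mapping.single [0, 1] 1) (\<lambda>_ _. 0)"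
proof -
  have ev: "poly_eval n M (Poly_Mapping.single [0, 1] 1) (\<lambda>_. 0) X = tensor_mult n M (X 0) (X 1)"
    for n and X :: "nat \<Rightarrow> 'k tensor"
    by (simp add: poly_eval_def fun_eq_iff)
  have "total_complexity (tensor_ix n p <+> tensor_ix n p) (tensor_ix n p)
      (\<lambda>x. tensor_mult n M (\<lambda>e. x (Inl e)) (\<lambda>e. x (Inr e))) =
    total_complexity ({..<2 :: nat} \<times> tensor_ix n p) (tensor_ix n p)
      (\<lambda>x. tensor_mult n M (\<lambda>e. x (0, e)) (\<lambda>e. x (1, e)))" for n
  proof -
    let ?I = "tensor_ix n p <+> tensor_ix n p" and ?I' = "{..<2 :: nat} \<times> tensor_ix n p"
    define h :: "_ \<Rightarrow> nat \<times> nat \<times> nat \<times> nat" where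
      "h i = (case i of Inl e \<Rightarrow> (0, e) | Inr e \<Rightarrow> (1, e))" for i
    define g :: "nat \<times> nat \<times> nat \<times> nat \<Rightarrow> _" where
      "g i = (if fst i = 0 then Inl (snd i) else Inr (snd i))" for i
    have h: "bij_betw h ?I ?I'" and g: "bij_betw g ?I' ?I"
      by (rule bij_betw_byWitness[where f' = g] bij_betw_byWitness[where f' = h];
        force simp: h_def g_def less_2_cases_iff)+
    have "(\<exists>P out. length P = t \<and> computes ?I (tensor_ix n p) P out
        (\<lambda>x. tensor_mult n M (\<lambda>e. x (Inl e)) (\<lambda>e. x (Inr e)))) \<longleftrightarrow>
      (\<exists>P out. length P = t \<and> computes ?I' (tensor_ix n p) P out
        (\<lambda>x. tensor_mult n M (\<lambda>e. x (0, e)) (\<lambda>e. x (1, e))))" for t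
    proof
      assume "\<exists>P out. length P = t \<and> computes ?I (tensor_ix n p) P out
        (\<lambda>x. tensor_mult n M (\<lambda>e. x (Inl e)) (\<lambda>e. x (Inr e)))"
      then show "\<exists>P out. length P = t \<and> computes ?I' (tensor_ix n p) P out
        (\<lambda>x. tensor_mult n M (\<lambda>e. x (0, e)) (\<lambda>e. x (1, e)))"
        by (rule computes_rename[OF h, rotated])
          (intro arg_cong2[of _ _ _ _ "tensor_mult n M"] ext;
            auto simp: h_def coord_space_def Plus_def image_iff)
    next
      assume "\<exists>P out. length P = t \<and> computes ?I' (tensor_ix n p) P out
        (\<lambda>x. tensor_mult n M (\<lambda>e. x (0, e)) (\<lambda>e. x (1, e)))"
      then show "\<exists>P out. length P = t \<and> computes ?I (tensor_ix n p) P out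
        (\<lambda>x. tensor_mult n M (\<lambda>e. x (Inl e)) (\<lambda>e. x (Inr e)))"
        by (rule computes_rename[OF g, rotated])
          (intro arg_cong2[of _ _ _ _ "tensor_mult n M"] ext;
            auto simp: g_def coord_space_def Plus_def image_iff)
    qed
    then show ?thesis unfolding total_complexity_def by simp
  qed
  then show ?thesis
    unfolding omega_hat_tensor_mult_def omega_hat_eval_def omega_hat_def ev by simp
qed

section \<open>Matrix multiplication inside a tensor polynomial\<close>

lemma mat_adjoint_dim: "M \<in> carrier_mat q p \<Longrightarrow> mat_adjoint M \<in> carrier_mat p q"
  by (simp add: mat_adjoint_def mat_of_rows_def)

lemma mat_adjoint_index:
  "M \<in> carrier_mat q p \<Longrightarrow> i < p \<Longrightarrow> j < q \<Longrightarrow> mat_adjoint M $$ (i, j) = conjugate (M $$ (j, i))"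
  by (simp add: mat_adjoint_def mat_of_rows_def)

text \<open>A maximal independent set of columns has \<open>q\<close> elements and forms an
  invertible square matrix, whose transpose annihilates \<open>y\<close>.\<close>

lemma full_rank_left_kernel:
  fixes M :: "'k::field mat"
  assumes M: "M \<in> carrier_mat q p" and rank: "vec_space.rank q M = q"
    and y: "y \<in> carrier_vec q" "\<And>j. j < p \<Longrightarrow> col M j \<bullet> y = 0"
  shows "y = 0\<^sub>v q"
proof (rule ccontr)
  assume y0: "y \<noteq> 0\<^sub>v q"
  interpret vec_space "TYPE('k)" q .
  let ?P = "\<lambda>T. T \<subseteq> set (cols M) \<and> lin_indpt T"
  obtain S where S: "finite S" "maximal S ?P"
    using maximal_exists_superset[of "set (cols M)" ?P "{}"] finite_lin_indpt2[of "{}"] by auto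
  have cS: "card S = q" using rank rank_card_indpt[OF M S(2)] by simp
  obtain xs where xs: "set xs = S" "distinct xs" using S(1) finite_distinct_list by blast
  have len: "length xs = q" using xs cS distinct_card by fastforce
  have PS: "S \<subseteq> set (cols M)" "lin_indpt S" using S(2) by (auto simp: maximal_def)
  define B where "B = mat_of_cols q xs"
  have B: "B \<in> carrier_mat q q" using len by (simp add: B_def mat_of_cols_def)
  have carr: "set xs \<subseteq> carrier_vec q" using xs(1) PS(1) cols_dim[of M] M by auto
  have cols: "cols B = xs" unfolding B_def using carr by (rule cols_mat_of_cols)
  have "rank B = q" using lin_indpt_full_rank[OF B] cols xs PS(2) by simp
  then have "det B \<noteq> 0" using det_rank_iff[OF B] by simp
  then have "det (transpose_mat B) \<noteq> 0" using det_transpose[OF B] by simp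
  moreover have "transpose_mat B *\<^sub>v y = 0\<^sub>v q"
  proof (rule eq_vecI)
    fix i assume "i < dim_vec (0\<^sub>v q :: 'k vec)"
    then have i: "i < q" by simp
    have "xs ! i \<in> set (cols M)" using i len xs(1) PS(1) nth_mem by blast
    then obtain j where j: "j < p" "xs ! i = col M j" using M by (auto simp: cols_def)
    have "col B i = xs ! i" using cols i B cols_nth[of i B] by simp
    then show "(transpose_mat B *\<^sub>v y) $ i = 0\<^sub>v q $ i"
      using i B j y(2)[OF j(1)] by simp
  qed (use B in simp)
  ultimately show False
    using det_0_iff_vec_prod_zero_field[of "transpose_mat B" q] B y(1) y0 by auto
qed

text \<open>If M M^H v = 0, then w = M^H v satisfies M w = 0, so the Hermitian square of w is v^H M
  w = 0 and w = 0. Then the conjugate of v is orthogonal to all columns of \<open>M\<close>, and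
  full rank gives v = 0.\<close>

lemma pinv_full_rank:
  fixes M :: "'k::conjugatable_ordered_field mat"
  assumes M: "M \<in> carrier_mat q p" and rank: "vec_space.rank q M = q"
  shows "pinv M \<in> carrier_mat p q" "M * pinv M = 1\<^sub>m q"
proof -
  define H where "H = mat_adjoint M"
  have H: "H \<in> carrier_mat p q" unfolding H_def by (rule mat_adjoint_dim[OF M])
  have MH: "M * H \<in> carrier_mat q q" using M H by simp
  have "det (M * H) \<noteq> 0"
  proof
    assume "det (M * H) = 0"
    then obtain v where v: "v \<in> carrier_vec q" "v \<noteq> 0\<^sub>v q" "(M * H) *\<^sub>v v = 0\<^sub>v q"
      using det_0_iff_vec_prod_zero_field[OF MH] by blast
    define w where "w = H *\<^sub>v v"
    have w: "w \<in> carrier_vec p" unfolding w_def using H v(1) by simp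
    have Mw: "M *\<^sub>v w = 0\<^sub>v q" unfolding w_def using v(3) assoc_mult_mat_vec[OF M H v(1)] by simp
    have wi: "w $ i = (\<Sum>j<q. conjugate (M $$ (j, i)) * v $ j)" if "i < p" for i
      unfolding w_def using that H v(1) mat_adjoint_index[OF M that]
      by (auto simp: scalar_prod_def lessThan_atLeast0 H_def intro!: sum.cong)
    have Mwj: "(\<Sum>i<p. M $$ (j, i) * w $ i) = 0" if "j < q" for j
    proof -
      have "(M *\<^sub>v w) $ j = (\<Sum>i<p. M $$ (j, i) * w $ i)"
        using that M w by (auto simp: scalar_prod_def lessThan_atLeast0 intro!: sum.cong)
      then show ?thesis using Mw that by simp
    qed
    have cwi: "conjugate (w $ i) = (\<Sum>j<q. M $$ (j, i) * conjugate (v $ j))" if "i < p" for i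
      unfolding wi[OF that] by (simp add: sum_conjugate conjugate_dist_mul)
    have "w \<bullet>c w = (\<Sum>i<p. w $ i * (\<Sum>j<q. M $$ (j, i) * conjugate (v $ j)))"
      using w cwi by (auto simp: scalar_prod_def lessThan_atLeast0 intro!: sum.cong)
    also have "\<dots> = (\<Sum>i<p. \<Sum>j<q. conjugate (v $ j) * (M $$ (j, i) * w $ i))"
      by (simp add: sum_distrib_left mult_ac)
    also have "\<dots> = (\<Sum>j<q. \<Sum>i<p. conjugate (v $ j) * (M $$ (j, i) * w $ i))"
      by (rule sum.swap)
    also have "\<dots> = (\<Sum>j<q. conjugate (v $ j) * (\<Sum>i<p. M $$ (j, i) * w $ i))"
      by (simp add: sum_distrib_left)
    also have "\<dots> = 0" using Mwj by simp
    finally have "w = 0\<^sub>v p" using conjugate_square_eq_0_vec[OF w] by simp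
    have "conjugate v = 0\<^sub>v q"
    proof (rule full_rank_left_kernel[OF M rank])
      show "conjugate v \<in> carrier_vec q" using v(1) by simp
      fix i assume i: "i < p"
      have "col M i \<bullet> conjugate v = (\<Sum>j<q. M $$ (j, i) * conjugate (v $ j))"
        using i M v(1) by (auto simp: scalar_prod_def lessThan_atLeast0 intro!: sum.cong)
      also have "\<dots> = conjugate (w $ i)" using cwi[OF i] by simp
      finally show "col M i \<bullet> conjugate v = 0" using \<open>w = 0\<^sub>v p\<close> i by simp
    qed
    then have "v $ i = 0" if "i < q" for i
      using that v(1) by (metis carrier_vecD conjugate_zero_iff index_zero_vec(1) vec_index_conjugate)
    then show False using v(1,2) by auto
  qed
  then have "M * H \<in> Units (ring_mat TYPE('k) q ())" by (rule det_non_zero_imp_unit[OF MH])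
  then obtain B where B: "mat_inverse (M * H) = Some B"
    using mat_inverse(1)[OF MH, where b = "()"] by (cases "mat_inverse (M * H)") auto
  have B': "(M * H) * B = 1\<^sub>m q" "B \<in> carrier_mat q q" using mat_inverse(2)[OF MH B] by auto
  have pinv: "pinv M = H * B" by (simp add: pinv_def B flip: H_def)
  show "pinv M \<in> carrier_mat p q" unfolding pinv using H B'(2) by simp
  show "M * pinv M = 1\<^sub>m q" unfolding pinv using assoc_mult_mat[OF M H B'(2)] B'(1) by simp
qed

text \<open>
  The tensors \<open>slice_tensor M A\<close>, whose image under \<open>\<times>\<^sub>3 M\<close> has \<open>A\<close> as its only nonzero frontal slice, form
  a copy of the matrix algebra.
\<close>

definition slice_tensor :: "'k::conjugatable_field mat \<Rightarrow> (nat \<times> nat \<Rightarrow> 'k) \<Rightarrow> 'k tensor" where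
  "slice_tensor M A = (\<lambda>(i, j, l). if l < dim_col M then A (i, j) * pinv M $$ (l, 0) else 0)"

text \<open>Frontal slice 0 of \<open>T \<times>\<^sub>3 M\<close>: linear in \<open>T\<close>, and
  a left inverse of \<open>slice_tensor M\<close> when \<open>pinv M\<close> is a right inverse of
  \<open>M\<close>.\<close>

definition tensor_slice :: "'k::conjugatable_field mat \<Rightarrow> 'k tensor \<Rightarrow> nat \<times> nat \<Rightarrow> 'k" where
  "tensor_slice M T = (\<lambda>(i, j). \<Sum>l<dim_col M. M $$ (0, l) * T (i, j, l))"

fun matrix_word :: "nat \<Rightarrow> (nat \<Rightarrow> nat \<times> nat \<Rightarrow> 'k::field) \<Rightarrow> nat list \<Rightarrow> nat \<times> nat \<Rightarrow> 'k" where
  "matrix_word n Y [] = (\<lambda>_. 0)"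
| "matrix_word n Y [s] = Y s"
| "matrix_word n Y (s # t # w) = matrix_mult n (Y s) (matrix_word n Y (t # w))"

context
  fixes M :: "'k::conjugatable_field mat" and q p :: nat
  assumes M: "M \<in> carrier_mat q p" and N: "pinv M \<in> carrier_mat p q" and MN: "M * pinv M = 1\<^sub>m q"
    and q: "1 \<le> q"
begin

lemma mult_pinv: "h < q \<Longrightarrow> (\<Sum>l<p. M $$ (h, l) * pinv M $$ (l, 0)) = (if h = 0 then 1 else 0)"
proof -
  assume "h < q"
  then have "(M * pinv M) $$ (h, 0) = (\<Sum>l<p. M $$ (h, l) * pinv M $$ (l, 0))"
    using M N q by (auto simp: scalar_prod_def lessThan_atLeast0 intro!: sum.cong)
  then show ?thesis using MN \<open>h < q\<close> q by simp
qed

lemma tensor_slice_slice_tensor: "tensor_slice M (slice_tensor M A) = A"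
proof
  fix e :: "nat \<times> nat"
  obtain i j where e: "e = (i, j)" by (cases e)
  have "tensor_slice M (slice_tensor M A) e = A e * (\<Sum>l<p. M $$ (0, l) * pinv M $$ (l, 0))"
    using M by (simp add: e tensor_slice_def slice_tensor_def sum_distrib_left mult_ac)
  then show "tensor_slice M (slice_tensor M A) e = A e" using mult_pinv[of 0] q by simp
qed

lemma mode3_slice_tensor:
  "(slice_tensor M A \<times>\<^sub>3 M) (i, j, h) = (if h = 0 then A (i, j) else 0)"
proof (cases "h < q")
  case True
  have "(slice_tensor M A \<times>\<^sub>3 M) (i, j, h) = A (i, j) * (\<Sum>l<p. M $$ (h, l) * pinv M $$ (l, 0))"
    using M True by (simp add: mode3_prod_def slice_tensor_def sum_distrib_left mult_ac)
  then show ?thesis using mult_pinv[OF True] by simp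
next
  case False
  then show ?thesis using M q by (auto simp: mode3_prod_def)
qed

lemma tensor_mult_slice_tensor: "tensor_mult n M (slice_tensor M A) (slice_tensor M B) = slice_tensor M (matrix_mult n A B)"
proof
  fix e :: "nat \<times> nat \<times> nat"
  obtain i j l where e: "e = (i, j, l)" by (cases e)
  define G where "G = facewise_prod n (slice_tensor M A \<times>\<^sub>3 M) (slice_tensor M B \<times>\<^sub>3 M)"
  have G: "G (i, j, h) = (if h = 0 then matrix_mult n A B (i, j) else 0)" for h
    by (simp add: G_def frontal_slice_mult mode3_slice_tensor matrix_mult_apply)
  have "tensor_mult n M (slice_tensor M A) (slice_tensor M B) = G \<times>\<^sub>3 pinv M"
    by (simp add: tensor_mult_def G_def)
  then have "tensor_mult n M (slice_tensor M A) (slice_tensor M B) e =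
      (if l < p then \<Sum>h<q. pinv M $$ (l, h) * G (i, j, h) else 0)"
    using N by (simp add: mode3_prod_def e)
  also have "(\<Sum>h<q. pinv M $$ (l, h) * G (i, j, h)) =
      (\<Sum>h<q. if h = 0 then pinv M $$ (l, 0) * matrix_mult n A B (i, j) else 0)"
    by (rule sum.cong) (simp_all add: G)
  also have "(if l < p then \<dots> else 0) = slice_tensor M (matrix_mult n A B) e"
    using M q by (simp add: e slice_tensor_def mult.commute)
  finally show "tensor_mult n M (slice_tensor M A) (slice_tensor M B) e = slice_tensor M (matrix_mult n A B) e" .
qed

lemma word_prod_slice_tensor:
  "w \<noteq> [] \<Longrightarrow> word_prod n M (\<lambda>s. slice_tensor M (Y s)) w = slice_tensor M (matrix_word n Y w)"
  by (induction w rule: induct_list012) (simp_all add: tensor_mult_slice_tensor)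

text \<open>On the embedded matrix algebra, linearity of \<open>tensor_slice\<close> turns the
  tensor polynomial into the same combination of words in matrices, up to the constant term.\<close>

lemma tensor_slice_poly_eval:
  assumes "\<And>w. w \<in> Poly_Mapping.keys f \<Longrightarrow> w \<noteq> []"
  shows "tensor_slice M (poly_eval n M f c (\<lambda>s. slice_tensor M (Y s))) e =
    tensor_slice M c e + (\<Sum>w\<in>Poly_Mapping.keys f. Poly_Mapping.lookup f w * matrix_word n Y w e)"
proof -
  obtain i j where e: "e = (i, j)" by (cases e)
  let ?K = "Poly_Mapping.keys f"
  have "poly_eval n M f c (\<lambda>s. slice_tensor M (Y s)) = (\<lambda>e. c e + (\<Sum>w\<in>?K. Poly_Mapping.lookup f w *
      slice_tensor M (matrix_word n Y w) e))"
    unfolding poly_eval_def using assms by (simp add: word_prod_slice_tensor cong: sum.cong)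
  then have "tensor_slice M (poly_eval n M f c (\<lambda>s. slice_tensor M (Y s))) e = tensor_slice M c e +
      (\<Sum>l<p. \<Sum>w\<in>?K. Poly_Mapping.lookup f w * (M $$ (0, l) * slice_tensor M (matrix_word n Y w) (i, j, l)))"
    using M by (simp add: tensor_slice_def e distrib_left sum.distrib sum_distrib_left mult_ac)
  also have "(\<Sum>l<p. \<Sum>w\<in>?K. Poly_Mapping.lookup f w * (M $$ (0, l) * slice_tensor M (matrix_word n Y w) (i, j, l)))
      = (\<Sum>w\<in>?K. \<Sum>l<p. Poly_Mapping.lookup f w * (M $$ (0, l) * slice_tensor M (matrix_word n Y w) (i, j, l)))"
    by (rule sum.swap)
  also have "\<dots> = (\<Sum>w\<in>?K. Poly_Mapping.lookup f w * tensor_slice M (slice_tensor M (matrix_word n Y w)) e)"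
    using M by (simp add: tensor_slice_def e sum_distrib_left)
  finally show ?thesis by (simp add: tensor_slice_slice_tensor)
qed

end

text \<open>
  Substituting for the indeterminates block matrices supported just above the diagonal, the block
  in position \<open>(0, d)\<close> of a word of length \<open>d\<close> picks out a single word \<open>w\<close>.
\<close>

definition block_shift :: "nat \<Rightarrow> nat list \<Rightarrow> (nat \<Rightarrow> nat \<times> nat \<Rightarrow> 'k::zero) \<Rightarrow> nat \<Rightarrow> nat \<times> nat \<Rightarrow> 'k" where
  "block_shift m w Z s = (\<lambda>(i, j). if i < Suc (length w) * m \<and> j < Suc (length w) * m \<and>
     i div m < length w \<and> w ! (i div m) = s \<and> j div m = Suc (i div m)
     then Z (i div m) (i mod m, j mod m) else 0)"

text \<open>The identity need not be cut off at size \<open>m\<close>: \<open>block_shift\<close>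
  reads it at remainders modulo \<open>m\<close> only.\<close>

definition two_factors :: "(nat \<times> nat \<Rightarrow> 'k) \<Rightarrow> (nat \<times> nat \<Rightarrow> 'k) \<Rightarrow> nat \<Rightarrow> nat \<times> nat \<Rightarrow> 'k::field" where
  "two_factors A B a = (if a = 0 then A else if a = 1 then B else (\<lambda>(i, j). if i = j then 1 else 0))"

lemma block_shift_block:
  assumes "a \<le> length w" "b \<le> length w" "x < m" "y < m"
  shows "block_shift m w Z s (a * m + x, b * m + y) =
    (if a < length w \<and> w ! a = s \<and> b = Suc a then Z a (x, y) else 0)"
proof -
  have lt: "a * m + x < Suc (length w) * m" "b * m + y < Suc (length w) * m"
    using assms by (intro block_index_less; simp)+
  have dm: "(a * m + x) div m = a" "(a * m + x) mod m = x" "(b * m + y) div m = b" "(b * m + y) mod m = y"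
    using assms(3,4) by simp_all
  show ?thesis by (simp only: block_shift_def prod.case dm lt simp_thms)
qed

text \<open>The only block path from row \<open>a\<close> to column \<open>d\<close> advances by one
  per letter, and in row \<open>b\<close> only the letter \<open>w ! b\<close> acts, so the word
  must be \<open>drop a w\<close>. The start row is general because the induction removes the first
  letter and moves on to row \<open>a + 1\<close>.\<close>

lemma matrix_word_block:
  fixes A B :: "nat \<times> nat \<Rightarrow> 'k::field"
  assumes "2 \<le> length w" "v \<noteq> []" "a \<le> length w" "x < m" "y < m"
  defines "d \<equiv> length w"
  shows "matrix_word (Suc d * m) (block_shift m w (two_factors A B)) v (a * m + x, d * m + y) =
    (if v = drop a w then if a = 0 then \<Sum>z<m. A (x, z) * B (z, y) else two_factors A B a (x, y) else 0)"
  using assms(2-4)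
proof (induction v arbitrary: a x rule: induct_list012)
  case (2 s)
  have "[s] = drop a w \<longleftrightarrow> a < d \<and> w ! a = s \<and> d = Suc a"
    using 2(2) by (cases "a = d") (auto simp: d_def Cons_nth_drop_Suc[symmetric])
  \<comment> \<open>A single letter reaches column \<open>d\<close> only from row
    \<open>d - 1\<close>, which is positive because \<open>w\<close> has at least two letters; so
    the case \<open>a = 0\<close> does not arise here.\<close>
  then show ?case
    using 2 assms(1,5) by (auto simp: block_shift_block d_def)
next
  case (3 s s' v)
  let ?Y = "block_shift m w (two_factors A B)"
  let ?G = "\<lambda>a e. if a = 0 then \<Sum>z<m. A (fst e, z) * B (z, snd e) else two_factors A B a e"
  let ?mw = "matrix_word (Suc d * m) ?Y"
  have lt: "a * m + x < Suc d * m" "d * m + y < Suc d * m"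
    using 3(4,5) assms(5) by (intro block_index_less; simp add: d_def)+
  have IH: "?mw (s' # v) (b * m + z, d * m + y) = (if s' # v = drop b w then ?G b (z, y) else 0)"
    if "b \<le> d" "z < m" for b z
    using 3(2)[of b z] that unfolding d_def by simp
  have "?mw (s # s' # v) (a * m + x, d * m + y)
      = (\<Sum>z<Suc d * m. ?Y s (a * m + x, z) * ?mw (s' # v) (z, d * m + y))"
    using lt by (simp add: matrix_mult_apply)
  also have "\<dots> = (\<Sum>b<Suc d. \<Sum>z<m. ?Y s (a * m + x, b * m + z) * ?mw (s' # v) (b * m + z, d * m + y))"
    by (rule sum_lessThan_mult)
  also have "\<dots> = (\<Sum>b<Suc d. if b = Suc a then
      (\<Sum>z<m. if a < d \<and> w ! a = s \<and> s' # v = drop b w then two_factors A B a (x, z) * ?G b (z, y) else 0) else 0)"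
  proof (rule sum.cong[OF refl])
    fix b assume "b \<in> {..<Suc d}"
    then have b: "b \<le> length w" by (simp add: d_def)
    have "?Y s (a * m + x, b * m + z) * ?mw (s' # v) (b * m + z, d * m + y) =
       (if b = Suc a then if a < d \<and> w ! a = s \<and> s' # v = drop b w then two_factors A B a (x, z) * ?G b (z, y) else 0 else 0)"
      if "z < m" for z
      using IH[of b z] b that block_shift_block[OF 3(4) b 3(5) that, of "two_factors A B" s]
      by (auto simp: d_def)
    then show "(\<Sum>z<m. ?Y s (a * m + x, b * m + z) * ?mw (s' # v) (b * m + z, d * m + y)) =
      (if b = Suc a then (\<Sum>z<m. if a < d \<and> w ! a = s \<and> s' # v = drop b w
         then two_factors A B a (x, z) * ?G b (z, y) else 0) else 0)"
      by (cases "b = Suc a") (auto intro!: sum.cong sum.neutral)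
  qed
  also have "\<dots> = (if a < d then \<Sum>z<m. if w ! a = s \<and> s' # v = drop (Suc a) w
      then two_factors A B a (x, z) * ?G (Suc a) (z, y) else 0 else 0)"
    by (subst sum.delta) auto
  also have "\<dots> = (if s # s' # v = drop a w then \<Sum>z<m. two_factors A B a (x, z) * ?G (Suc a) (z, y) else 0)"
    by (cases "a < d") (auto simp: d_def Cons_nth_drop_Suc[symmetric])
  \<comment> \<open>For positive \<open>a\<close> the factor in row \<open>a + 1\<close> is an
    identity and the sum collapses; for \<open>a = 0\<close> the sum is the product of
    \<open>A\<close> and \<open>B\<close>.\<close>
  also have "\<dots> = (if s # s' # v = drop a w then ?G a (x, y) else 0)"
  proof (cases "a = 0")
    case True
    then show ?thesis by (simp add: two_factors_def)
  next
    case False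
    have "(\<Sum>z<m. two_factors A B a (x, z) * two_factors A B (Suc a) (z, y)) =
        (\<Sum>z<m. if z = y then two_factors A B a (x, y) else 0)"
      using False by (intro sum.cong) (auto simp: two_factors_def)
    then show ?thesis using False assms(5) by simp
  qed
  finally show ?case by simp
qed simp

section \<open>Degrees of tensor polynomials along planes\<close>

definition is_bipoly :: "nat \<Rightarrow> ('k::field \<Rightarrow> 'k \<Rightarrow> 'k) \<Rightarrow> bool" where
  "is_bipoly D g \<longleftrightarrow> (\<exists>q. bipoly D q g)"

lemma is_bipoly_mono: "is_bipoly D g \<Longrightarrow> D \<le> E \<Longrightarrow> is_bipoly E g"
  unfolding is_bipoly_def using bipoly_mono by blast

lemma is_bipoly_const: "is_bipoly D (\<lambda>s t. c)"
  using bipoly_const[of c] is_bipoly_mono[of 0 _ D] unfolding is_bipoly_def by blast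

lemma is_bipoly_mult: "is_bipoly D g \<Longrightarrow> is_bipoly E h \<Longrightarrow> is_bipoly (D + E) (\<lambda>s t. g s t * h s t)"
  unfolding is_bipoly_def using bipoly_mult by blast

lemma is_bipoly_add: "is_bipoly D g \<Longrightarrow> is_bipoly D h \<Longrightarrow> is_bipoly D (\<lambda>s t. g s t + h s t)"
  unfolding is_bipoly_def using bipoly_add by blast

lemma is_bipoly_cmult: "is_bipoly D g \<Longrightarrow> is_bipoly D (\<lambda>s t. c * g s t)"
  using is_bipoly_mult[OF is_bipoly_const[of 0 c], of D g] by simp

lemma is_bipoly_if: "is_bipoly D g \<Longrightarrow> is_bipoly D h \<Longrightarrow> is_bipoly D (\<lambda>s t. if c then g s t else h s t)"
  by (cases c) simp_all

lemma is_bipoly_sum: "(\<And>i. i \<in> F \<Longrightarrow> is_bipoly D (g i)) \<Longrightarrow> is_bipoly D (\<lambda>s t. \<Sum>i\<in>F. g i s t)"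
  by (induction F rule: infinite_finite_induct) (simp_all add: is_bipoly_const is_bipoly_add)

lemma is_bipoly_mode3:
  assumes "\<And>e. is_bipoly D (\<lambda>s t. A s t e)"
  shows "is_bipoly D (\<lambda>s t. (A s t \<times>\<^sub>3 N) e)"
  by (cases e) (simp add: mode3_prod_def is_bipoly_if is_bipoly_const is_bipoly_sum is_bipoly_cmult assms del: if_split)

text \<open>The mode-3 products have constant coefficients, so only the face-wise product adds
  degrees.\<close>

lemma is_bipoly_tensor_mult:
  assumes "\<And>e. is_bipoly D (\<lambda>s t. A s t e)" "\<And>e. is_bipoly E (\<lambda>s t. B s t e)"
  shows "is_bipoly (D + E) (\<lambda>s t. tensor_mult n M (A s t) (B s t) e)"
  unfolding tensor_mult_def
proof (rule is_bipoly_mode3)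
  fix e :: "nat \<times> nat \<times> nat"
  show "is_bipoly (D + E) (\<lambda>s t. facewise_prod n (A s t \<times>\<^sub>3 M) (B s t \<times>\<^sub>3 M) e)"
    by (cases e)
      (simp add: frontal_slice_mult is_bipoly_if is_bipoly_const is_bipoly_sum is_bipoly_mult is_bipoly_mode3 assms)
qed

lemma is_bipoly_word_prod:
  assumes "\<And>i e. is_bipoly 1 (\<lambda>s t. X s t i e)" "w \<noteq> []"
  shows "is_bipoly (length w) (\<lambda>s t. word_prod n M (X s t) w e)"
  using assms(2)
proof (induction w arbitrary: e rule: induct_list012)
  case (2 i)
  then show ?case using assms(1) by simp
next
  case (3 i j w)
  then have "is_bipoly (1 + length (j # w)) (\<lambda>s t. word_prod n M (X s t) (i # j # w) e)"
    unfolding word_prod.simps by (intro is_bipoly_tensor_mult assms(1)) auto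
  then show ?case by simp
qed simp

lemma is_bipoly_poly_eval:
  assumes "\<And>i e. is_bipoly 1 (\<lambda>s t. X s t i e)"
    and "\<And>w. w \<in> Poly_Mapping.keys f \<Longrightarrow> w \<noteq> [] \<and> length w \<le> D"
  shows "is_bipoly D (\<lambda>s t. poly_eval n M f c (X s t) e)"
  unfolding poly_eval_def
  by (intro is_bipoly_add is_bipoly_const is_bipoly_sum is_bipoly_cmult)
    (use assms is_bipoly_mono is_bipoly_word_prod in blast)

lemma poly_eq_if_infinite:
  assumes "infinite (UNIV :: 'k::field set)" "\<And>t. poly p t = poly q (t :: 'k)"
  shows "p = q"
proof -
  have "poly (p - q) t = 0" for t using assms(2) by simp
  then have "p - q = 0" using poly_roots_finite[of "p - q"] assms(1) by auto
  then show ?thesis by simp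
qed

text \<open>Along the line through \<open>\<eta>\<close> in direction \<open>A u + B v\<close>, the
  corner block of transformed slice 0 is a constant plus t^2 times a nonzero multiple of the matrix
  product of \<open>u\<close> and \<open>v\<close>. The factor \<open>Suc D\<close> comes from
  interpolation, the 2 from polarization.\<close>

lemma matrix_rank_le_program:
  fixes M :: "'k::conjugatable_field mat"
  assumes inf: "infinite (UNIV :: 'k set)"
    and M: "M \<in> carrier_mat q p" "pinv M \<in> carrier_mat p q" "M * pinv M = 1\<^sub>m q" "1 \<le> q"
    and f: "tensor_polynomial k p f C"
    and w: "w \<in> Poly_Mapping.keys f" "2 \<le> length w"
    and D: "\<And>v. v \<in> Poly_Mapping.keys f \<Longrightarrow> length v \<le> D"
    and n: "n = Suc (length w) * m"
    and comp: "computes ({..<k} \<times> tensor_ix n p) (tensor_ix n p) P out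
      (\<lambda>x. poly_eval n M f (C n) (\<lambda>s e. x (s, e)))"
  shows "tensor_rank (matrix_ix m) (matrix_ix m) (matrix_ix m)
    (matrix_mult m :: (nat \<times> nat \<Rightarrow> 'k) \<Rightarrow> _) \<le> 2 * (Suc D * length P)"
proof -
  define d where "d = length w"
  define I where "I = {..<k} \<times> tensor_ix n p"
  define c where "c = Poly_Mapping.lookup f w"
  have c: "c \<noteq> 0" using w(1) by (simp add: c_def in_keys_iff)
  have keys: "v \<noteq> []" "set v \<subseteq> {..<k}" if "v \<in> Poly_Mapping.keys f" for v
    using f that by (auto simp: tensor_polynomial_def)
  define \<phi> where "\<phi> x = poly_eval n M f (C n) (\<lambda>s e. x (s, e))" for x :: "nat \<times> nat \<times> nat \<times> nat \<Rightarrow> 'k"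
  define inp where "inp Z = (\<lambda>(s, e). slice_tensor M (block_shift m w Z s) e)"
    for Z :: "nat \<Rightarrow> nat \<times> nat \<Rightarrow> 'k"
  have inp_apply: "inp Z (s, i, j, l) = (if l < p then block_shift m w Z s (i, j) * pinv M $$ (l, 0) else 0)"
    for Z s i j l using M(1) by (simp add: inp_def slice_tensor_def)
  have inp: "inp Z \<in> coord_space I" for Z
  proof -
    have "s < k \<and> i < n \<and> j < n" if "block_shift m w Z s (i, j) \<noteq> 0" for s i j
    proof -
      have "i < n" "j < n" "i div m < length w" "w ! (i div m) = s"
        using that by (auto simp: block_shift_def n split: if_splits)
      then show ?thesis using keys(2)[OF w(1)] nth_mem by blast
    qed
    then show ?thesis by (force simp: coord_space_def I_def tensor_ix_def inp_apply)
  qed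
  define A where "A u = inp (\<lambda>a. if a = 0 then u else (\<lambda>_. 0))" for u
  define B where "B v = inp (\<lambda>a. if a = 1 then v else (\<lambda>_. 0))" for v
  \<comment> \<open>Zero blocks for the two factors, identities for the rest; adding
    \<open>t * (A u + B v)\<close> fills in the first two blocks and leaves the identities
    alone.\<close>
  define \<eta> where "\<eta> = inp (two_factors (\<lambda>_. 0) (\<lambda>_. 0))"
  have line: "(\<lambda>i. \<eta> i + t * (A u i + B v i)) = inp (two_factors (\<lambda>e. t * u e) (\<lambda>e. t * v e))" for t u v
  proof
    fix e :: "nat \<times> nat \<times> nat \<times> nat"
    obtain s i j l where e: "e = (s, i, j, l)" by (cases e)
    show "\<eta> e + t * (A u e + B v e) = inp (two_factors (\<lambda>e. t * u e) (\<lambda>e. t * v e)) e"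
      by (auto simp: e \<eta>_def A_def B_def inp_apply block_shift_def two_factors_def)
  qed
  have bip: "is_bipoly D (\<lambda>s t. \<phi> (\<lambda>i. \<eta> i + s * \<xi> i + t * x i) j)" for \<xi> x j
    unfolding \<phi>_def
  proof (rule is_bipoly_poly_eval)
    show "is_bipoly 1 (\<lambda>s t. \<eta> (i, e) + s * \<xi> (i, e) + t * x (i, e))" for i e
      unfolding is_bipoly_def using bipoly_affine by blast
  qed (use keys D in blast)
  obtain F :: "('k \<times> nat) set" and W l l' where F: "finite F" "card F = Suc D * length P"
    "\<forall>s\<in>F. linear_form I (l s) \<and> linear_form I (l' s)"
    and coeff2: "\<forall>x\<in>coord_space I. \<forall>j\<in>tensor_ix n p. \<forall>p :: 'k poly. (\<forall>t. \<phi> (\<lambda>i. \<eta> i + t * x i) j = poly p t) \<longrightarrow>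
      coeff p 2 = (\<Sum>s\<in>F. W j s * l s x * l' s x)"
  proof -
    have "\<eta> \<in> coord_space I" unfolding \<eta>_def by (rule inp)
    from second_order_everywhere[OF inf comp[folded I_def \<phi>_def] this bip[unfolded is_bipoly_def]] that
    show ?thesis by blast
  qed
  \<comment> \<open>\<open>M $$ (0, h)\<close> reads transformed slice 0, the shift by
    \<open>d * m\<close> reads the block in position \<open>(0, d)\<close>, and division by
    \<open>c\<close> removes the coefficient of \<open>w\<close>.\<close>
  define W' where "W' e s = (if e \<in> matrix_ix m then
    1 / c * (\<Sum>h<p. M $$ (0, h) * W (fst e, d * m + snd e, h) s) else 0)" for e s
  have "tensor_rank (matrix_ix m) (matrix_ix m) (matrix_ix m)
    (matrix_mult m :: (nat \<times> nat \<Rightarrow> 'k) \<Rightarrow> _) \<le> 2 * card F"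
  proof (rule tensor_rank_le_polar[OF F(1), where X = I and A = A and B = B and W = W' and l = l and l' = l'])
    show "linear_form I (l s) \<and> linear_form I (l' s)" if "s \<in> F" for s using F(3) that by blast
    show "A u \<in> coord_space I" "B u \<in> coord_space I" for u unfolding A_def B_def by (rule inp)+
    show "A (\<lambda>i. u i + u' i) = (\<lambda>i. A u i + A u' i)" "B (\<lambda>i. u i + u' i) = (\<lambda>i. B u i + B u' i)" for u u'
      by (auto simp: A_def B_def inp_apply block_shift_def fun_eq_iff algebra_simps)
    show "A (\<lambda>i. c * u i) = (\<lambda>i. c * A u i)" "B (\<lambda>i. c * u i) = (\<lambda>i. c * B u i)" for c u
      by (auto simp: A_def B_def inp_apply block_shift_def fun_eq_iff algebra_simps)
    show "matrix_mult m u (\<lambda>_. 0) = (\<lambda>_. 0)" "matrix_mult m (\<lambda>_. 0) u = (\<lambda>_. 0)" for u :: "nat \<times> nat \<Rightarrow> 'k"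
      by (auto simp: fun_eq_iff matrix_mult_apply)
    show "W' e s = 0" if "e \<notin> matrix_ix m" for e s using that by (simp add: W'_def)
    fix u v :: "nat \<times> nat \<Rightarrow> 'k"
    define x where "x = (\<lambda>i. A u i + B v i)"
    have x: "x \<in> coord_space I" unfolding x_def
      using coord_space_line[of "A u" I "B v" 1] inp by (simp add: A_def B_def)
    have "\<exists>r. \<forall>t. \<phi> (\<lambda>i. \<eta> i + t * x i) j = poly r t" for j
    proof -
      obtain r where "\<And>s t. \<phi> (\<lambda>i. \<eta> i + s * 0 + t * x i) j = poly (poly r [:t:]) s"
        using bip[of "\<lambda>_. 0" x j] unfolding is_bipoly_def bipoly_def by blast
      then have "\<phi> (\<lambda>i. \<eta> i + t * x i) j = poly (map_poly (\<lambda>c. poly c 0) r) t" for t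
        unfolding poly_poly_const[symmetric] by simp
      then show ?thesis by blast
    qed
    then obtain r where r: "\<And>j t. \<phi> (\<lambda>i. \<eta> i + t * x i) j = poly (r j) t" by metis
    have "matrix_mult m u v (a, b) = (\<Sum>s\<in>F. W' (a, b) s * l s x * l' s x)" if ab: "a < m" "b < m" for a b
    proof -
      define j where "j h = (a, d * m + b, h)" for h :: nat
      have jn: "j h \<in> tensor_ix n p" if "h < p" for h
      proof -
        have "0 * m + a < Suc d * m" "d * m + b < Suc d * m"
          using ab by (intro block_index_less; simp)+
        then show ?thesis using that by (simp add: j_def tensor_ix_def n d_def)
      qed
      define e where "e = (\<Sum>z<m. u (a, z) * v (z, b))"
      \<comment> \<open>There is no linear term: other words do not reach this block, and
        \<open>w\<close> uses each of the two factors exactly once.\<close>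
      have "poly (\<Sum>h<p. smult (M $$ (0, h)) (r (j h))) t = poly [:tensor_slice M (C n) (a, d * m + b), 0, c * e:] t" for t
      proof -
        let ?Y = "block_shift m w (two_factors (\<lambda>e. t * u e) (\<lambda>e. t * v e))"
        have word: "matrix_word n ?Y z (a, d * m + b) = (if z = w then t\<^sup>2 * e else 0)" if "z \<in> Poly_Mapping.keys f" for z
          using matrix_word_block[OF w(2) keys(1)[OF that], of 0 a m b "\<lambda>e. t * u e" "\<lambda>e. t * v e"] ab
          by (simp add: n d_def e_def power2_eq_square sum_distrib_left mult_ac)
        have "poly (\<Sum>h<p. smult (M $$ (0, h)) (r (j h))) t =
            tensor_slice M (\<phi> (\<lambda>i. \<eta> i + t * x i)) (a, d * m + b)"
          using M(1) by (simp add: poly_sum r tensor_slice_def j_def)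
        also have "\<phi> (\<lambda>i. \<eta> i + t * x i) = poly_eval n M f (C n) (\<lambda>s. slice_tensor M (?Y s))"
          unfolding \<phi>_def x_def line by (simp add: inp_def)
        also have "tensor_slice M \<dots> (a, d * m + b) = tensor_slice M (C n) (a, d * m + b) +
            (\<Sum>z\<in>Poly_Mapping.keys f. Poly_Mapping.lookup f z * matrix_word n ?Y z (a, d * m + b))"
          by (rule tensor_slice_poly_eval[OF M]) (use keys in blast)
        also have "(\<Sum>z\<in>Poly_Mapping.keys f. Poly_Mapping.lookup f z * matrix_word n ?Y z (a, d * m + b)) =
            (\<Sum>z\<in>Poly_Mapping.keys f. if z = w then c * (t\<^sup>2 * e) else 0)"
          by (rule sum.cong) (simp_all add: word c_def)
        also have "\<dots> = c * (t\<^sup>2 * e)" using w(1) by simp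
        finally show ?thesis by (simp add: power2_eq_square algebra_simps)
      qed
      from poly_eq_if_infinite[OF inf this]
      have "coeff (\<Sum>h<p. smult (M $$ (0, h)) (r (j h))) 2 = c * e" by simp
      then have "c * e = (\<Sum>h<p. M $$ (0, h) * coeff (r (j h)) 2)" by (simp add: coeff_sum)
      also have "\<dots> = (\<Sum>h<p. M $$ (0, h) * (\<Sum>s\<in>F. W (j h) s * l s x * l' s x))"
        using coeff2 x jn r by (intro sum.cong) auto
      also have "\<dots> = (\<Sum>h<p. \<Sum>s\<in>F. M $$ (0, h) * W (j h) s * (l s x * l' s x))"
        by (simp add: sum_distrib_left mult.assoc)
      also have "\<dots> = (\<Sum>s\<in>F. \<Sum>h<p. M $$ (0, h) * W (j h) s * (l s x * l' s x))"
        by (rule sum.swap)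
      finally have ce: "c * e = (\<Sum>s\<in>F. \<Sum>h<p. M $$ (0, h) * W (j h) s * (l s x * l' s x))" .
      have "matrix_mult m u v (a, b) = 1 / c * (c * e)" using ab c by (simp add: matrix_mult_apply e_def)
      also have "\<dots> = (\<Sum>s\<in>F. W' (a, b) s * l s x * l' s x)"
        unfolding ce using ab
        by (simp add: W'_def matrix_ix_def j_def sum_distrib_left sum_distrib_right sum_divide_distrib mult_ac)
      finally show ?thesis .
    qed
    then have "matrix_mult m u v e = (\<Sum>s\<in>F. W' e s * l s x * l' s x)" for e
      by (cases e; cases "e \<in> matrix_ix m") (auto simp: matrix_ix_def matrix_mult_apply W'_def)
    then show "matrix_mult m u v = (\<lambda>k. \<Sum>s\<in>F. W' k s * l s (\<lambda>i. A u i + B v i) * l' s (\<lambda>i. A u i + B v i))"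
      unfolding x_def by (intro ext)
  qed
  then show ?thesis using F(2) by simp
qed

section \<open>Exponents\<close>

text \<open>An arbitrarily small loss in the exponent does not change the infimum. The upper bound
  uses this slack to absorb the constant of the O-bound.\<close>

lemma growth_exponent_le:
  assumes "\<And>\<tau> \<sigma>. (\<lambda>n. real (b n)) \<in> O(\<lambda>n. real n powr \<tau>) \<Longrightarrow> \<tau> < \<sigma> \<Longrightarrow>
    (\<lambda>n. real (a n)) \<in> O(\<lambda>n. real n powr \<sigma>)"
  shows "growth_exponent a \<le> growth_exponent b"
  unfolding growth_exponent_def[of b]
proof (rule Inf_greatest)
  fix y assume "y \<in> ereal ` {\<tau>. (\<lambda>n. real (b n)) \<in> O(\<lambda>n. real n powr \<tau>)}"
  then obtain \<tau> where \<tau>: "y = ereal \<tau>" "(\<lambda>n. real (b n)) \<in> O(\<lambda>n. real n powr \<tau>)" by auto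
  show "growth_exponent a \<le> y"
  proof (rule ereal_le_epsilon2)
    fix e :: real assume "0 < e"
    then have "growth_exponent a \<le> ereal (\<tau> + e)"
      unfolding growth_exponent_def using assms[OF \<tau>(2), of "\<tau> + e"] by (intro Inf_lower) auto
    then show "growth_exponent a \<le> y + ereal e" by (simp add: \<tau>(1))
  qed
qed

lemma growth_exponent_mono:
  assumes "\<And>\<tau>. (\<lambda>n. real (b n)) \<in> O(\<lambda>n. real n powr \<tau>) \<Longrightarrow> (\<lambda>n. real (a n)) \<in> O(\<lambda>n. real n powr \<tau>)"
  shows "growth_exponent a \<le> growth_exponent b"
  unfolding growth_exponent_def using assms by (intro Inf_superset_mono image_mono) auto

abbreviation mm_rank :: "'k::field itself \<Rightarrow> nat \<Rightarrow> nat" where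
  "mm_rank _ n \<equiv> tensor_rank (matrix_ix n) (matrix_ix n) (matrix_ix n)
    (matrix_mult n :: (nat \<times> nat \<Rightarrow> 'k) \<Rightarrow> (nat \<times> nat \<Rightarrow> 'k) \<Rightarrow> nat \<times> nat \<Rightarrow> 'k)"

lemma mm_cost_if_rank_le:
  assumes "2 \<le> m" "real (Suc (mm_rank TYPE('k::field) m)) \<le> real m powr \<sigma>"
  shows "\<exists>K. \<forall>n\<ge>1. \<exists>t. mm_cost TYPE('u) TYPE('k) n t \<and> real t \<le> K * real n powr \<sigma>
    \<and> (real n)\<^sup>2 \<le> K * real n powr \<sigma>"
proof -
  note dec = matrix_mult_rank_decomposition[of m, where 'k = 'k]
  show ?thesis
    using bilinear_scheme_if_decomposition[OF dec] matrix_mult_rank_ge[OF dec] assms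
    by (intro mm_cost_exponent[where r = "Suc (mm_rank TYPE('k) m)"]) auto
qed

lemma omega_hat_eval_eq:
  fixes M :: "'k::{conjugatable_ordered_field, field_char_0} mat"
  assumes q: "1 \<le> q" and M: "M \<in> carrier_mat q p" and rank: "vec_space.rank q M = q"
    and f: "tensor_polynomial k p f C" and nonlin: "nonlinear f"
  shows "omega_hat_eval M p k f C = omega_matrix_mult TYPE('k)"
proof (rule antisym)
  note N = pinv_full_rank[OF M rank]
  define L where "L n = total_complexity ({..<k} \<times> tensor_ix n p) (tensor_ix n p)
      (\<lambda>x. poly_eval n M f (C n) (\<lambda>s e. x (s, e)))" for n
  obtain K where K: "\<And>n t. mm_cost TYPE(nat \<times> nat \<times> nat \<times> nat \<Rightarrow> 'k) TYPE('k) n t \<Longrightarrow>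
    \<exists>P out. length P \<le> K * (t + n\<^sup>2) \<and> computes ({..<k} \<times> tensor_ix n p) (tensor_ix n p) P out
      (\<lambda>x. poly_eval n M f (C n) (\<lambda>s e. x (s, e)))"
    using eval_program[OF M N(1) f] by blast
  have L_le: "L n \<le> K * (t + n\<^sup>2)" if mm_cost: "mm_cost TYPE(nat \<times> nat \<times> nat \<times> nat \<Rightarrow> 'k) TYPE('k) n t" for n t
  proof -
    obtain P out where P: "length P \<le> K * (t + n\<^sup>2)" "computes ({..<k} \<times> tensor_ix n p) (tensor_ix n p) P out
      (\<lambda>x. poly_eval n M f (C n) (\<lambda>s e. x (s, e)))" using K[OF mm_cost] by blast
    have "L n \<le> length P" unfolding L_def total_complexity_def using P(2) by (intro Least_le) blast
    then show ?thesis using P(1) by simp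
  qed
  have ev: "omega_hat_eval M p k f C = growth_exponent L"
    by (simp add: omega_hat_eval_def omega_hat_def L_def[abs_def])
  have mm: "omega_matrix_mult TYPE('k) = growth_exponent (mm_rank TYPE('k))"
    by (simp add: omega_matrix_mult_def omega_def)
  show "omega_hat_eval M p k f C \<le> omega_matrix_mult TYPE('k)"
    unfolding ev mm
  proof (rule growth_exponent_le)
    fix \<tau> \<sigma> :: real
    assume "(\<lambda>n. real (mm_rank TYPE('k) n)) \<in> O(\<lambda>n. real n powr \<tau>)" and less: "\<tau> < \<sigma>"
    then obtain c where "\<forall>\<^sub>F m in at_top. norm (real (mm_rank TYPE('k) m)) \<le> c * norm (real m powr \<tau>)"
      by (auto elim: landau_o.bigE)
    \<comment> \<open>One large \<open>m\<close> is enough: the surplus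
      \<open>m powr (\<sigma> - \<tau>)\<close> absorbs both \<open>c\<close> and the factor 2 that
      pays for passing from the rank to rank + 1.\<close>
    moreover have "filterlim (\<lambda>m. real m powr (\<sigma> - \<tau>)) at_top at_top" using less by real_asymp
    then have "\<forall>\<^sub>F m in at_top. 2 * c \<le> real m powr (\<sigma> - \<tau>)" by (simp add: filterlim_at_top)
    ultimately have "\<forall>\<^sub>F m in at_top. 2 \<le> m \<and> norm (real (mm_rank TYPE('k) m)) \<le> c * norm (real m powr \<tau>) \<and>
        2 * c \<le> real m powr (\<sigma> - \<tau>)"
      using eventually_ge_at_top[of 2] by eventually_elim auto
    then obtain m where m: "2 \<le> m" "real (mm_rank TYPE('k) m) \<le> c * real m powr \<tau>"
      "2 * c \<le> real m powr (\<sigma> - \<tau>)"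
      by (auto simp: eventually_at_top_linorder)
    have "1 \<le> m\<^sup>2" using m(1) by simp
    also have "\<dots> \<le> mm_rank TYPE('k) m" by (rule matrix_mult_rank_ge[OF matrix_mult_rank_decomposition])
    finally have "real (Suc (mm_rank TYPE('k) m)) \<le> 2 * real (mm_rank TYPE('k) m)" by simp
    also have "\<dots> \<le> 2 * c * real m powr \<tau>" using m(2) by simp
    also have "\<dots> \<le> real m powr (\<sigma> - \<tau>) * real m powr \<tau>" using m(3) by (rule mult_right_mono) simp
    also have "\<dots> = real m powr \<sigma>" by (simp flip: powr_add)
    finally have "real (Suc (mm_rank TYPE('k) m)) \<le> real m powr \<sigma>" .
    from mm_cost_if_rank_le[OF m(1) this]
    obtain K' where K': "\<And>n. 1 \<le> n \<Longrightarrow> \<exists>t. mm_cost TYPE(nat \<times> nat \<times> nat \<times> nat \<Rightarrow> 'k) TYPE('k) n t \<and>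
      real t \<le> K' * real n powr \<sigma> \<and> (real n)\<^sup>2 \<le> K' * real n powr \<sigma>" by blast
    show "(\<lambda>n. real (L n)) \<in> O(\<lambda>n. real n powr \<sigma>)"
    proof (rule bigoI)
      show "\<forall>\<^sub>F n in at_top. norm (real (L n)) \<le> real K * (2 * K') * norm (real n powr \<sigma>)"
        using eventually_ge_at_top[of 1]
      proof eventually_elim
        case (elim n)
        obtain t where t: "mm_cost TYPE(nat \<times> nat \<times> nat \<times> nat \<Rightarrow> 'k) TYPE('k) n t"
          "real t \<le> K' * real n powr \<sigma>" "(real n)\<^sup>2 \<le> K' * real n powr \<sigma>" using K'[OF elim] by blast
        have "real (L n) \<le> real (K * (t + n\<^sup>2))" using L_le[OF t(1)] by (simp only: of_nat_le_iff)
        also have "\<dots> = real K * (real t + (real n)\<^sup>2)" by simp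
        also have "\<dots> \<le> real K * (2 * K' * real n powr \<sigma>)" using t(2,3) by (intro mult_left_mono) auto
        finally show ?case by simp
      qed
    qed
  qed
  show "omega_matrix_mult TYPE('k) \<le> omega_hat_eval M p k f C"
    unfolding ev mm
  proof (rule growth_exponent_mono)
    fix \<tau> :: real
    assume "(\<lambda>n. real (L n)) \<in> O(\<lambda>n. real n powr \<tau>)"
    then obtain c where "\<forall>\<^sub>F n in at_top. norm (real (L n)) \<le> c * norm (real n powr \<tau>)"
      by (auto elim: landau_o.bigE)
    then obtain n0 where c: "\<And>n. n0 \<le> n \<Longrightarrow> real (L n) \<le> c * real n powr \<tau>"
      by (auto simp: eventually_at_top_linorder)
    obtain w where w: "w \<in> Poly_Mapping.keys f" "2 \<le> length w" using nonlin by (auto simp: nonlinear_def)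
    obtain D where D: "\<And>v. v \<in> Poly_Mapping.keys f \<Longrightarrow> length v \<le> D"
      using finite_nat_set_iff_bounded_le[of "length ` Poly_Mapping.keys f"] by auto
    \<comment> \<open>The number of block rows, one more than the length of the word.\<close>
    define d where "d = Suc (length w)"
    have rank_le: "mm_rank TYPE('k) m \<le> 2 * (Suc D * L (d * m))" if "1 \<le> m" for m
    proof -
      \<comment> \<open>Any exponent will do; the case \<open>m = 2\<close> only shows that some
        program exists for every size, so that the \<open>LEAST\<close> in the complexity is
        attained.\<close>
      have "real (Suc (mm_rank TYPE('k) 2)) \<le> real 2 powr log 2 (Suc (mm_rank TYPE('k) 2))" by simp
      from mm_cost_if_rank_le[OF order_refl this]
      have "\<forall>n\<ge>1. \<exists>t. mm_cost TYPE(nat \<times> nat \<times> nat \<times> nat \<Rightarrow> 'k) TYPE('k) n t" by blast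
      moreover have "1 \<le> d * m" using that by (simp add: d_def)
      ultimately obtain t where "mm_cost TYPE(nat \<times> nat \<times> nat \<times> nat \<Rightarrow> 'k) TYPE('k) (d * m) t"
        by blast
      from K[OF this] have "\<exists>t P out. length P = t \<and> computes ({..<k} \<times> tensor_ix (d * m) p) (tensor_ix (d * m) p) P out
        (\<lambda>x. poly_eval (d * m) M f (C (d * m)) (\<lambda>s e. x (s, e)))" by blast
      from LeastI_ex[OF this] obtain P out where "length P = L (d * m)"
        "computes ({..<k} \<times> tensor_ix (d * m) p) (tensor_ix (d * m) p) P out
        (\<lambda>x. poly_eval (d * m) M f (C (d * m)) (\<lambda>s e. x (s, e)))"
        unfolding L_def total_complexity_def by blast
      then show ?thesis
        using matrix_rank_le_program[OF infinite_UNIV_char_0 M N q f w D, of "d * m" m P out] by (simp add: d_def)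
    qed
    show "(\<lambda>m. real (mm_rank TYPE('k) m)) \<in> O(\<lambda>m. real m powr \<tau>)"
    proof (rule bigoI)
      show "\<forall>\<^sub>F m in at_top. norm (real (mm_rank TYPE('k) m)) \<le>
          (2 * real (Suc D) * c * real d powr \<tau>) * norm (real m powr \<tau>)"
        \<comment> \<open>\<open>Suc n0\<close> ensures both \<open>1 \<le> m\<close> and
          \<open>n0 \<le> d * m\<close>.\<close>
        using eventually_ge_at_top[of "Suc n0"]
      proof eventually_elim
        case (elim m)
        have "m \<le> d * m" by (simp add: d_def)
        then have "n0 \<le> d * m" using elim by linarith
        have "real (mm_rank TYPE('k) m) \<le> real (2 * (Suc D * L (d * m)))"
          using rank_le[of m] elim by (simp only: of_nat_le_iff)
        also have "\<dots> = 2 * real (Suc D) * real (L (d * m))" by (simp only: of_nat_mult of_nat_numeral mult.assoc)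
        also have "\<dots> \<le> 2 * real (Suc D) * (c * real (d * m) powr \<tau>)"
          using c[OF \<open>n0 \<le> d * m\<close>] by (intro mult_left_mono) auto
        finally show ?case by (simp add: powr_mult mult_ac del: of_nat_Suc)
      qed
    qed
  qed
qed

lemma exponents_eq:
  fixes M :: "'k::{conjugatable_ordered_field, field_char_0} mat"
  assumes "1 \<le> q" "M \<in> carrier_mat q p" "vec_space.rank q M = q"
    and "tensor_polynomial k p f C" "nonlinear f"
  shows "omega_hat_eval M p k f C = omega_hat_tensor_mult M p \<and>
    omega_hat_tensor_mult M p = omega_matrix_mult TYPE('k)"
proof -
  have "tensor_polynomial 2 p (Poly_Mapping.single [0, 1] (1 :: 'k)) (\<lambda>_ _. 0)"
    "nonlinear (Poly_Mapping.single [0, 1] (1 :: 'k))"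
    by (auto simp: tensor_polynomial_def nonlinear_def coord_space_def)
  then show ?thesis
    using omega_hat_eval_eq[OF assms] omega_hat_eval_eq[OF assms(1-3)]
    by (simp add: omega_hat_tensor_mult_eq_eval)
qed

theorem theorem3p3:
  shows
    "(\<forall>(M :: real mat) p q k f C.
        1 \<le> q \<and> q \<le> p \<and> M \<in> carrier_mat q p \<and> vec_space.rank q M = q \<and>
        tensor_polynomial k p f C \<and> nonlinear f \<longrightarrow>
        omega_hat_eval M p k f C = omega_hat_tensor_mult M p \<and>
        omega_hat_tensor_mult M p = omega_matrix_mult TYPE(real))
     \<and>
     (\<forall>(M :: complex mat) p q k f C.
        1 \<le> q \<and> q \<le> p \<and> M \<in> carrier_mat q p \<and> vec_space.rank q M = q \<and>
        tensor_polynomial k p f C \<and> nonlinear f \<longrightarrow>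
        omega_hat_eval M p k f C = omega_hat_tensor_mult M p \<and>
        omega_hat_tensor_mult M p = omega_matrix_mult TYPE(complex))"
  by (intro conjI allI impI; elim conjE) (simp_all add: exponents_eq)

end
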